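(* The category dual (opposite) to the category of bornological $K^*$-algebras is equivalent to the category of realcompact $k_{\mathbb{C}}$-spaces.
   Context: A Tychonoff (completely regular Hausdorff) space $T$ is a $k_{\mathbb{C}}$-space if every function $T\to\mathbb{C}$ whose restriction to each compact subset of $T$ is continuous is continuous on $T$. A Tychonoff space $T$ is realcompact (a $Q$-space) if every unit-preserving $\mathbb{R}$-algebra homomorphism $\chi\colon C_{\mathbb{R}}(T)\to\mathbb{R}$, where $C_{\mathbb{R}}(T)$ is the algebra of continuous real-valued functions on $T$, is evaluation at some point of $T$. Morphisms of spaces are the continuous maps. (The empty space is allowed.) "Algebra" means commutative associative algebra over $\mathbb{C}$ with unit (the zero algebra is allowed). An involutive algebra is an algebra with a conjugate-linear map $x\mapsto x^*$ satisfying $(x^* )^*=x$, $(xy)^*=y^*x^*$. A $C^*$-seminorm is a seminorm $p$ with $p(xx^* )=p(x)^2$ for all $x$. A $K^*$-algebra is an involutive algebra with a complete Hausdorff topology defined by a family of $C^*$-seminorms; it is bornological if its underlying locally convex space is bornological. Morphisms are the continuous unit-preserving algebra homomorphisms $u$ with $u(x^* )=u(x)^*$ (full subcategory). *)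

theory Defs
  imports "HOL-Analysis.Analysis" "HOL-Algebra.Module" "HOL-Library.Equipollence"
begin

section \<open>Categories\<close>

text \<open>Hom-sets of different pairs of objects may overlap, so composition and the action of a functor
  on morphisms take the objects involved as arguments:
  \<open>Comp X A B C g f\<close> is the composite of \<open>f \<in> Hom X A B\<close> and \<open>g \<in> Hom X B C\<close>.\<close>

record ('o, 'm) cat =
  Obj :: "'o set"
  Hom :: "'o \<Rightarrow> 'o \<Rightarrow> 'm set"
  Ident :: "'o \<Rightarrow> 'm"
  Comp :: "'o \<Rightarrow> 'o \<Rightarrow> 'o \<Rightarrow> 'm \<Rightarrow> 'm \<Rightarrow> 'm"

locale category =
  fixes X :: "('o, 'm) cat"
  assumes Ident_in_Hom: "A \<in> Obj X \<Longrightarrow> Ident X A \<in> Hom X A A"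
    and Comp_in_Hom:
      "\<lbrakk>A \<in> Obj X; B \<in> Obj X; C \<in> Obj X; f \<in> Hom X A B; g \<in> Hom X B C\<rbrakk>
        \<Longrightarrow> Comp X A B C g f \<in> Hom X A C"
    and Comp_Ident_right:
      "\<lbrakk>A \<in> Obj X; B \<in> Obj X; f \<in> Hom X A B\<rbrakk> \<Longrightarrow> Comp X A A B f (Ident X A) = f"
    and Comp_Ident_left:
      "\<lbrakk>A \<in> Obj X; B \<in> Obj X; f \<in> Hom X A B\<rbrakk> \<Longrightarrow> Comp X A B B (Ident X B) f = f"
    and Comp_assoc:
      "\<lbrakk>A \<in> Obj X; B \<in> Obj X; C \<in> Obj X; D \<in> Obj X;
        f \<in> Hom X A B; g \<in> Hom X B C; h \<in> Hom X C D\<rbrakk>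
        \<Longrightarrow> Comp X A C D h (Comp X A B C g f) = Comp X A B D (Comp X B C D h g) f"

definition opposite :: "('o, 'm) cat \<Rightarrow> ('o, 'm) cat" where
  "opposite X = \<lparr>Obj = Obj X, Hom = (\<lambda>A B. Hom X B A), Ident = Ident X,
     Comp = (\<lambda>A B C g f. Comp X C B A f g)\<rparr>"

record ('o, 'm, 'p, 'n) cat_functor =
  on_Obj :: "'o \<Rightarrow> 'p"
  on_Hom :: "'o \<Rightarrow> 'o \<Rightarrow> 'm \<Rightarrow> 'n"

locale is_functor = X: category X + Y: category Y
  for X :: "('o, 'm) cat" and Y :: "('p, 'n) cat" and F :: "('o, 'm, 'p, 'n) cat_functor" +
  assumes on_Obj: "A \<in> Obj X \<Longrightarrow> on_Obj F A \<in> Obj Y"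
    and on_Hom: "\<lbrakk>A \<in> Obj X; B \<in> Obj X; f \<in> Hom X A B\<rbrakk>
        \<Longrightarrow> on_Hom F A B f \<in> Hom Y (on_Obj F A) (on_Obj F B)"
    and on_Ident: "A \<in> Obj X \<Longrightarrow> on_Hom F A A (Ident X A) = Ident Y (on_Obj F A)"
    and on_Comp:
      "\<lbrakk>A \<in> Obj X; B \<in> Obj X; C \<in> Obj X; f \<in> Hom X A B; g \<in> Hom X B C\<rbrakk>
        \<Longrightarrow> on_Hom F A C (Comp X A B C g f)
          = Comp Y (on_Obj F A) (on_Obj F B) (on_Obj F C) (on_Hom F B C g) (on_Hom F A B f)"

definition id_functor :: "('o, 'm, 'o, 'm) cat_functor" where
  "id_functor = \<lparr>on_Obj = (\<lambda>A. A), on_Hom = (\<lambda>A B f. f)\<rparr>"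

definition comp_functor ::
    "('p, 'n, 'q, 'l) cat_functor \<Rightarrow> ('o, 'm, 'p, 'n) cat_functor \<Rightarrow> ('o, 'm, 'q, 'l) cat_functor" where
  "comp_functor G F = \<lparr>on_Obj = (\<lambda>A. on_Obj G (on_Obj F A)),
     on_Hom = (\<lambda>A B f. on_Hom G (on_Obj F A) (on_Obj F B) (on_Hom F A B f))\<rparr>"

definition iso_in :: "('o, 'm) cat \<Rightarrow> 'o \<Rightarrow> 'o \<Rightarrow> 'm \<Rightarrow> bool" where
  "iso_in X A B f \<longleftrightarrow> f \<in> Hom X A B \<and>
     (\<exists>g \<in> Hom X B A. Comp X A B A g f = Ident X A \<and> Comp X B A B f g = Ident X B)"

definition naturally_isomorphic ::
    "('o, 'm) cat \<Rightarrow> ('p, 'n) cat \<Rightarrow> ('o, 'm, 'p, 'n) cat_functor \<Rightarrow> ('o, 'm, 'p, 'n) cat_functor \<Rightarrow> bool"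
  where
  "naturally_isomorphic X Y F G \<longleftrightarrow> (\<exists>\<eta>.
     (\<forall>A \<in> Obj X. iso_in Y (on_Obj F A) (on_Obj G A) (\<eta> A)) \<and>
     (\<forall>A \<in> Obj X. \<forall>B \<in> Obj X. \<forall>f \<in> Hom X A B.
        Comp Y (on_Obj F A) (on_Obj F B) (on_Obj G B) (\<eta> B) (on_Hom F A B f)
        = Comp Y (on_Obj F A) (on_Obj G A) (on_Obj G B) (on_Hom G A B f) (\<eta> A)))"

definition equivalent_categories :: "('o, 'm) cat \<Rightarrow> ('p, 'n) cat \<Rightarrow> bool" where
  "equivalent_categories X Y \<longleftrightarrow> (\<exists>F G. is_functor X Y F \<and> is_functor Y X G \<and>
     naturally_isomorphic X X (comp_functor G F) id_functor \<and>
     naturally_isomorphic Y Y (comp_functor F G) id_functor)"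

text \<open>The properties of a set-theoretic universe that are used here, for the family of small subsets
  of a fixed type. For example, the sets of cardinality less than that of the type form a universe
  whenever that cardinality is an uncountable strong limit.\<close>

definition universe :: "'u set set \<Rightarrow> bool" where
  "universe \<U> \<longleftrightarrow>
     (\<exists>X \<in> \<U>. infinite X) \<and>
     (\<forall>X \<in> \<U>. \<forall>Y. Y \<lesssim> X \<longrightarrow> Y \<in> \<U>) \<and>
     (\<forall>X \<in> \<U>. \<exists>Y \<in> \<U>. Pow X \<lesssim> Y)"


section \<open>Realcompact $k_{\mathbb{C}}$-spaces\<close>

definition Tychonoff_space :: "'b topology \<Rightarrow> bool" where
  "Tychonoff_space T \<longleftrightarrow> completely_regular_space T \<and> Hausdorff_space T"

definition kC_space :: "'b topology \<Rightarrow> bool" where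
  "kC_space T \<longleftrightarrow> Tychonoff_space T \<and>
     (\<forall>f :: 'b \<Rightarrow> complex.
        (\<forall>K. compactin T K \<longrightarrow> continuous_map (subtopology T K) euclidean f)
        \<longrightarrow> continuous_map T euclidean f)"

text \<open>Functions on a space (and morphisms below) are represented by extensional functions, so that
  equality as maps is equality in HOL.\<close>

definition real_continuous_functions :: "'b topology \<Rightarrow> ('b \<Rightarrow> real) set" where
  "real_continuous_functions T = {f \<in> extensional (topspace T). continuous_map T euclidean f}"

definition real_character :: "'b topology \<Rightarrow> (('b \<Rightarrow> real) \<Rightarrow> real) \<Rightarrow> bool" where
  "real_character T h \<longleftrightarrow>
     (\<forall>f \<in> real_continuous_functions T. \<forall>g \<in> real_continuous_functions T.
        h (\<lambda>t \<in> topspace T. f t + g t) = h f + h g \<and>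
        h (\<lambda>t \<in> topspace T. f t * g t) = h f * h g) \<and>
     (\<forall>c. \<forall>f \<in> real_continuous_functions T. h (\<lambda>t \<in> topspace T. c * f t) = c * h f) \<and>
     h (\<lambda>t \<in> topspace T. 1) = 1"

definition realcompact_space :: "'b topology \<Rightarrow> bool" where
  "realcompact_space T \<longleftrightarrow> Tychonoff_space T \<and>
     (\<forall>h. real_character T h \<longrightarrow>
        (\<exists>t \<in> topspace T. \<forall>f \<in> real_continuous_functions T. h f = f t))"

definition realcompact_kC_cat :: "'b set set \<Rightarrow> ('b topology, 'b \<Rightarrow> 'b) cat" where
  "realcompact_kC_cat \<U> =
     \<lparr>Obj = {T. topspace T \<in> \<U> \<and> realcompact_space T \<and> kC_space T},
      Hom = (\<lambda>T S. {g \<in> extensional (topspace T). continuous_map T S g}),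
      Ident = (\<lambda>T. \<lambda>t \<in> topspace T. t),
      Comp = (\<lambda>T S R h g. compose (topspace T) h g)\<rparr>"


section \<open>$K^*$-algebras\<close>

definition complex_ring :: "complex ring" where
  "complex_ring = \<lparr>carrier = UNIV, monoid.mult = (*), one = 1, zero = 0, add = (+)\<rparr>"

record 'a star_algebra = "(complex, 'a) module" +
  star :: "'a \<Rightarrow> 'a"

record 'a top_star_algebra = "'a star_algebra" +
  topo :: "'a topology"

locale involutive_algebra = algebra complex_ring A for A :: "('a, 'm) star_algebra_scheme" (structure) +
  assumes star_closed: "x \<in> carrier A \<Longrightarrow> star A x \<in> carrier A"
    and star_add: "\<lbrakk>x \<in> carrier A; y \<in> carrier A\<rbrakk> \<Longrightarrow> star A (x \<oplus> y) = star A x \<oplus> star A y"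
    and star_smult: "x \<in> carrier A \<Longrightarrow> star A (c \<odot> x) = cnj c \<odot> star A x"
    and star_star: "x \<in> carrier A \<Longrightarrow> star A (star A x) = x"
    and star_mult: "\<lbrakk>x \<in> carrier A; y \<in> carrier A\<rbrakk> \<Longrightarrow> star A (x \<otimes> y) = star A y \<otimes> star A x"

definition Cstar_seminorm :: "('a, 'm) star_algebra_scheme \<Rightarrow> ('a \<Rightarrow> real) \<Rightarrow> bool" where
  "Cstar_seminorm A p \<longleftrightarrow>
     (\<forall>x \<in> carrier A. \<forall>y \<in> carrier A. p (x \<oplus>\<^bsub>A\<^esub> y) \<le> p x + p y) \<and>
     (\<forall>c. \<forall>x \<in> carrier A. p (c \<odot>\<^bsub>A\<^esub> x) = cmod c * p x) \<and>
     (\<forall>x \<in> carrier A. p (x \<otimes>\<^bsub>A\<^esub> star A x) = (p x)\<^sup>2)"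

definition seminorm_topology ::
    "('a, 'm) star_algebra_scheme \<Rightarrow> ('a \<Rightarrow> real) set \<Rightarrow> 'a topology" where
  "seminorm_topology A P = topology (\<lambda>U. U \<subseteq> carrier A \<and>
     (\<forall>x \<in> U. \<exists>F e. finite F \<and> F \<subseteq> P \<and> e > 0 \<and>
        {y \<in> carrier A. \<forall>p \<in> F. p (y \<ominus>\<^bsub>A\<^esub> x) < e} \<subseteq> U))"

lemma openin_seminorm_topology:
  "openin (seminorm_topology A P) U \<longleftrightarrow> U \<subseteq> carrier A \<and>
     (\<forall>x \<in> U. \<exists>F e. finite F \<and> F \<subseteq> P \<and> e > 0 \<and>
        {y \<in> carrier A. \<forall>p \<in> F. p (y \<ominus>\<^bsub>A\<^esub> x) < e} \<subseteq> U)"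
proof -
  let ?B = "\<lambda>F e x. {y \<in> carrier A. \<forall>p \<in> F. p (y \<ominus>\<^bsub>A\<^esub> x) < (e::real)}"
  define Q where "Q U \<longleftrightarrow> U \<subseteq> carrier A \<and>
    (\<forall>x \<in> U. \<exists>F e. finite F \<and> F \<subseteq> P \<and> e > 0 \<and> ?B F e x \<subseteq> U)" for U
  have inter: "Q (S \<inter> T)" if S: "Q S" and T: "Q T" for S T
    unfolding Q_def
  proof (intro conjI ballI)
    show "S \<inter> T \<subseteq> carrier A" using S by (auto simp: Q_def)
    fix x assume x: "x \<in> S \<inter> T"
    from S x have "\<exists>F e. finite F \<and> F \<subseteq> P \<and> e > 0 \<and> ?B F e x \<subseteq> S"
      by (simp add: Q_def)
    then obtain F e where F: "finite F" "F \<subseteq> P" "e > 0" "?B F e x \<subseteq> S"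
      by (elim exE conjE)
    from T x have "\<exists>F e. finite F \<and> F \<subseteq> P \<and> e > 0 \<and> ?B F e x \<subseteq> T"
      by (simp add: Q_def)
    then obtain G d where G: "finite G" "G \<subseteq> P" "d > 0" "?B G d x \<subseteq> T"
      by (elim exE conjE)
    have "?B (F \<union> G) (min e d) x \<subseteq> ?B F e x \<inter> ?B G d x"
      by auto
    with F(4) G(4) have "?B (F \<union> G) (min e d) x \<subseteq> S \<inter> T"
      by (meson Int_mono order_trans)
    with F G show "\<exists>F e. finite F \<and> F \<subseteq> P \<and> e > 0 \<and> ?B F e x \<subseteq> S \<inter> T"
      by (intro exI[of _ "F \<union> G"] exI[of _ "min e d"] conjI) simp_all
  qed
  have union: "Q (\<Union>\<K>)" if \<K>: "\<forall>K \<in> \<K>. Q K" for \<K>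
    unfolding Q_def
  proof (intro conjI ballI)
    show "\<Union>\<K> \<subseteq> carrier A" using \<K> by (auto simp: Q_def)
    fix x assume "x \<in> \<Union>\<K>"
    then obtain K where K: "K \<in> \<K>" "x \<in> K" by (elim UnionE)
    with \<K> have "\<exists>F e. finite F \<and> F \<subseteq> P \<and> e > 0 \<and> ?B F e x \<subseteq> K"
      by (simp add: Q_def)
    then obtain F e where F: "finite F" "F \<subseteq> P" "e > 0" "?B F e x \<subseteq> K"
      by (elim exE conjE)
    with Union_upper[OF K(1)] show "\<exists>F e. finite F \<and> F \<subseteq> P \<and> e > 0 \<and> ?B F e x \<subseteq> \<Union>\<K>"
      by (intro exI[of _ F] exI[of _ e] conjI) simp_all
  qed
  have "istopology Q"
    using inter union by (simp add: istopology_def)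
  then have "openin (topology Q) U \<longleftrightarrow> Q U"
    by (simp add: topology_inverse')
  then show ?thesis
    by (simp add: seminorm_topology_def Q_def[abs_def])
qed

definition Cauchy_filter :: "('a, 'm) top_star_algebra_scheme \<Rightarrow> 'a filter \<Rightarrow> bool" where
  "Cauchy_filter A \<F> \<longleftrightarrow> \<F> \<noteq> bot \<and>
     (\<forall>U. openin (topo A) U \<and> \<zero>\<^bsub>A\<^esub> \<in> U \<longrightarrow>
        (\<exists>S \<subseteq> carrier A. eventually (\<lambda>x. x \<in> S) \<F> \<and> (\<forall>x \<in> S. \<forall>y \<in> S. x \<ominus>\<^bsub>A\<^esub> y \<in> U)))"

definition complete_algebra :: "('a, 'm) top_star_algebra_scheme \<Rightarrow> bool" where
  "complete_algebra A \<longleftrightarrow> (\<forall>\<F>. Cauchy_filter A \<F> \<longrightarrow> (\<exists>l. limitin (topo A) (\<lambda>x. x) l \<F>))"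

definition Kstar_algebra :: "('a, 'm) top_star_algebra_scheme \<Rightarrow> bool" where
  "Kstar_algebra A \<longleftrightarrow> involutive_algebra A \<and>
     (\<exists>P. (\<forall>p \<in> P. Cstar_seminorm A p) \<and> topo A = seminorm_topology A P) \<and>
     Hausdorff_space (topo A) \<and> complete_algebra A"

definition absorbs :: "('a, 'm) top_star_algebra_scheme \<Rightarrow> 'a set \<Rightarrow> 'a set \<Rightarrow> bool" where
  "absorbs A V B \<longleftrightarrow>
     (\<exists>r > 0. \<forall>c :: complex. cmod c \<ge> r \<longrightarrow> B \<subseteq> (\<lambda>v. c \<odot>\<^bsub>A\<^esub> v) ` V)"

definition bounded_subset :: "('a, 'm) top_star_algebra_scheme \<Rightarrow> 'a set \<Rightarrow> bool" where
  "bounded_subset A B \<longleftrightarrow> B \<subseteq> carrier A \<and>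
     (\<forall>U. openin (topo A) U \<and> \<zero>\<^bsub>A\<^esub> \<in> U \<longrightarrow> absorbs A U B)"

definition absolutely_convex :: "('a, 'm) top_star_algebra_scheme \<Rightarrow> 'a set \<Rightarrow> bool" where
  "absolutely_convex A V \<longleftrightarrow> V \<subseteq> carrier A \<and>
     (\<forall>x \<in> V. \<forall>y \<in> V. \<forall>a b :: complex. cmod a + cmod b \<le> 1 \<longrightarrow>
        a \<odot>\<^bsub>A\<^esub> x \<oplus>\<^bsub>A\<^esub> b \<odot>\<^bsub>A\<^esub> y \<in> V)"

definition bornological :: "('a, 'm) top_star_algebra_scheme \<Rightarrow> bool" where
  "bornological A \<longleftrightarrow>
     (\<forall>V. absolutely_convex A V \<and> (\<forall>B. bounded_subset A B \<longrightarrow> absorbs A V B) \<longrightarrow>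
        (\<exists>U. openin (topo A) U \<and> \<zero>\<^bsub>A\<^esub> \<in> U \<and> U \<subseteq> V))"

text \<open>Source and target may live on different types.\<close>

definition Kstar_hom ::
    "('a, 'm) top_star_algebra_scheme \<Rightarrow> ('b, 'n) top_star_algebra_scheme \<Rightarrow> ('a \<Rightarrow> 'b) set" where
  "Kstar_hom A B = {u \<in> ring_hom A B. u \<in> extensional (carrier A) \<and>
     (\<forall>c. \<forall>x \<in> carrier A. u (c \<odot>\<^bsub>A\<^esub> x) = c \<odot>\<^bsub>B\<^esub> u x) \<and>
     (\<forall>x \<in> carrier A. u (star A x) = star B (u x)) \<and>
     continuous_map (topo A) (topo B) u}"

definition Kstar_iso ::
    "('a, 'm) top_star_algebra_scheme \<Rightarrow> ('b, 'n) top_star_algebra_scheme \<Rightarrow> ('a \<Rightarrow> 'b) \<Rightarrow> bool" where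
  "Kstar_iso A B u \<longleftrightarrow> u \<in> Kstar_hom A B \<and>
     (\<exists>v \<in> Kstar_hom B A. (\<forall>x \<in> carrier A. v (u x) = x) \<and> (\<forall>y \<in> carrier B. u (v y) = y))"

definition bornological_Kstar_cat :: "'a set set \<Rightarrow> ('a top_star_algebra, 'a \<Rightarrow> 'a) cat" where
  "bornological_Kstar_cat \<U> =
     \<lparr>Obj = {A. carrier A \<in> \<U> \<and> Kstar_algebra A \<and> bornological A},
      Hom = Kstar_hom,
      Ident = (\<lambda>A. \<lambda>x \<in> carrier A. x),
      Comp = (\<lambda>A B C v u. compose (carrier A) v u)\<rparr>"


section \<open>The function algebra and the spectrum\<close>

definition cont_star_algebra :: "'b topology \<Rightarrow> ('b \<Rightarrow> complex) star_algebra" where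
  "cont_star_algebra T =
     \<lparr>carrier = {f \<in> extensional (topspace T). continuous_map T euclidean f},
      monoid.mult = (\<lambda>f g. \<lambda>t \<in> topspace T. f t * g t),
      one = (\<lambda>t \<in> topspace T. 1),
      zero = (\<lambda>t \<in> topspace T. 0),
      add = (\<lambda>f g. \<lambda>t \<in> topspace T. f t + g t),
      smult = (\<lambda>c f. \<lambda>t \<in> topspace T. c * f t),
      star = (\<lambda>f. \<lambda>t \<in> topspace T. cnj (f t))\<rparr>"

text \<open>Inserting 0 gives the right value for the empty set.\<close>

definition sup_seminorm :: "'b set \<Rightarrow> ('b \<Rightarrow> complex) \<Rightarrow> real" where
  "sup_seminorm K f = Sup (insert 0 ((\<lambda>t. cmod (f t)) ` K))"

text \<open>The algebra of continuous complex functions, with the compact-open topology.\<close>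

definition cont_algebra :: "'b topology \<Rightarrow> ('b \<Rightarrow> complex) top_star_algebra" where
  "cont_algebra T = star_algebra.extend (cont_star_algebra T)
     (top_star_algebra.fields
        (seminorm_topology (cont_star_algebra T) (sup_seminorm ` {K. compactin T K})))"

definition cont_functor ::
    "('b topology, 'b \<Rightarrow> 'b, ('b \<Rightarrow> complex) top_star_algebra, ('b \<Rightarrow> complex) \<Rightarrow> ('b \<Rightarrow> complex)) cat_functor"
  where
  "cont_functor = \<lparr>on_Obj = cont_algebra,
     on_Hom = (\<lambda>T S g. \<lambda>f \<in> carrier (cont_algebra S). \<lambda>t \<in> topspace T. f (g t))\<rparr>"

definition complex_Kstar :: "complex top_star_algebra" where
  "complex_Kstar =
     \<lparr>carrier = UNIV, monoid.mult = (*), one = 1, zero = 0, add = (+),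
      smult = (*), star = cnj, topo = euclidean\<rparr>"

text \<open>The characters, with the topology of pointwise convergence.\<close>

definition spectrum :: "('a, 'm) top_star_algebra_scheme \<Rightarrow> ('a \<Rightarrow> complex) topology" where
  "spectrum A = subtopology (product_topology (\<lambda>_. euclidean) (carrier A)) (Kstar_hom A complex_Kstar)"

definition spectrum_functor ::
    "('a top_star_algebra, 'a \<Rightarrow> 'a, ('a \<Rightarrow> complex) topology, ('a \<Rightarrow> complex) \<Rightarrow> ('a \<Rightarrow> complex)) cat_functor"
  where
  "spectrum_functor = \<lparr>on_Obj = spectrum,
     on_Hom = (\<lambda>A B u. \<lambda>\<phi> \<in> topspace (spectrum A). \<lambda>x \<in> carrier B. \<phi> (u x))\<rparr>"

text \<open>No type is closed under passing from a space to its function algebra (or from an algebra to its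
  spectrum), so these functors raise the type. The two composites are therefore compared with the
  identity functor through isomorphisms between objects on different types: the next two definitions
  spell out that a composite of the two functors is naturally isomorphic to the identity functor.\<close>

definition natural_Kstar_iso_double_dual ::
    "('a top_star_algebra \<Rightarrow> 'a \<Rightarrow> (('a \<Rightarrow> complex) \<Rightarrow> complex)) \<Rightarrow> bool" where
  "natural_Kstar_iso_double_dual \<eta> \<longleftrightarrow>
     (let X = opposite (bornological_Kstar_cat UNIV); CS = comp_functor cont_functor spectrum_functor in
       (\<forall>A \<in> Obj X. Kstar_iso A (on_Obj CS A) (\<eta> A)) \<and>
       (\<forall>A \<in> Obj X. \<forall>B \<in> Obj X. \<forall>u \<in> Hom X A B. \<forall>x \<in> carrier B.
          \<eta> A (u x) = on_Hom CS A B u (\<eta> B x)))"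

definition natural_homeomorphism_double_dual ::
    "('b topology \<Rightarrow> 'b \<Rightarrow> (('b \<Rightarrow> complex) \<Rightarrow> complex)) \<Rightarrow> bool" where
  "natural_homeomorphism_double_dual \<epsilon> \<longleftrightarrow>
     (let Y = realcompact_kC_cat UNIV; SC = comp_functor spectrum_functor cont_functor in
       (\<forall>T \<in> Obj Y. homeomorphic_map T (on_Obj SC T) (\<epsilon> T)) \<and>
       (\<forall>T \<in> Obj Y. \<forall>S \<in> Obj Y. \<forall>g \<in> Hom Y T S. \<forall>t \<in> topspace T.
          \<epsilon> S (g t) = on_Hom SC T S g (\<epsilon> T t)))"

end

theory Submission
  imports Defs
begin

text \<open>On a commutative involutive algebra a $C^*$-seminorm \<open>p\<close> is automatically submultiplicative, and it is
  the supremum of the moduli of the characters it dominates. Indeed, \<open>y \<mapsto> lim p (b\<^sup>n y) / p (b)\<^sup>n\<close> with \<open>b = a a\<^sup>*\<close> is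
  a smaller $C^*$-seminorm on which multiplication by \<open>a\<close> acts by a constant factor, so a minimal $C^*$-seminorm is
  multiplicative, and by Gelfand--Mazur it is the modulus of a character.

  By Stone--Weierstrass and completeness, a $K^*$-algebra therefore consists of the functions on its spectrum
  that are continuous on each equicontinuous set. If the algebra is bornological, every $C^*$-seminorm on it
  is continuous. For the suprema over compact sets this says that the topology is the compact-open one, and
  for the moduli of arbitrary characters it says that the spectrum is realcompact.

  Conversely, let \<open>T\<close> be realcompact and let \<open>V\<close> be an absolutely convex bornivorous set of continuous
  functions. The essential supremum with respect to \<open>V\<close> is a $C^*$-seminorm; the characters it dominates are
  the points of a compact set \<open>K\<close>, and \<open>V\<close> contains all functions that are small enough on \<open>K\<close>
  (Nachbin--Shirota).\<close>

section \<open>Characters of commutative algebras with a $C^*$-seminorm\<close>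

text \<open>The algebra need not be complete for a given C*-seminorm, and for an arbitrary
  C*-seminorm continuity is only a late conclusion. Resolvents and the spectral radius are therefore
  replaced by estimates on powers with exponent \<open>2 ^ n\<close>, for which the C*-identity is
  an exact equality on selfadjoint elements; error constants disappear after taking roots. The real
  characters in the definition of a realcompact space carry no continuity. This is why characters
  are treated as purely algebraic objects, and why continuity is proved for all C*-seminorms and not
  only for those of a defining family. The k_C-condition is what makes the limit of a Cauchy filter
  of functions continuous; conversely the spectrum satisfies it because its equicontinuous sets are
  compact. The equivalence inside one type uses the spectrum functor alone, moved to small copies of
  the spectra and shown to be full, faithful and essentially surjective. Closure of a universe under
  power sets makes room for these copies and for those of the function algebras.\<close>

text \<open>If \<open>b < a\<close>, the powers of the ratio \<open>a / b\<close> outgrow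
  \<open>C\<close>. This removes the constant from any estimate that holds for all
  \<open>2 ^ n\<close>-th powers of a selfadjoint element.\<close>

lemma le_of_iterated_squares_le:
  fixes a b C :: real
  assumes "0 \<le> a" "0 \<le> b" "\<And>n. a ^ (2 ^ n) \<le> C * b ^ (2 ^ n)"
  shows "a \<le> b"
proof (rule ccontr)
  assume "\<not> a \<le> b"
  then have ab: "b < a" by simp
  show False
  proof (cases "b = 0")
    case True
    then show False using assms(3)[of 0] ab by simp
  next
    case False
    then have b: "0 < b" using assms by simp
    define q where "q = a / b"
    have q: "1 < q" using ab b by (simp add: q_def)
    have "q ^ (2 ^ n) \<le> C" for n
      using assms(3)[of n] b by (simp add: q_def power_divide divide_le_eq)
    moreover obtain n where n: "C < q ^ n" using real_arch_pow[OF q] by blast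
    moreover have "q ^ n \<le> q ^ (2 ^ n)"
      using q by (intro power_increasing) (auto intro: less_imp_le less_exp)
    ultimately show False by (meson not_less order_trans)
  qed
qed

lemma complex_ring_simps [simp]:
  "carrier complex_ring = UNIV" "x \<otimes>\<^bsub>complex_ring\<^esub> y = x * y" "\<one>\<^bsub>complex_ring\<^esub> = 1"
  "\<zero>\<^bsub>complex_ring\<^esub> = 0" "x \<oplus>\<^bsub>complex_ring\<^esub> y = x + y"
  by (simp_all add: complex_ring_def)

lemma cring_complex_ring: "cring complex_ring"
  by (unfold_locales)
    (auto simp: algebra_simps Units_def intro: exI[of _ "- x" for x] add.right_inverse add.left_inverse)

lemma complex_ring_uminus [simp]: "\<ominus>\<^bsub>complex_ring\<^esub> x = - x"
proof -
  interpret cring complex_ring by (rule cring_complex_ring)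
  show ?thesis by (rule minus_equality) simp_all
qed

section \<open>Scalars, involution and selfadjoint elements\<close>

context involutive_algebra
begin

lemma sm_closed [simp, intro]: "x \<in> carrier A \<Longrightarrow> c \<odot> x \<in> carrier A"
  by simp

lemma sm_add_left: "x \<in> carrier A \<Longrightarrow> (c + d) \<odot> x = c \<odot> x \<oplus> d \<odot> x"
  using smult_l_distr[of c d x] by simp

lemma sm_add_right: "\<lbrakk>x \<in> carrier A; y \<in> carrier A\<rbrakk> \<Longrightarrow> c \<odot> (x \<oplus> y) = c \<odot> x \<oplus> c \<odot> y"
  using smult_r_distr[of c x y] by simp

lemma sm_sm: "x \<in> carrier A \<Longrightarrow> c \<odot> (d \<odot> x) = (c * d) \<odot> x"
  using smult_assoc1[of c d x] by simp

lemma sm_one [simp]: "x \<in> carrier A \<Longrightarrow> 1 \<odot> x = x"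
  using smult_one[of x] by simp

lemma sm_mult_left: "\<lbrakk>x \<in> carrier A; y \<in> carrier A\<rbrakk> \<Longrightarrow> (c \<odot> x) \<otimes> y = c \<odot> (x \<otimes> y)"
  using smult_assoc2[of c x y] by simp

lemma sm_mult_right: "\<lbrakk>x \<in> carrier A; y \<in> carrier A\<rbrakk> \<Longrightarrow> x \<otimes> (c \<odot> y) = c \<odot> (x \<otimes> y)"
  using sm_mult_left[of y x c] by (simp add: m_comm)

lemma sm_zero_left [simp]: "x \<in> carrier A \<Longrightarrow> 0 \<odot> x = \<zero>"
  using smult_l_null[of x] by simp

lemma sm_zero_right [simp]: "c \<odot> \<zero> = \<zero>"
  using smult_r_null[of c] by simp

lemma uminus_eq_sm: "x \<in> carrier A \<Longrightarrow> \<ominus> x = (- 1) \<odot> x"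
  using smult_l_minus[of 1 x] by simp

lemma minus_eq_sm: "y \<in> carrier A \<Longrightarrow> x \<ominus> y = x \<oplus> (- 1) \<odot> y"
  by (simp add: minus_eq uminus_eq_sm)

lemma sm_sum: "\<lbrakk>x \<in> carrier A; c + d = e\<rbrakk> \<Longrightarrow> c \<odot> x \<oplus> d \<odot> x = e \<odot> x"
  by (auto simp: sm_add_left)

declare star_closed [simp]

lemma star_zero [simp]: "star A \<zero> = \<zero>"
  using star_smult[of \<zero> 0] by simp

lemma star_one [simp]: "star A \<one> = \<one>"
proof -
  \<comment> \<open>The left side is \<open>\<one>\<close> because \<open>star\<close> is
    involutive, the right side is \<open>star A \<one>\<close>.\<close>
  have "star A (star A \<one> \<otimes> \<one>) = star A \<one> \<otimes> star A (star A \<one>)"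
    by (rule star_mult) simp_all
  then show ?thesis by (simp add: star_star)
qed

definition selfadjoint :: "'a \<Rightarrow> bool" where
  "selfadjoint x \<longleftrightarrow> x \<in> carrier A \<and> star A x = x"

lemma selfadjoint_mult: "\<lbrakk>selfadjoint x; selfadjoint y\<rbrakk> \<Longrightarrow> selfadjoint (x \<otimes> y)"
  by (simp add: selfadjoint_def star_mult m_comm)

lemma selfadjoint_mult_star: "x \<in> carrier A \<Longrightarrow> selfadjoint (x \<otimes> star A x)"
  by (simp add: selfadjoint_def star_mult star_star)

lemma selfadjoint_pow: "selfadjoint x \<Longrightarrow> selfadjoint (x [^] (n::nat))"
  by (induction n) (auto simp: selfadjoint_def star_mult m_comm)

text \<open>The C*-identity controls squares of selfadjoint elements; this expresses a product
  through squares.\<close>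

lemma polarisation:
  assumes a: "a \<in> carrier A" and b: "b \<in> carrier A"
  shows "4 \<odot> (a \<otimes> b) = (a \<oplus> b) \<otimes> (a \<oplus> b) \<ominus> (a \<ominus> b) \<otimes> (a \<ominus> b)"
proof -
  have "(a \<oplus> b) \<otimes> (a \<oplus> b) \<ominus> (a \<ominus> b) \<otimes> (a \<ominus> b) = (a \<otimes> b \<oplus> a \<otimes> b) \<oplus> (a \<otimes> b \<oplus> a \<otimes> b)"
    using a b by algebra
  also have "\<dots> = 4 \<odot> (a \<otimes> b)"
    using sm_sum[of "a \<otimes> b" 1 1 2] sm_sum[of "a \<otimes> b" 2 2 4] a b by simp
  finally show ?thesis by simp
qed

lemma add_cancel_middle: "\<lbrakk>x \<in> carrier A; y \<in> carrier A; z \<in> carrier A\<rbrakk> \<Longrightarrow> (x \<ominus> y) \<oplus> (y \<ominus> z) = x \<ominus> z"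
  by algebra

end

section \<open>A single C*-seminorm and its submultiplicativity\<close>

locale Cstar_seminormed_algebra = involutive_algebra A for A :: "('a, 'm) star_algebra_scheme" (structure) +
  fixes p :: "'a \<Rightarrow> real"
  assumes Cstar_seminorm: "Cstar_seminorm A p"
begin

lemma p_add: "\<lbrakk>x \<in> carrier A; y \<in> carrier A\<rbrakk> \<Longrightarrow> p (x \<oplus> y) \<le> p x + p y"
  and p_sm: "x \<in> carrier A \<Longrightarrow> p (c \<odot> x) = cmod c * p x"
  and p_mult_star: "x \<in> carrier A \<Longrightarrow> p (x \<otimes> star A x) = (p x)\<^sup>2"
  using Cstar_seminorm by (auto simp: Cstar_seminorm_def)

lemma p_zero [simp]: "p \<zero> = 0"
  using p_sm[of \<zero> 0] by simp

lemma p_uminus: "x \<in> carrier A \<Longrightarrow> p (\<ominus> x) = p x"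
  using p_sm[of x "-1"] by (simp add: uminus_eq_sm)

lemma p_nonneg [simp]: "x \<in> carrier A \<Longrightarrow> 0 \<le> p x"
  using p_add[of x "\<ominus> x"] p_uminus[of x] by (simp add: r_neg)

lemma p_minus: "\<lbrakk>x \<in> carrier A; y \<in> carrier A\<rbrakk> \<Longrightarrow> p (x \<ominus> y) \<le> p x + p y"
  using p_add[of x "\<ominus> y"] by (simp add: minus_eq p_uminus)

lemma p_minus_commute: "\<lbrakk>x \<in> carrier A; y \<in> carrier A\<rbrakk> \<Longrightarrow> p (x \<ominus> y) = p (y \<ominus> x)"
  using p_uminus[of "y \<ominus> x"] by (simp add: minus_add minus_eq a_comm)

lemma p_triangle:
  "\<lbrakk>x \<in> carrier A; y \<in> carrier A; z \<in> carrier A\<rbrakk> \<Longrightarrow> p (x \<ominus> z) \<le> p (x \<ominus> y) + p (y \<ominus> z)"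
  using p_add[of "x \<ominus> y" "y \<ominus> z"] by (simp add: add_cancel_middle)

lemma p_reverse_triangle: "\<lbrakk>x \<in> carrier A; y \<in> carrier A\<rbrakk> \<Longrightarrow> \<bar>p x - p y\<bar> \<le> p (x \<ominus> y)"
  using p_triangle[of x y \<zero>] p_triangle[of y x \<zero>] p_minus_commute[of x y] by (simp add: minus_eq)

lemma p_star: "x \<in> carrier A \<Longrightarrow> p (star A x) = p x"
  using p_mult_star[of x] p_mult_star[of "star A x"]
  by (simp add: star_star m_comm)

lemma p_square: "selfadjoint x \<Longrightarrow> p (x \<otimes> x) = (p x)\<^sup>2"
  using p_mult_star[of x] by (simp add: selfadjoint_def)

text \<open>Each application of the C*-identity doubles the exponent, which is why powers of two are
  singled out.\<close>

lemma p_pow_two_power: "selfadjoint x \<Longrightarrow> p (x [^] (2 ^ n :: nat)) = p x ^ (2 ^ n)"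
proof (induction n)
  case (Suc n)
  have "x [^] (2 ^ Suc n :: nat) = x [^] (2 ^ n :: nat) \<otimes> x [^] (2 ^ n :: nat)"
    using Suc.prems by (simp add: nat_pow_mult selfadjoint_def mult_2)
  then show ?case
    using Suc p_square[OF selfadjoint_pow[OF Suc.prems]] by (simp add: power_mult[symmetric] mult.commute)
qed (simp add: selfadjoint_def)

text \<open>Polarisation first gives the bound 2, since four times the seminorm is at most
  \<open>2^2 + 2^2\<close>. Applied to the \<open>2 ^ n\<close>-th powers of \<open>a\<close> and
  \<open>b\<close>, whose seminorms are still at most 1, it bounds
  \<open>p (a \<otimes> b) ^ (2 ^ n)\<close> by 2 for all \<open>n\<close>, and taking roots brings
  2 down to 1.\<close>

lemma p_mult_selfadjoint_le_1:
  assumes a: "selfadjoint a" "p a \<le> 1" and b: "selfadjoint b" "p b \<le> 1"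
  shows "p (a \<otimes> b) \<le> 1"
proof -
  have le2: "p (c \<otimes> d) \<le> 2" if c: "selfadjoint c" "p c \<le> 1" and d: "selfadjoint d" "p d \<le> 1" for c d
  proof -
    have car: "c \<in> carrier A" "d \<in> carrier A" using c d by (auto simp: selfadjoint_def)
    have sa: "selfadjoint (c \<oplus> d)" "selfadjoint (c \<ominus> d)"
      using c d by (auto simp: selfadjoint_def star_add minus_eq_sm star_smult)
    have "4 * p (c \<otimes> d) = p (4 \<odot> (c \<otimes> d))"
      using car by (simp add: p_sm)
    also have "\<dots> \<le> (p (c \<oplus> d))\<^sup>2 + (p (c \<ominus> d))\<^sup>2"
      using p_minus[of "(c \<oplus> d) \<otimes> (c \<oplus> d)" "(c \<ominus> d) \<otimes> (c \<ominus> d)"] car sa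
      by (simp add: polarisation p_square)
    also have "\<dots> \<le> 2\<^sup>2 + 2\<^sup>2"
      using p_add[of c d] p_minus[of c d] car c d by (intro add_mono power_mono) auto
    finally show ?thesis by simp
  qed
  have car: "a \<in> carrier A" "b \<in> carrier A" using a b by (auto simp: selfadjoint_def)
  have "p (a \<otimes> b) ^ (2 ^ n) \<le> 2 * 1 ^ (2 ^ n)" for n
  proof -
    have "p (a \<otimes> b) ^ (2 ^ n) = p ((a \<otimes> b) [^] (2 ^ n :: nat))"
      using p_pow_two_power[OF selfadjoint_mult[OF a(1) b(1)]] by simp
    also have "\<dots> = p (a [^] (2 ^ n :: nat) \<otimes> b [^] (2 ^ n :: nat))"
      using car by (simp add: nat_pow_distrib)
    also have "\<dots> \<le> 2"
      using a b car by (intro le2 selfadjoint_pow) (auto simp: p_pow_two_power intro: power_le_one)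
    finally show ?thesis by simp
  qed
  then show ?thesis
    using le_of_iterated_squares_le[of "p (a \<otimes> b)" 1 2] car by simp
qed

text \<open>By commutativity the square of \<open>p (x \<otimes> y)\<close> is the seminorm of a
  product of the selfadjoint elements \<open>x \<otimes> star A x\<close> and
  \<open>y \<otimes> star A y\<close>.\<close>

lemma p_mult_le_1:
  assumes x: "x \<in> carrier A" "p x \<le> 1" and y: "y \<in> carrier A" "p y \<le> 1"
  shows "p (x \<otimes> y) \<le> 1"
proof -
  have "(p (x \<otimes> y))\<^sup>2 = p ((x \<otimes> y) \<otimes> star A (x \<otimes> y))"
    using x y by (simp add: p_mult_star)
  also have "(x \<otimes> y) \<otimes> star A (x \<otimes> y) = (x \<otimes> star A x) \<otimes> (y \<otimes> star A y)"
    using x y by (simp add: star_mult m_ac)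
  also have "p \<dots> \<le> 1"
    by (rule p_mult_selfadjoint_le_1) (use x y in \<open>auto simp: p_mult_star power_le_one selfadjoint_mult_star\<close>)
  finally show ?thesis
    using x y by (simp add: abs_square_le_1 abs_le_iff)
qed

lemma p_mult:
  assumes x: "x \<in> carrier A" and y: "y \<in> carrier A"
  shows "p (x \<otimes> y) \<le> p x * p y"
proof -
  \<comment> \<open>Normalising by \<open>p x + e\<close> rather than \<open>p x\<close> covers
    elements of seminorm zero; \<open>e\<close> tends to 0 at the end.\<close>
  have *: "p (x \<otimes> y) \<le> (p x + e) * (p y + e)" if e: "e > 0" for e
  proof -
    let ?a = "p x + e" and ?b = "p y + e"
    have pos: "?a > 0" "?b > 0" using x y e by (auto intro: add_nonneg_pos)
    define s t where "s = complex_of_real (1 / ?a)" and "t = complex_of_real (1 / ?b)"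
    have st: "cmod s = 1 / ?a" "cmod t = 1 / ?b"
      unfolding s_def t_def norm_of_real using pos by simp_all
    have "p ((s \<odot> x) \<otimes> (t \<odot> y)) \<le> 1"
      using x y pos e by (intro p_mult_le_1) (simp_all add: p_sm st)
    moreover have "(s \<odot> x) \<otimes> (t \<odot> y) = (s * t) \<odot> (x \<otimes> y)"
      using x y by (simp add: sm_mult_left sm_mult_right sm_sm mult.commute)
    ultimately have "(1 / ?a) * (1 / ?b) * p (x \<otimes> y) \<le> 1"
      using x y by (simp only: p_sm m_closed norm_mult st)
    then show ?thesis
      using pos by (simp add: divide_le_eq)
  qed
  have "((\<lambda>e. (p x + e) * (p y + e)) \<longlongrightarrow> (p x + 0) * (p y + 0)) (at_right 0)"
    by (intro tendsto_intros)
  moreover have "eventually (\<lambda>e. p (x \<otimes> y) \<le> (p x + e) * (p y + e)) (at_right 0)"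
    by (rule eventually_mono[OF eventually_at_right_less[of 0]]) (rule *)
  ultimately show ?thesis
    by (metis add.right_neutral tendsto_lowerbound trivial_limit_at_right_real)
qed

lemma p_pow: "x \<in> carrier A \<Longrightarrow> p (x [^] Suc n) \<le> p x ^ Suc n"
proof (induction n)
  case (Suc n)
  have "p (x [^] Suc (Suc n)) \<le> p (x [^] Suc n) * p x"
    using Suc.prems p_mult[of "x [^] Suc n" x] by simp
  also have "\<dots> \<le> p x ^ Suc n * p x"
    using Suc by (intro mult_right_mono) auto
  finally show ?case by (simp add: mult.commute)
qed simp

text \<open>Powers of \<open>x \<otimes> star A x\<close> reduce the constant \<open>C\<close> to 1.
  Hence every continuity estimate for a C*-seminorm below can be stated without a constant.\<close>

lemma p_le_of_le_mult:
  assumes r: "Cstar_seminorm A r" and le: "\<And>x. x \<in> carrier A \<Longrightarrow> r x \<le> C * p x"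
    and x: "x \<in> carrier A"
  shows "r x \<le> p x"
proof -
  interpret r: Cstar_seminormed_algebra A r
    using r by unfold_locales
  let ?b = "x \<otimes> star A x"
  have b: "selfadjoint ?b" using x by (rule selfadjoint_mult_star)
  have "r ?b \<le> p ?b"
  proof (rule le_of_iterated_squares_le)
    show "r ?b ^ 2 ^ n \<le> C * p ?b ^ 2 ^ n" for n
      using le[of "?b [^] (2 ^ n :: nat)"] x by (simp add: p_pow_two_power[OF b] r.p_pow_two_power[OF b])
  qed (use x in simp_all)
  then show ?thesis
    using x by (simp add: p_mult_star r.p_mult_star power_mono_iff)
qed

end

text \<open>Allows a seminorm to be normalised off the carrier.\<close>

lemma Cstar_seminorm_cong:
  assumes "involutive_algebra A" "\<And>x. x \<in> carrier A \<Longrightarrow> p x = q x"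
  shows "Cstar_seminorm A p \<longleftrightarrow> Cstar_seminorm A q"
proof -
  interpret involutive_algebra A by fact
  show ?thesis unfolding Cstar_seminorm_def by (simp add: assms(2))
qed

section \<open>Peak seminorms\<close>

context Cstar_seminormed_algebra
begin

text \<open>If \<open>p\<close> is the supremum norm over a compact set, then \<open>peak a\<close> is the supremum norm over the
  subset where \<open>\<bar>a\<bar>\<close> attains its maximum.\<close>

definition peak :: "'a \<Rightarrow> 'a \<Rightarrow> real" where
  "peak a y = lim (\<lambda>n. p ((a \<otimes> star A a) [^] n \<otimes> y) / p (a \<otimes> star A a) ^ n)"

context
  fixes a assumes a: "a \<in> carrier A" and p_a: "0 < p a"
begin

private abbreviation b where "b \<equiv> a \<otimes> star A a"

private lemma b: "b \<in> carrier A" "selfadjoint b" "0 < p b"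
  using a p_a by (simp_all add: selfadjoint_mult_star p_mult_star)

text \<open>By submultiplicativity the quotients decrease in \<open>n\<close>, and they are
  nonnegative, so the \<open>lim\<close> in the definition is a genuine limit.\<close>

lemma peak_tendsto:
  assumes y: "y \<in> carrier A"
  shows "(\<lambda>n. p (b [^] n \<otimes> y) / p b ^ n) \<longlonglongrightarrow> peak a y" (is "?s \<longlonglongrightarrow> _")
proof -
  have dec: "decseq ?s"
  proof (rule decseq_SucI)
    fix n
    have "b [^] Suc n \<otimes> y = b \<otimes> (b [^] n \<otimes> y)"
      using b y by (simp add: m_ac)
    then have "p (b [^] Suc n \<otimes> y) \<le> p b * p (b [^] n \<otimes> y)"
      using p_mult[of b "b [^] n \<otimes> y"] b(1) y by (simp only: m_closed nat_pow_closed)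
    then show "?s (Suc n) \<le> ?s n"
      using b(3) by (simp add: field_simps)
  qed
  have "\<forall>n. 0 \<le> ?s n"
    using b y by simp
  from decseq_convergent[OF dec this] obtain L where "?s \<longlonglongrightarrow> L" by blast
  then show ?thesis
    unfolding peak_def by (simp add: limI)
qed

lemma peak_le: "y \<in> carrier A \<Longrightarrow> peak a y \<le> p y"
proof -
  assume y: "y \<in> carrier A"
  have "p (b [^] n \<otimes> y) / p b ^ n \<le> p y" for n
  proof -
    \<comment> \<open>\<open>p_pow\<close> starts at exponent 1; for \<open>n = 0\<close> the
      quotient is \<open>p y\<close> itself.\<close>
    have "p (b [^] n) \<le> p b ^ n" if "n > 0"
      using p_pow[OF b(1), of "n - 1"] that by simp
    then have "p (b [^] n \<otimes> y) \<le> p b ^ n * p y"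
      using p_mult[of "b [^] n" y] b y mult_right_mono[of "p (b [^] n)" "p b ^ n" "p y"]
      by (cases "n = 0") auto
    then show ?thesis using b(3) by (simp add: divide_le_eq mult.commute)
  qed
  then show ?thesis
    using LIMSEQ_le_const2[OF peak_tendsto[OF y]] by blast
qed

text \<open>Along the exponents \<open>2 ^ n\<close> the quotient equals 1, because \<open>b\<close>
  is selfadjoint.\<close>

lemma peak_one: "peak a \<one> = 1"
proof -
  have strict_mono: "strict_mono (\<lambda>n. 2 ^ n :: nat)"
    by (rule strict_monoI) simp
  have "(\<lambda>n. p (b [^] ((2::nat) ^ n) \<otimes> \<one>) / p b ^ (2 ^ n)) \<longlonglongrightarrow> peak a \<one>"
    using LIMSEQ_subseq_LIMSEQ[OF peak_tendsto[OF one_closed] strict_mono] by (simp only: o_def)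
  moreover have "p (b [^] ((2::nat) ^ n) \<otimes> \<one>) / p b ^ (2 ^ n) = 1" for n
    using b by (simp add: p_pow_two_power)
  ultimately show ?thesis
    using LIMSEQ_unique[OF _ tendsto_const] by (simp only:)
qed

text \<open>Peaking at \<open>a\<close> does not disturb an element \<open>x\<close> by which
  multiplication already scales \<open>p\<close>. This keeps the norm at one chosen element while
  peaking at others.\<close>

lemma peak_mult_eigen:
  assumes c: "\<And>y. y \<in> carrier A \<Longrightarrow> p (x \<otimes> y) = c * p y" and x: "x \<in> carrier A" and y: "y \<in> carrier A"
  shows "peak a (x \<otimes> y) = c * peak a y"
proof -
  have "(\<lambda>n. c * (p (b [^] n \<otimes> y) / p b ^ n)) \<longlonglongrightarrow> c * peak a y"
    by (intro tendsto_intros peak_tendsto y)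
  moreover have "c * (p (b [^] n \<otimes> y) / p b ^ n) = p (b [^] n \<otimes> (x \<otimes> y)) / p b ^ n" for n
  proof -
    have "b [^] n \<otimes> (x \<otimes> y) = x \<otimes> (b [^] n \<otimes> y)"
      using a x y by (simp add: m_lcomm)
    then show ?thesis using c[of "b [^] n \<otimes> y"] a y by (simp only: m_closed nat_pow_closed star_closed) simp
  qed
  ultimately show ?thesis
    using LIMSEQ_unique[OF peak_tendsto[OF m_closed[OF x y]]] by (simp only:)
qed

lemma Cstar_seminorm_peak: "Cstar_seminorm A (peak a)"
  unfolding Cstar_seminorm_def
proof (intro conjI ballI allI)
  fix x y assume x: "x \<in> carrier A" and y: "y \<in> carrier A"
  show "peak a (x \<oplus> y) \<le> peak a x + peak a y"
  proof (rule LIMSEQ_le[OF peak_tendsto tendsto_add[OF peak_tendsto peak_tendsto]])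
    have "p (b [^] n \<otimes> (x \<oplus> y)) / p b ^ n \<le> p (b [^] n \<otimes> x) / p b ^ n + p (b [^] n \<otimes> y) / p b ^ n" for n
      using p_add[of "b [^] n \<otimes> x" "b [^] n \<otimes> y"] x y b by (simp add: r_distr divide_right_mono flip: add_divide_distrib)
    then show "\<exists>N. \<forall>n\<ge>N. p (b [^] n \<otimes> (x \<oplus> y)) / p b ^ n \<le> p (b [^] n \<otimes> x) / p b ^ n + p (b [^] n \<otimes> y) / p b ^ n"
      by blast
  qed (use x y in auto)
next
  fix c x assume x: "x \<in> carrier A"
  have "(\<lambda>n. p (b [^] n \<otimes> (c \<odot> x)) / p b ^ n) = (\<lambda>n. cmod c * (p (b [^] n \<otimes> x) / p b ^ n))"
    using x b by (simp add: sm_mult_right p_sm)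
  then show "peak a (c \<odot> x) = cmod c * peak a x"
    using LIMSEQ_unique[OF peak_tendsto[OF sm_closed[OF x]]] tendsto_mult_left[OF peak_tendsto[OF x], of "cmod c"]
    by simp
next
  fix x assume x: "x \<in> carrier A"
  \<comment> \<open>Since \<open>b [^] n\<close> is selfadjoint, the even terms for
    \<open>x \<otimes> star A x\<close> are the squares of the terms for \<open>x\<close>, and the
    C*-identity passes to the limit.\<close>
  have "p (b [^] (2 * n) \<otimes> (x \<otimes> star A x)) / p b ^ (2 * n) = (p (b [^] n \<otimes> x) / p b ^ n)\<^sup>2" for n
  proof -
    have "b [^] (2 * n) \<otimes> (x \<otimes> star A x) = (b [^] n \<otimes> b [^] n) \<otimes> (x \<otimes> star A x)"
      using b by (simp add: nat_pow_mult mult_2)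
    also have "\<dots> = (b [^] n \<otimes> x) \<otimes> star A (b [^] n \<otimes> x)"
      using b x selfadjoint_pow[OF b(2), of n] a by (simp add: star_mult selfadjoint_def m_ac)
    finally have "p (b [^] (2 * n) \<otimes> (x \<otimes> star A x)) = (p (b [^] n \<otimes> x))\<^sup>2"
      using p_mult_star[of "b [^] n \<otimes> x"] b x by (simp only: m_closed nat_pow_closed)
    then show ?thesis by (simp add: power_divide power_mult[symmetric] mult.commute)
  qed
  moreover have "(\<lambda>n. p (b [^] (2 * n) \<otimes> (x \<otimes> star A x)) / p b ^ (2 * n)) \<longlonglongrightarrow> peak a (x \<otimes> star A x)"
    using LIMSEQ_subseq_LIMSEQ[OF peak_tendsto, of "x \<otimes> star A x" "\<lambda>n. 2 * n"] x
    by (auto simp: strict_mono_def o_def)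
  moreover have "(\<lambda>n. (p (b [^] n \<otimes> x) / p b ^ n)\<^sup>2) \<longlonglongrightarrow> (peak a x)\<^sup>2"
    by (intro tendsto_intros peak_tendsto x)
  ultimately show "peak a (x \<otimes> star A x) = (peak a x)\<^sup>2"
    using LIMSEQ_unique by simp
qed

text \<open>For \<open>b\<close> in place of \<open>a\<close> this is a shift of the defining
  sequence. The case of \<open>a\<close> follows from the C*-identity, since
  \<open>a \<otimes> y\<close> times its adjoint is \<open>b\<close> times
  \<open>y \<otimes> star A y\<close>.\<close>

lemma peak_mult:
  assumes y: "y \<in> carrier A"
  shows "peak a (a \<otimes> y) = p a * peak a y"
proof -
  interpret peak: Cstar_seminormed_algebra A "peak a"
    using Cstar_seminorm_peak by unfold_locales
  have b_mult: "peak a (b \<otimes> z) = p b * peak a z" if z: "z \<in> carrier A" for z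
  proof -
    have "(\<lambda>n. p b * (p (b [^] Suc n \<otimes> z) / p b ^ Suc n)) \<longlonglongrightarrow> p b * peak a z"
      by (intro tendsto_intros LIMSEQ_Suc[OF peak_tendsto] z)
    moreover have "p b * (p (b [^] Suc n \<otimes> z) / p b ^ Suc n) = p (b [^] n \<otimes> (b \<otimes> z)) / p b ^ n" for n
      using b z by (simp add: m_assoc)
    ultimately show ?thesis
      using LIMSEQ_unique[OF peak_tendsto[OF m_closed[OF b(1) z]]] by simp
  qed
  have "(peak a (a \<otimes> y))\<^sup>2 = peak a (b \<otimes> (y \<otimes> star A y))"
    using a y by (simp add: peak.p_mult_star[symmetric] star_mult m_ac)
  also have "\<dots> = (p a * peak a y)\<^sup>2"
    using a y by (simp add: b_mult p_mult_star peak.p_mult_star power_mult_distrib)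
  finally show ?thesis
    using a y p_a by (simp add: power2_eq_iff_nonneg)
qed

end

section \<open>Minimal C*-seminorms\<close>

text \<open>The last two conditions force \<open>q x = p x\<close>, so the norm at \<open>x\<close>
  is not lost when \<open>q\<close> shrinks. Values off the carrier are fixed because
  \<open>\<le>\<close> and \<open>=\<close> on functions see them too.\<close>

definition sharp_seminorms :: "'a \<Rightarrow> ('a \<Rightarrow> real) set" where
  "sharp_seminorms x = {q. Cstar_seminorm A q \<and> (\<forall>y. y \<notin> carrier A \<longrightarrow> q y = 0) \<and>
     (\<forall>y \<in> carrier A. q y \<le> p y) \<and> q \<one> = 1 \<and> (\<forall>y \<in> carrier A. q (x \<otimes> y) = p x * q y)}"

text \<open>Used twice: with \<open>a = x\<close> to show that sharp seminorms exist, and with a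
  minimal seminorm in place of \<open>p\<close>, where it produces a competitor.\<close>

lemma peak_sharp:
  assumes a: "a \<in> carrier A" "0 < p a" and x: "x \<in> carrier A"
    and eig: "\<And>y. y \<in> carrier A \<Longrightarrow> peak a (x \<otimes> y) = p x * peak a y"
  shows "(\<lambda>y. if y \<in> carrier A then peak a y else 0) \<in> sharp_seminorms x"
  unfolding sharp_seminorms_def
  using Cstar_seminorm_peak[OF a] peak_le[OF a] peak_one[OF a] eig x
    Cstar_seminorm_cong[OF involutive_algebra_axioms, of "peak a" "\<lambda>y. if y \<in> carrier A then peak a y else 0"]
  by auto

text \<open>Zorn's lemma for the reversed order: a nonempty chain is bounded by its pointwise
  infimum, and for the empty chain the peak seminorm at \<open>x\<close> will do.\<close>

lemma minimal_sharp_seminorm: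
  assumes x: "x \<in> carrier A" "0 < p x"
  shows "\<exists>q \<in> sharp_seminorms x. \<forall>r \<in> sharp_seminorms x. r \<le> q \<longrightarrow> r = q"
proof (rule predicate_Zorn)
  show "partial_order_on (sharp_seminorms x) (relation_of (\<lambda>q r. r \<le> q) (sharp_seminorms x))"
    by (rule partial_order_on_relation_ofI) auto
  fix C assume C: "C \<in> Chains (relation_of (\<lambda>q r. r \<le> q) (sharp_seminorms x))"
  then have sub: "C \<subseteq> sharp_seminorms x" and chain: "\<And>q r. \<lbrakk>q \<in> C; r \<in> C\<rbrakk> \<Longrightarrow> q \<le> r \<or> r \<le> q"
    unfolding Chains_def relation_of_def by auto
  have ex: "(\<lambda>y. if y \<in> carrier A then peak x y else 0) \<in> sharp_seminorms x"
    by (rule peak_sharp[OF x x(1)]) (rule peak_mult[OF x])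
  show "\<exists>u \<in> sharp_seminorms x. \<forall>q \<in> C. u \<le> q"
  proof (cases "C = {}")
    case True
    then show ?thesis using ex by auto
  next
    case False
    have csn: "Cstar_seminormed_algebra A q" if "q \<in> C" for q
      using sub that by unfold_locales (auto simp: sharp_seminorms_def)
    have nonneg: "0 \<le> q y" if "q \<in> C" for q y
      using Cstar_seminormed_algebra.p_nonneg[OF csn[OF that], of y] sub that
      by (cases "y \<in> carrier A") (auto simp: sharp_seminorms_def)
    define u where "u y = (INF q\<in>C. q y)" for y
    have bdd: "bdd_below ((\<lambda>q. q y) ` C)" for y
      using nonneg by (auto intro: bdd_belowI[of _ 0])
    have u_le: "u y \<le> q y" if "q \<in> C" for q y
      unfolding u_def by (rule cINF_lower[OF bdd that])
    have u_ge: "m \<le> u y" if "\<And>q. q \<in> C \<Longrightarrow> m \<le> q y" for m y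
      unfolding u_def by (rule cINF_greatest[OF False that])
    have u_nonneg: "0 \<le> u y" for y by (rule u_ge) (rule nonneg)
    have u_less: "\<exists>q \<in> C. q y < m" if "u y < m" for m y
      using that u_ge[of m y] by (meson not_le)
    \<comment> \<open>An infimum commutes with nonnegative scaling. This gives homogeneity, the
      scaling by \<open>p x\<close> under multiplication by \<open>x\<close> and, with
      \<open>c = 0\<close>, the value 0 off the carrier.\<close>
    have u_scale: "u z = c * u y" if c: "0 \<le> c" and z: "\<And>q. q \<in> C \<Longrightarrow> q z = c * q y" for c y z
    proof (rule antisym)
      show "c * u y \<le> u z"
        by (rule u_ge) (simp add: z u_le c mult_left_mono)
      show "u z \<le> c * u y"
      proof (cases "c = 0")
        case True
        then show ?thesis using False u_le[of _ z] z by fastforce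
      next
        case False
        then have "u z / c \<le> u y"
          using u_le[of _ z] z c by (intro u_ge) (simp add: divide_le_eq mult.commute)
        then show ?thesis using c False by (simp add: divide_le_eq mult.commute)
      qed
    qed
    have "Cstar_seminorm A u"
      unfolding Cstar_seminorm_def
    proof (intro conjI ballI allI)
      fix y z assume y: "y \<in> carrier A" and z: "z \<in> carrier A"
      show "u (y \<oplus> z) \<le> u y + u z"
      proof (rule field_le_epsilon)
        fix e :: real assume "0 < e"
        obtain q r where qr: "q \<in> C" "r \<in> C" "q y < u y + e / 2" "r z < u z + e / 2"
          using u_less[of y "u y + e / 2"] u_less[of z "u z + e / 2"] \<open>0 < e\<close> by auto
        \<comment> \<open>In a chain one of \<open>q\<close> and \<open>r\<close> lies below the
          other, so one seminorm nearly attains both infima.\<close>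
        obtain s where s: "s \<in> C" "s \<le> q" "s \<le> r"
          using chain[OF qr(1,2)] qr by blast
        have "u (y \<oplus> z) \<le> s (y \<oplus> z)" by (rule u_le[OF s(1)])
        also have "\<dots> \<le> s y + s z"
          by (rule Cstar_seminormed_algebra.p_add[OF csn[OF s(1)] y z])
        also have "\<dots> \<le> q y + r z" using s by (auto simp: le_fun_def intro: add_mono)
        finally show "u (y \<oplus> z) \<le> u y + u z + e" using qr by simp
      qed
    next
      fix c y assume y: "y \<in> carrier A"
      show "u (c \<odot> y) = cmod c * u y"
        by (rule u_scale) (simp_all add: Cstar_seminormed_algebra.p_sm[OF csn y])
    next
      fix y assume y: "y \<in> carrier A"
      have eq: "q (y \<otimes> star A y) = (q y)\<^sup>2" if "q \<in> C" for q
        by (rule Cstar_seminormed_algebra.p_mult_star[OF csn[OF that] y])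
      show "u (y \<otimes> star A y) = (u y)\<^sup>2"
      proof (rule antisym)
        show "(u y)\<^sup>2 \<le> u (y \<otimes> star A y)"
          using u_nonneg u_le by (intro u_ge) (auto simp: eq intro: power_mono)
        have "sqrt (u (y \<otimes> star A y)) \<le> u y"
          using u_le[of _ "y \<otimes> star A y"] nonneg by (intro u_ge real_le_lsqrt) (auto simp: eq)
        then show "u (y \<otimes> star A y) \<le> (u y)\<^sup>2"
          using u_nonneg by (simp add: sqrt_le_D)
      qed
    qed
    moreover have "u y = 0" if "y \<notin> carrier A" for y
      using u_scale[of 0 y y] sub that by (force simp: sharp_seminorms_def)
    moreover have "u y \<le> p y" if "y \<in> carrier A" for y
      using u_le[of _ y] False sub that by (force simp: sharp_seminorms_def intro: order_trans)
    moreover have "u \<one> = 1"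
    proof -
      have "(\<lambda>q. q \<one>) ` C = {1}" using False sub by (auto simp: sharp_seminorms_def)
      then show ?thesis by (simp add: u_def)
    qed
    moreover have "u (x \<otimes> y) = p x * u y" if "y \<in> carrier A" for y
      using sub that x by (intro u_scale) (auto simp: sharp_seminorms_def)
    ultimately have "u \<in> sharp_seminorms x" by (simp add: sharp_seminorms_def)
    moreover have "\<forall>q \<in> C. u \<le> q" using u_le by (simp add: le_fun_def)
    ultimately show ?thesis by blast
  qed
qed

text \<open>If \<open>q a > 0\<close>, the peak of \<open>q\<close> at \<open>a\<close> is again
  sharp at \<open>x\<close> and lies below \<open>q\<close>, so it equals \<open>q\<close> by
  minimality; but multiplication by \<open>a\<close> scales the peak by \<open>q a\<close>. If
  \<open>q a = 0\<close>, submultiplicativity suffices.\<close>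

lemma minimal_sharp_seminorm_mult:
  assumes x: "x \<in> carrier A" and q: "q \<in> sharp_seminorms x"
    and min: "\<And>r. \<lbrakk>r \<in> sharp_seminorms x; r \<le> q\<rbrakk> \<Longrightarrow> r = q"
    and a: "a \<in> carrier A" and y: "y \<in> carrier A"
  shows "q (a \<otimes> y) = q a * q y"
proof -
  interpret q: Cstar_seminormed_algebra A q
    using q by unfold_locales (simp add: sharp_seminorms_def)
  show ?thesis
  proof (cases "q a = 0")
    case True
    then show ?thesis using q.p_mult[OF a y] q.p_nonneg[OF m_closed[OF a y]] by simp
  next
    case False
    then have pos: "0 < q a" using q.p_nonneg[OF a] by simp
    have qx: "q x = p x"
      using q x by (simp add: sharp_seminorms_def) (metis mult.right_neutral one_closed r_one)
    let ?r = "\<lambda>y. if y \<in> carrier A then q.peak a y else 0"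
    have "?r \<in> q.sharp_seminorms x"
      using q x by (intro q.peak_sharp[OF a pos] q.peak_mult_eigen[OF a pos]) (auto simp: sharp_seminorms_def qx)
    \<comment> \<open>Sharp with respect to \<open>q\<close> implies sharp with respect to
      \<open>p\<close>, because \<open>q x = p x\<close> and \<open>q\<close> lies below
      \<open>p\<close>.\<close>
    then have "?r \<in> sharp_seminorms x"
      using q x by (auto simp: sharp_seminorms_def q.sharp_seminorms_def qx intro: order_trans)
    moreover have "?r \<le> q"
      using q q.peak_le[OF a pos] by (auto simp: le_fun_def sharp_seminorms_def)
    ultimately have eq: "?r = q" by (rule min)
    have "q.peak a z = q z" if "z \<in> carrier A" for z
      using fun_cong[OF eq, of z] that by simp
    then show ?thesis
      using q.peak_mult[OF a pos y] a y by simp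
  qed
qed

end

section \<open>Characters and the Gelfand--Mazur argument\<close>

text \<open>Continuity is kept apart, because for bornological algebras it will be a theorem about
  all of these.\<close>

definition star_characters :: "('a, 'm) star_algebra_scheme \<Rightarrow> ('a \<Rightarrow> complex) set" where
  "star_characters A = {u \<in> extensional (carrier A).
     (\<forall>x \<in> carrier A. \<forall>y \<in> carrier A. u (x \<oplus>\<^bsub>A\<^esub> y) = u x + u y \<and> u (x \<otimes>\<^bsub>A\<^esub> y) = u x * u y) \<and>
     u \<one>\<^bsub>A\<^esub> = 1 \<and>
     (\<forall>c. \<forall>x \<in> carrier A. u (c \<odot>\<^bsub>A\<^esub> x) = c * u x) \<and>
     (\<forall>x \<in> carrier A. u (star A x) = cnj (u x))}"

locale multiplicative_Cstar_seminorm = Cstar_seminormed_algebra +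
  assumes p_mult_eq: "\<lbrakk>x \<in> carrier A; y \<in> carrier A\<rbrakk> \<Longrightarrow> p (x \<otimes> y) = p x * p y"
    and p_one: "p \<one> = 1"
begin

lemma p_scalar: "p (c \<odot> \<one>) = cmod c"
  by (simp add: p_sm p_one)

lemma square_minus_square:
  assumes y: "y \<in> carrier A"
  shows "(y \<otimes> y) \<ominus> (c * c) \<odot> \<one> = (y \<ominus> c \<odot> \<one>) \<otimes> (y \<ominus> (- c) \<odot> \<one>)"
proof -
  have c: "(- c) \<odot> \<one> = \<ominus> (c \<odot> \<one>)" "(c * c) \<odot> \<one> = (c \<odot> \<one>) \<otimes> (c \<odot> \<one>)"
    by (simp_all add: uminus_eq_sm sm_sm sm_mult_left sm_mult_right)
  have "c \<odot> \<one> \<in> carrier A" by simp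
  then show ?thesis unfolding c using y by algebra
qed

text \<open>The argument of Gelfand--Mazur: if the distance \<open>m\<close> of \<open>y\<close> from the scalars is positive and is
  attained at \<open>0\<close>, then the factorisation of \<open>y\<^sup>N - c\<^sup>N\<close> for \<open>N = 2\<^sup>n\<close> shows that
  it is also attained at all scalars \<open>c\<close> with \<open>\<bar>c\<bar> < m\<close>.\<close>

lemma distance_attained_nearby:
  assumes y: "y \<in> carrier A" and m: "p y = m" "0 < m"
    and min: "\<And>c. m \<le> p (y \<ominus> c \<odot> \<one>)" and c: "cmod c < m"
  shows "p (y \<ominus> c \<odot> \<one>) = m"
proof -
  have sq: "y [^] (2 ^ Suc n :: nat) = y [^] (2 ^ n :: nat) \<otimes> y [^] (2 ^ n :: nat)" for n
    using y by (simp add: nat_pow_mult mult_2)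
  have p_sq: "p (y [^] (2 ^ Suc n :: nat) \<ominus> (d * d) \<odot> \<one>)
      = p (y [^] (2 ^ n :: nat) \<ominus> d \<odot> \<one>) * p (y [^] (2 ^ n :: nat) \<ominus> (- d) \<odot> \<one>)" for n d
    unfolding sq using y by (simp add: square_minus_square p_mult_eq)
  \<comment> \<open>Every scalar has a square root, so \<open>y [^] (2 ^ n)\<close> minus a scalar
    splits into factors \<open>y \<ominus> c \<odot> \<one>\<close>, each of seminorm at least
    \<open>m\<close>.\<close>
  have low: "m ^ (2 ^ n) \<le> p (y [^] (2 ^ n :: nat) \<ominus> d \<odot> \<one>)" for n d
  proof (induction n arbitrary: d)
    case 0
    then show ?case using min y by simp
  next
    case (Suc n)
    have "m ^ (2 ^ Suc n) = m ^ (2 ^ n) * m ^ (2 ^ n)" by (simp add: mult_2 power_add)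
    also have "\<dots> \<le> p (y [^] (2 ^ n :: nat) \<ominus> csqrt d \<odot> \<one>) * p (y [^] (2 ^ n :: nat) \<ominus> (- csqrt d) \<odot> \<one>)"
      using m y by (intro mult_mono Suc.IH) auto
    also have "\<dots> = p (y [^] (2 ^ Suc n :: nat) \<ominus> (csqrt d * csqrt d) \<odot> \<one>)"
      by (simp only: p_sq)
    also have "csqrt d * csqrt d = d" by (simp flip: power2_eq_square)
    finally show ?case .
  qed
  \<comment> \<open>The same factorisation, keeping the factor for \<open>c\<close> and bounding the
    others below by \<open>m\<close>; the additional \<open>m\<close> on the right avoids the
    exponent \<open>2 ^ n - 1\<close>.\<close>
  have up: "p (y \<ominus> c \<odot> \<one>) * m ^ (2 ^ n) \<le> m * p (y [^] (2 ^ n :: nat) \<ominus> (c ^ (2 ^ n)) \<odot> \<one>)" for n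
  proof (induction n)
    case 0
    then show ?case using y by simp
  next
    case (Suc n)
    let ?d = "c ^ (2 ^ n)"
    have "p (y \<ominus> c \<odot> \<one>) * m ^ (2 ^ Suc n) = (p (y \<ominus> c \<odot> \<one>) * m ^ (2 ^ n)) * m ^ (2 ^ n)"
      by (simp add: mult_2 power_add)
    also have "\<dots> \<le> (m * p (y [^] (2 ^ n :: nat) \<ominus> ?d \<odot> \<one>)) * p (y [^] (2 ^ n :: nat) \<ominus> (- ?d) \<odot> \<one>)"
      using m y by (intro mult_mono Suc.IH low) auto
    also have "\<dots> = m * p (y [^] (2 ^ Suc n :: nat) \<ominus> (?d * ?d) \<odot> \<one>)"
      by (simp only: p_sq mult.assoc)
    also have "?d * ?d = c ^ (2 ^ Suc n)" by (simp add: mult_2 power_add)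
    finally show ?case .
  qed
  have pow: "p (y [^] (n :: nat)) = m ^ n" for n
    using y m by (induction n) (simp_all add: p_one p_mult_eq mult.commute)
  \<comment> \<open>Dividing by \<open>m ^ ?N\<close> and lowering the exponent from
    \<open>2 ^ n\<close> to \<open>n\<close> leaves a bound that tends to \<open>m\<close>.\<close>
  have "p (y \<ominus> c \<odot> \<one>) \<le> m + m * (cmod c / m) ^ n" for n
  proof -
    let ?N = "2 ^ n :: nat"
    have "p (y \<ominus> c \<odot> \<one>) * m ^ ?N \<le> m * (m ^ ?N + cmod c ^ ?N)"
      using up[of n] p_minus[of "y [^] ?N" "(c ^ ?N) \<odot> \<one>"] y m
      by (simp add: pow p_scalar norm_power) (meson less_imp_le mult_left_mono order_trans)
    then have "p (y \<ominus> c \<odot> \<one>) \<le> m + m * (cmod c / m) ^ ?N"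
      using m by (simp add: power_divide field_simps)
    also have "(cmod c / m) ^ ?N \<le> (cmod c / m) ^ n"
      using c m by (intro power_decreasing) (auto intro: less_imp_le less_exp)
    finally show ?thesis using m by simp
  qed
  moreover have "(\<lambda>n. m + m * (cmod c / m) ^ n) \<longlonglongrightarrow> m + m * 0"
    using c m by (intro tendsto_intros LIMSEQ_power_zero) simp
  ultimately have "p (y \<ominus> c \<odot> \<one>) \<le> m"
    using LIMSEQ_le_const[of _ "m + m * 0" "p (y \<ominus> c \<odot> \<one>)"] by simp
  with min[of c] show ?thesis by simp
qed

lemma minus_scalars: "x \<in> carrier A \<Longrightarrow> (x \<ominus> c \<odot> \<one>) \<ominus> d \<odot> \<one> = x \<ominus> (c + d) \<odot> \<one>"
  by (simp add: minus_eq_sm sm_sm a_assoc sm_add_left[symmetric])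

lemma scalar_minus_scalar: "x \<in> carrier A \<Longrightarrow> (x \<ominus> d \<odot> \<one>) \<ominus> (x \<ominus> c \<odot> \<one>) = (c - d) \<odot> \<one>"
proof -
  assume x: "x \<in> carrier A"
  have "(x \<ominus> v) \<ominus> (x \<ominus> u) = u \<ominus> v" if "u \<in> carrier A" "v \<in> carrier A" for u v
    using x that by algebra
  then have "(x \<ominus> d \<odot> \<one>) \<ominus> (x \<ominus> c \<odot> \<one>) = c \<odot> \<one> \<ominus> d \<odot> \<one>" by simp
  also have "\<dots> = (c - d) \<odot> \<one>" by (simp add: minus_eq_sm sm_sm sm_sum)
  finally show ?thesis .
qed

text \<open>The distance \<open>g c\<close> of \<open>x\<close> from the scalar \<open>c\<close> is
  continuous and grows with \<open>cmod c\<close>, so it has a minimum. If that were positive,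
  \<open>distance_attained_nearby\<close> would propagate it to scalars of arbitrarily large
  modulus, against the growth of \<open>g\<close>.\<close>

lemma scalar_exists:
  assumes x: "x \<in> carrier A"
  shows "\<exists>c. p (x \<ominus> c \<odot> \<one>) = 0"
proof -
  define g where "g c = p (x \<ominus> c \<odot> \<one>)" for c
  have lip: "\<bar>g d - g c\<bar> \<le> cmod (d - c)" for c d
    using p_reverse_triangle[of "x \<ominus> d \<odot> \<one>" "x \<ominus> c \<odot> \<one>"] x
    by (simp add: g_def scalar_minus_scalar p_scalar norm_minus_commute)
  have "continuous_on UNIV g"
    unfolding continuous_on_iff dist_norm using lip by (metis le_less_trans real_norm_def)
  moreover have g0: "g 0 = p x"
    using x by (simp add: g_def minus_eq_sm)
  have "compact (cball (0::complex) (2 * p x))" "cball (0::complex) (2 * p x) \<noteq> {}"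
    using p_nonneg[OF x] by (simp_all add: not_less del: p_nonneg)
  ultimately obtain c where c: "c \<in> cball 0 (2 * p x)" "\<forall>d \<in> cball 0 (2 * p x). g c \<le> g d"
    using continuous_attains_inf[of "cball 0 (2 * p x)" g] continuous_on_subset by blast
  have far: "cmod d \<le> g d + p x" for d
    using p_reverse_triangle[of "d \<odot> \<one>" x] p_minus_commute[of "d \<odot> \<one>" x] x by (simp add: g_def p_scalar)
  \<comment> \<open>Outside the ball \<open>cmod d > 2 * p x\<close>, so \<open>far\<close> gives
    \<open>g d > p x\<close>, which is \<open>g 0\<close>; the minimum over the ball is therefore
    global.\<close>
  have min: "g c \<le> g d" for d
  proof (cases "d \<in> cball 0 (2 * p x)")
    case False
    then show ?thesis using far[of d] c(2)[rule_format, of 0] x by (simp add: g0)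
  qed (use c in blast)
  show ?thesis
  proof (rule ccontr)
    assume "\<nexists>c. p (x \<ominus> c \<odot> \<one>) = 0"
    then have pos: "0 < g c" using x by (metis g_def less_eq_real_def minus_closed one_closed p_nonneg sm_closed)
    have near: "g (c' + d) = g c" if c': "g c' = g c" and d: "cmod d < g c" for c' d
    proof -
      have "p ((x \<ominus> c' \<odot> \<one>) \<ominus> d \<odot> \<one>) = g c"
        using x pos c' d min[unfolded g_def]
        by (intro distance_attained_nearby[where y = "x \<ominus> c' \<odot> \<one>"]) (simp_all only: minus_scalars g_def, simp)
      then show ?thesis using x by (simp add: g_def minus_scalars)
    qed
    \<comment> \<open>Steps of half the minimal distance stay within the reach of
      \<open>near\<close>.\<close>
    have line: "g (c + of_nat n * of_real (g c / 2)) = g c" for n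
    proof (induction n)
      case (Suc n)
      then show ?case
        using near[of "c + of_nat n * of_real (g c / 2)" "of_real (g c / 2)"] pos
        by (simp add: distrib_right add_divide_distrib add_ac norm_divide)
    qed simp
    obtain n :: nat where n: "(g c + p x + cmod c) < n * (g c / 2)"
      using reals_Archimedean3[OF half_gt_zero[OF pos]] by blast
    have "cmod (of_nat n * of_real (g c / 2) :: complex) \<le> cmod (c + of_nat n * of_real (g c / 2)) + cmod c"
      by (metis add.commute add_diff_cancel_left' norm_triangle_ineq4)
    also have "cmod (c + of_nat n * of_real (g c / 2)) \<le> g c + p x"
      using far[of "c + of_nat n * of_real (g c / 2)"] line by simp
    finally show False using n pos by (simp add: norm_mult norm_divide)
  qed
qed

text \<open>The value \<open>undefined\<close> off the carrier makes the map extensional, as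
  \<open>star_characters\<close> demands.\<close>

definition scalar_part :: "'a \<Rightarrow> complex" where
  "scalar_part x = (if x \<in> carrier A then THE c. p (x \<ominus> c \<odot> \<one>) = 0 else undefined)"

lemma scalar_part_eq:
  assumes x: "x \<in> carrier A" and c: "p (x \<ominus> c \<odot> \<one>) = 0"
  shows "scalar_part x = c"
proof -
  have "d = c" if "p (x \<ominus> d \<odot> \<one>) = 0" for d
    using p_minus[of "x \<ominus> d \<odot> \<one>" "x \<ominus> c \<odot> \<one>"] c that x by (simp add: scalar_minus_scalar p_scalar)
  then have "(THE c. p (x \<ominus> c \<odot> \<one>) = 0) = c" using c by (intro the_equality)
  then show ?thesis using x by (simp add: scalar_part_def)
qed

lemma scalar_part: "x \<in> carrier A \<Longrightarrow> p (x \<ominus> scalar_part x \<odot> \<one>) = 0"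
  using scalar_exists[of x] scalar_part_eq[of x] by auto

text \<open>The elements with \<open>p y = 0\<close> form an ideal complementary to the scalars, and
  \<open>scalar_part\<close> is the projection along it. Any splitting into a null element and a
  scalar computes it, which yields all homomorphism laws.\<close>

lemma scalar_partI:
  assumes "x \<in> carrier A" "y \<in> carrier A" "p y = 0" "x = y \<oplus> c \<odot> \<one>"
  shows "scalar_part x = c"
proof (rule scalar_part_eq)
  have "x \<ominus> c \<odot> \<one> = y"
    using assms(2) unfolding assms(4) by (simp add: minus_eq_sm sm_sm a_assoc sm_sum[of _ c "-c" 0])
  then show "p (x \<ominus> c \<odot> \<one>) = 0" using assms by simp
qed fact

lemma scalar_part_decompose:
  assumes "x \<in> carrier A"
  obtains y where "y \<in> carrier A" "p y = 0" "x = y \<oplus> scalar_part x \<odot> \<one>"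
proof (rule that)
  show "x = (x \<ominus> scalar_part x \<odot> \<one>) \<oplus> scalar_part x \<odot> \<one>"
    using assms by (simp add: minus_eq_sm sm_sm a_assoc sm_sum[of _ "- c" c 0 for c])
qed (use assms scalar_part in auto)

lemma p_null_add: "\<lbrakk>x \<in> carrier A; y \<in> carrier A; p x = 0; p y = 0\<rbrakk> \<Longrightarrow> p (x \<oplus> y) = 0"
  by (rule antisym) (use p_add[of x y] in auto)

lemma scalar_part_add:
  assumes x: "x \<in> carrier A" and y: "y \<in> carrier A"
  shows "scalar_part (x \<oplus> y) = scalar_part x + scalar_part y"
proof -
  obtain u where u: "u \<in> carrier A" "p u = 0" "x = u \<oplus> scalar_part x \<odot> \<one>" by (rule scalar_part_decompose[OF x])
  obtain v where v: "v \<in> carrier A" "p v = 0" "y = v \<oplus> scalar_part y \<odot> \<one>" by (rule scalar_part_decompose[OF y])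
  show ?thesis
  proof (rule scalar_partI[of _ "u \<oplus> v"])
    have "x \<oplus> y = (u \<oplus> scalar_part x \<odot> \<one>) \<oplus> (v \<oplus> scalar_part y \<odot> \<one>)" using u(3) v(3) by simp
    then show "x \<oplus> y = u \<oplus> v \<oplus> (scalar_part x + scalar_part y) \<odot> \<one>" using u(1) v(1) by (simp add: sm_add_left a_ac)
  qed (use x y u v p_null_add in auto)
qed

lemma scalar_part_sm:
  assumes x: "x \<in> carrier A"
  shows "scalar_part (c \<odot> x) = c * scalar_part x"
proof -
  obtain u where u: "u \<in> carrier A" "p u = 0" "x = u \<oplus> scalar_part x \<odot> \<one>" by (rule scalar_part_decompose[OF x])
  show ?thesis
  proof (rule scalar_partI[of _ "c \<odot> u"])
    have "c \<odot> x = c \<odot> (u \<oplus> scalar_part x \<odot> \<one>)" using u(3) by simp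
    then show "c \<odot> x = c \<odot> u \<oplus> (c * scalar_part x) \<odot> \<one>" using u(1) by (simp add: sm_add_right sm_sm)
  qed (use x u in \<open>auto simp: p_sm\<close>)
qed

lemma scalar_part_star:
  assumes x: "x \<in> carrier A"
  shows "scalar_part (star A x) = cnj (scalar_part x)"
proof -
  obtain u where u: "u \<in> carrier A" "p u = 0" "x = u \<oplus> scalar_part x \<odot> \<one>" by (rule scalar_part_decompose[OF x])
  show ?thesis
  proof (rule scalar_partI[of _ "star A u"])
    have "star A x = star A (u \<oplus> scalar_part x \<odot> \<one>)" using u(3) by simp
    then show "star A x = star A u \<oplus> cnj (scalar_part x) \<odot> \<one>" using u(1) by (simp add: star_add star_smult)
  qed (use x u in \<open>auto simp: p_star\<close>)
qed

lemma scalar_part_one: "scalar_part \<one> = 1"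
  by (rule scalar_partI[of _ \<zero>]) simp_all

lemma scalar_part_mult:
  assumes x: "x \<in> carrier A" and y: "y \<in> carrier A"
  shows "scalar_part (x \<otimes> y) = scalar_part x * scalar_part y"
proof -
  obtain v where v: "v \<in> carrier A" "p v = 0" "y = v \<oplus> scalar_part y \<odot> \<one>" by (rule scalar_part_decompose[OF y])
  obtain u where u: "u \<in> carrier A" "p u = 0" "x = u \<oplus> scalar_part x \<odot> \<one>" by (rule scalar_part_decompose[OF x])
  show ?thesis
  proof (rule scalar_partI[of _ "x \<otimes> v \<oplus> scalar_part y \<odot> u"])
    have "x \<otimes> y = x \<otimes> (v \<oplus> scalar_part y \<odot> \<one>)" using v(3) by simp
    also have "\<dots> = x \<otimes> v \<oplus> scalar_part y \<odot> x"
      using x v(1) by (simp add: r_distr sm_mult_right)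
    also have "scalar_part y \<odot> x = scalar_part y \<odot> (u \<oplus> scalar_part x \<odot> \<one>)" using u(3) by simp
    finally show "x \<otimes> y = x \<otimes> v \<oplus> scalar_part y \<odot> u \<oplus> (scalar_part x * scalar_part y) \<odot> \<one>"
      using x u(1) v(1) by (simp add: sm_add_right sm_sm a_assoc mult.commute)
  qed (use x y u v in \<open>auto intro!: p_null_add simp: p_sm p_mult_eq\<close>)
qed

lemma cmod_scalar_part: "x \<in> carrier A \<Longrightarrow> cmod (scalar_part x) = p x"
  using p_reverse_triangle[of x "scalar_part x \<odot> \<one>"] scalar_part[of x] by (simp add: p_scalar)

lemma scalar_part_star_character: "scalar_part \<in> star_characters A"
proof -
  have "scalar_part \<in> extensional (carrier A)"
    by (simp add: scalar_part_def extensional_def)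
  then show ?thesis
    by (simp add: star_characters_def scalar_part_add scalar_part_mult scalar_part_one scalar_part_sm scalar_part_star)
qed

end

text \<open>A minimal seminorm \<open>q\<close> sharp at \<open>x\<close> is multiplicative, so its
  scalar part is a character with modulus \<open>q\<close>, which lies below \<open>p\<close> and
  equals \<open>p\<close> at \<open>x\<close>.\<close>

theorem (in Cstar_seminormed_algebra) norming_character:
  assumes x: "x \<in> carrier A" and px: "0 < p x"
  shows "\<exists>u \<in> star_characters A. (\<forall>y \<in> carrier A. cmod (u y) \<le> p y) \<and> cmod (u x) = p x"
proof -
  obtain q where q: "q \<in> sharp_seminorms x" and min: "\<And>r. \<lbrakk>r \<in> sharp_seminorms x; r \<le> q\<rbrakk> \<Longrightarrow> r = q"
    using minimal_sharp_seminorm[OF x px] by blast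
  interpret q: multiplicative_Cstar_seminorm A q
    using q minimal_sharp_seminorm_mult[OF x q min] by unfold_locales (auto simp: sharp_seminorms_def)
  have "q x = p x"
    using q x by (simp add: sharp_seminorms_def) (metis mult.right_neutral one_closed r_one)
  moreover have "cmod (q.scalar_part y) \<le> p y" if "y \<in> carrier A" for y
    using q that by (simp add: q.cmod_scalar_part sharp_seminorms_def)
  ultimately show ?thesis
    using q.scalar_part_star_character q.cmod_scalar_part[OF x] by metis
qed

section \<open>Algebras topologised by $C^*$-seminorms\<close>

lemma star_charactersD:
  assumes "u \<in> star_characters A"
  shows "u \<in> extensional (carrier A)"
    and "\<lbrakk>x \<in> carrier A; y \<in> carrier A\<rbrakk> \<Longrightarrow> u (x \<oplus>\<^bsub>A\<^esub> y) = u x + u y"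
    and "\<lbrakk>x \<in> carrier A; y \<in> carrier A\<rbrakk> \<Longrightarrow> u (x \<otimes>\<^bsub>A\<^esub> y) = u x * u y"
    and "u \<one>\<^bsub>A\<^esub> = 1"
    and "x \<in> carrier A \<Longrightarrow> u (c \<odot>\<^bsub>A\<^esub> x) = c * u x"
    and "x \<in> carrier A \<Longrightarrow> u (star A x) = cnj (u x)"
  using assms by (auto simp: star_characters_def)

lemma (in involutive_algebra) star_character_minus:
  assumes "u \<in> star_characters A" "x \<in> carrier A" "y \<in> carrier A"
  shows "u (x \<ominus> y) = u x - u y"
  using assms by (simp add: minus_eq_sm star_charactersD)

lemma (in involutive_algebra) star_character_zero: "u \<in> star_characters A \<Longrightarrow> u \<zero> = 0"
  using star_charactersD(5)[of u A \<zero> 0] by simp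

text \<open>Lets results on C*-seminorms be applied to characters whose continuity is not yet
  known.\<close>

lemma Cstar_seminorm_star_character:
  assumes "involutive_algebra A" "u \<in> star_characters A"
  shows "Cstar_seminorm A (\<lambda>x. cmod (u x))"
proof -
  interpret involutive_algebra A by fact
  show ?thesis
    using assms(2) by (simp add: Cstar_seminorm_def star_charactersD norm_triangle_ineq norm_mult power2_eq_square)
qed

lemma Kstar_hom_complex_Kstar:
  "Kstar_hom A complex_Kstar = {u \<in> star_characters A. continuous_map (topo A) euclidean u}"
  by (auto simp: Kstar_hom_def star_characters_def ring_hom_def complex_Kstar_def)

section \<open>Finite maxima of seminorms and the topology they define\<close>

text \<open>Inserting 0 gives the zero function for \<open>F = {}\<close>, so neighbourhoods for the
  empty family are covered.\<close>

definition pmax :: "('a \<Rightarrow> real) set \<Rightarrow> 'a \<Rightarrow> real" where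
  "pmax F x = Max (insert 0 ((\<lambda>p. p x) ` F))"

lemma pmax_le_iff: "finite F \<Longrightarrow> pmax F x \<le> e \<longleftrightarrow> 0 \<le> e \<and> (\<forall>p \<in> F. p x \<le> e)"
  by (simp add: pmax_def)

lemma pmax_less_iff: "finite F \<Longrightarrow> pmax F x < e \<longleftrightarrow> 0 < e \<and> (\<forall>p \<in> F. p x < e)"
  by (simp add: pmax_def)

lemma le_pmax: "\<lbrakk>finite F; p \<in> F\<rbrakk> \<Longrightarrow> p x \<le> pmax F x"
  using pmax_le_iff[of F x "pmax F x"] by simp

lemma pmax_nonneg [simp]: "finite F \<Longrightarrow> 0 \<le> pmax F x"
  by (simp add: pmax_def)

lemma pmax_mono: "\<lbrakk>finite G; F \<subseteq> G\<rbrakk> \<Longrightarrow> pmax F x \<le> pmax G x"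
  using finite_subset[of F G] by (auto simp: pmax_le_iff intro: le_pmax)

lemma pmax_cases: "finite F \<Longrightarrow> pmax F x = 0 \<or> (\<exists>p \<in> F. pmax F x = p x)"
  unfolding pmax_def using Max_in[of "insert 0 ((\<lambda>p. p x) ` F)"] by auto

text \<open>Completeness and the Hausdorff property are left out, so that the locale applies to
  function algebras and to copies of algebras before these are established.\<close>

locale Cstar_topological_algebra = involutive_algebra A
  for A :: "('a, 'm) top_star_algebra_scheme" (structure) +
  fixes P :: "('a \<Rightarrow> real) set"
  assumes Cstar_seminorms: "p \<in> P \<Longrightarrow> Cstar_seminorm A p"
    and topo_eq: "topo A = seminorm_topology A P"
begin

lemma P_seminorm: "p \<in> P \<Longrightarrow> Cstar_seminormed_algebra A p"
  by unfold_locales (rule Cstar_seminorms)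

text \<open>Each basic neighbourhood thereby becomes a ball of one C*-seminorm, to which the theory
  of a single seminorm applies.\<close>

lemma pmax_seminorm:
  assumes F: "finite F" "F \<subseteq> P"
  shows "Cstar_seminormed_algebra A (pmax F)"
proof unfold_locales
  note P = P_seminorm[OF subsetD[OF F(2)]]
  show "Cstar_seminorm A (pmax F)"
    unfolding Cstar_seminorm_def
  proof (intro conjI ballI allI)
    fix x y assume x: "x \<in> carrier A" and y: "y \<in> carrier A"
    have "p (x \<oplus> y) \<le> pmax F x + pmax F y" if p: "p \<in> F" for p
      by (rule order_trans[OF Cstar_seminormed_algebra.p_add[OF P[OF p] x y] add_mono[OF le_pmax[OF F(1) p] le_pmax[OF F(1) p]]])
    then show "pmax F (x \<oplus> y) \<le> pmax F x + pmax F y"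
      using F by (simp add: pmax_le_iff)
  next
    fix c x assume x: "x \<in> carrier A"
    have eq: "p (c \<odot> x) = cmod c * p x" if "p \<in> F" for p
      by (rule Cstar_seminormed_algebra.p_sm[OF P[OF that] x])
    show "pmax F (c \<odot> x) = cmod c * pmax F x"
    proof (rule antisym)
      show "pmax F (c \<odot> x) \<le> cmod c * pmax F x"
        using F by (auto simp: pmax_le_iff eq intro!: mult_left_mono le_pmax)
      show "cmod c * pmax F x \<le> pmax F (c \<odot> x)"
        using pmax_cases[OF F(1), of x] le_pmax[OF F(1), of _ "c \<odot> x"] F by (auto simp: eq)
    qed
  next
    fix x assume x: "x \<in> carrier A"
    have eq: "p (x \<otimes> star A x) = (p x)\<^sup>2" if "p \<in> F" for p
      by (rule Cstar_seminormed_algebra.p_mult_star[OF P[OF that] x])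
    have nn: "0 \<le> p x" if "p \<in> F" for p
      by (rule Cstar_seminormed_algebra.p_nonneg[OF P[OF that] x])
    show "pmax F (x \<otimes> star A x) = (pmax F x)\<^sup>2"
    proof (rule antisym)
      show "pmax F (x \<otimes> star A x) \<le> (pmax F x)\<^sup>2"
        using F nn by (auto simp: pmax_le_iff eq intro!: power_mono le_pmax)
      show "(pmax F x)\<^sup>2 \<le> pmax F (x \<otimes> star A x)"
        using pmax_cases[OF F(1), of x] le_pmax[OF F(1), of _ "x \<otimes> star A x"] F by (auto simp: eq)
    qed
  qed
qed

lemma openin_topo:
  "openin (topo A) U \<longleftrightarrow> U \<subseteq> carrier A \<and>
     (\<forall>x \<in> U. \<exists>F e. finite F \<and> F \<subseteq> P \<and> e > 0 \<and> {y \<in> carrier A. pmax F (y \<ominus> x) < e} \<subseteq> U)"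
  unfolding topo_eq openin_seminorm_topology
  by (intro conj_cong ball_cong ex_cong1 refl) (auto simp: pmax_less_iff)

lemma topspace_topo [simp]: "topspace (topo A) = carrier A"
proof
  have "openin (topo A) (carrier A)"
    \<comment> \<open>For the empty family the ball of radius 1 is the whole carrier.\<close>
    unfolding openin_topo by (auto intro!: exI[of _ "{}"] exI[of _ 1])
  then show "carrier A \<subseteq> topspace (topo A)" by (rule openin_subset)
  show "topspace (topo A) \<subseteq> carrier A"
    using openin_topspace[of "topo A"] unfolding openin_topo by blast
qed

lemma openin_ball:
  assumes F: "finite F" "F \<subseteq> P" and x: "x \<in> carrier A"
  shows "openin (topo A) {y \<in> carrier A. pmax F (y \<ominus> x) < e}"
  unfolding openin_topo
proof (intro conjI ballI)
  interpret p: Cstar_seminormed_algebra A "pmax F" by (rule pmax_seminorm[OF F])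
  fix y assume "y \<in> {y \<in> carrier A. pmax F (y \<ominus> x) < e}"
  then have y: "y \<in> carrier A" "pmax F (y \<ominus> x) < e" by auto
  have "pmax F (z \<ominus> x) < e" if "z \<in> carrier A" "pmax F (z \<ominus> y) < e - pmax F (y \<ominus> x)" for z
    using p.p_triangle[of z y x] that x y by simp
  then show "\<exists>G d. finite G \<and> G \<subseteq> P \<and> d > 0 \<and> {z \<in> carrier A. pmax G (z \<ominus> y) < d} \<subseteq> {y \<in> carrier A. pmax F (y \<ominus> x) < e}"
    using F y by (intro exI[of _ F] exI[of _ "e - pmax F (y \<ominus> x)"]) auto
qed auto

lemma minus_zero_right [simp]: "x \<in> carrier A \<Longrightarrow> x \<ominus> \<zero> = x"
  by (simp add: minus_eq)

lemma minus_self [simp]: "x \<in> carrier A \<Longrightarrow> x \<ominus> x = \<zero>"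
  by (simp add: minus_eq r_neg)

lemma zero_in_ball: "\<lbrakk>finite F; F \<subseteq> P; 0 < e; x \<in> carrier A\<rbrakk> \<Longrightarrow> pmax F (x \<ominus> x) < e"
  using Cstar_seminormed_algebra.p_zero[OF pmax_seminorm, of F] by simp

lemma openin_zero_ball:
  assumes F: "finite F" "F \<subseteq> P"
  shows "openin (topo A) {y \<in> carrier A. pmax F y < e}"
proof -
  have "{y \<in> carrier A. pmax F y < e} = {y \<in> carrier A. pmax F (y \<ominus> \<zero>) < e}" by auto
  then show ?thesis using openin_ball[OF F zero_closed] by simp
qed

lemma zero_nbhd:
  assumes "openin (topo A) U" "\<zero> \<in> U"
  obtains F e where "finite F" "F \<subseteq> P" "0 < e" "{y \<in> carrier A. pmax F y < e} \<subseteq> U"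
proof -
  obtain F e where F: "finite F" "F \<subseteq> P" "0 < e" "{y \<in> carrier A. pmax F (y \<ominus> \<zero>) < e} \<subseteq> U"
    using assms unfolding openin_topo by meson
  moreover have "{y \<in> carrier A. pmax F y < e} \<subseteq> {y \<in> carrier A. pmax F (y \<ominus> \<zero>) < e}" by auto
  ultimately show ?thesis using that by (meson order_trans)
qed

lemma limitin_topo:
  "limitin (topo A) f l \<F> \<longleftrightarrow> l \<in> carrier A \<and>
     (\<forall>F e. finite F \<longrightarrow> F \<subseteq> P \<longrightarrow> e > 0 \<longrightarrow> (\<forall>\<^sub>F x in \<F>. f x \<in> carrier A \<and> pmax F (f x \<ominus> l) < e))"
proof (safe, goal_cases)
  case 1
  then show ?case by (simp add: limitin_def)
next
  case (2 F e)
  then have l: "l \<in> carrier A" by (simp add: limitin_def)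
  from 2 have "\<forall>\<^sub>F x in \<F>. f x \<in> {y \<in> carrier A. pmax F (y \<ominus> l) < e}"
    using openin_ball[OF 2(2,3) l, of e] zero_in_ball[OF 2(2,3,4) l] l unfolding limitin_def by blast
  then show ?case by simp
next
  case 3
  show ?case unfolding limitin_def
  proof (intro conjI allI impI)
    show "l \<in> topspace (topo A)" using 3 by simp
    fix U assume "openin (topo A) U \<and> l \<in> U"
    then obtain F e where "finite F" "F \<subseteq> P" "0 < e" "{y \<in> carrier A. pmax F (y \<ominus> l) < e} \<subseteq> U"
      unfolding openin_topo by meson
    with 3 have "\<forall>\<^sub>F x in \<F>. f x \<in> carrier A \<and> pmax F (f x \<ominus> l) < e" by blast
    then show "\<forall>\<^sub>F x in \<F>. f x \<in> U"
      by (rule eventually_mono) (use \<open>{y \<in> carrier A. pmax F (y \<ominus> l) < e} \<subseteq> U\<close> in blast)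
  qed
qed

lemma Cauchy_filter_iff:
  "Cauchy_filter A \<F> \<longleftrightarrow> \<F> \<noteq> bot \<and>
     (\<forall>F e. finite F \<longrightarrow> F \<subseteq> P \<longrightarrow> e > 0 \<longrightarrow>
        (\<exists>S \<subseteq> carrier A. (\<forall>\<^sub>F x in \<F>. x \<in> S) \<and> (\<forall>x \<in> S. \<forall>y \<in> S. pmax F (x \<ominus> y) < e)))"
proof (safe, goal_cases)
  case 1
  then show ?case by (simp add: Cauchy_filter_def)
next
  case (2 F e)
  have "\<zero> \<in> {y \<in> carrier A. pmax F y < e}"
    using zero_in_ball[OF 2(2,3,4) zero_closed] by simp
  with 2 obtain S where "S \<subseteq> carrier A" "\<forall>\<^sub>F x in \<F>. x \<in> S"
      "\<forall>x \<in> S. \<forall>y \<in> S. x \<ominus> y \<in> {y \<in> carrier A. pmax F y < e}"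
    unfolding Cauchy_filter_def using openin_zero_ball[OF 2(2,3)] by meson
  then show ?case by blast
next
  case 3
  show ?case unfolding Cauchy_filter_def
  proof (intro conjI allI impI)
    fix U assume U: "openin (topo A) U \<and> \<zero> \<in> U"
    obtain F e where F: "finite F" "F \<subseteq> P" "0 < e" "{y \<in> carrier A. pmax F y < e} \<subseteq> U"
      by (rule zero_nbhd[OF conjunct1[OF U] conjunct2[OF U]])
    then obtain S where S: "S \<subseteq> carrier A" "\<forall>\<^sub>F x in \<F>. x \<in> S" "\<forall>x \<in> S. \<forall>y \<in> S. pmax F (x \<ominus> y) < e"
      using 3 by meson
    then have "\<forall>x \<in> S. \<forall>y \<in> S. x \<ominus> y \<in> U" using F(4) by (auto intro!: subsetD[OF F(4)])
    then show "\<exists>S \<subseteq> carrier A. (\<forall>\<^sub>F x in \<F>. x \<in> S) \<and> (\<forall>x \<in> S. \<forall>y \<in> S. x \<ominus> y \<in> U)"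
      using S by blast
  qed fact
qed

lemma Hausdorff_iff: "Hausdorff_space (topo A) \<longleftrightarrow> (\<forall>x \<in> carrier A. (\<forall>p \<in> P. p x = 0) \<longrightarrow> x = \<zero>)"
proof (intro iffI ballI impI)
  fix x assume haus: "Hausdorff_space (topo A)" and x: "x \<in> carrier A" and px: "\<forall>p \<in> P. p x = 0"
  show "x = \<zero>"
  proof (rule ccontr)
    assume "x \<noteq> \<zero>"
    then obtain U V where UV: "openin (topo A) U" "openin (topo A) V" "x \<in> U" "\<zero> \<in> V" "disjnt U V"
      using haus x unfolding Hausdorff_space_def topspace_topo by (metis zero_closed)
    obtain F e where F: "finite F" "F \<subseteq> P" "0 < e" "{y \<in> carrier A. pmax F y < e} \<subseteq> V"
      by (rule zero_nbhd[OF UV(2,4)])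
    have "p x < e" if "p \<in> F" for p using bspec[OF px subsetD[OF F(2) that]] F(3) by simp
    then have "pmax F x < e" using F(1,3) by (simp add: pmax_less_iff)
    then have "x \<in> V" using F x by blast
    then show False using UV by (auto simp: disjnt_iff)
  qed
next
  assume sep: "\<forall>x \<in> carrier A. (\<forall>p \<in> P. p x = 0) \<longrightarrow> x = \<zero>"
  show "Hausdorff_space (topo A)"
    unfolding Hausdorff_space_def topspace_topo
  proof (intro allI impI)
    fix x y assume xy: "x \<in> carrier A \<and> y \<in> carrier A \<and> x \<noteq> y"
    then have "x \<ominus> y \<noteq> \<zero>" by (metis add_cancel_middle l_zero minus_eq r_neg minus_closed add.inv_closed r_zero zero_closed minus_equality minus_minus)
    then obtain p where p: "p \<in> P" "p (x \<ominus> y) \<noteq> 0" using sep xy by (metis minus_closed)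
    interpret p: Cstar_seminormed_algebra A "pmax {p}" by (rule pmax_seminorm) (use p in auto)
    define e where "e = pmax {p} (x \<ominus> y) / 2"
    have e: "e > 0"
      using p le_pmax[of "{p}" p "x \<ominus> y"] Cstar_seminormed_algebra.p_nonneg[OF P_seminorm[OF p(1)], of "x \<ominus> y"] xy by (simp add: e_def)
    let ?U = "\<lambda>z. {y \<in> carrier A. pmax {p} (y \<ominus> z) < e}"
    have "disjnt (?U x) (?U y)"
      unfolding disjnt_iff using p.p_triangle[of x _ y] p.p_minus_commute[of x] xy by (fastforce simp: e_def)
    moreover have "x \<in> ?U x" "y \<in> ?U y" using xy e zero_in_ball[of "{p}" e] p by auto
    moreover have "openin (topo A) (?U x)" "openin (topo A) (?U y)" using xy p by (auto intro!: openin_ball)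
    ultimately show "\<exists>U V. openin (topo A) U \<and> openin (topo A) V \<and> x \<in> U \<and> y \<in> V \<and> disjnt U V" by blast
  qed
qed

lemma bounded_subset_iff:
  "bounded_subset A B \<longleftrightarrow> B \<subseteq> carrier A \<and> (\<forall>p \<in> P. \<exists>M. \<forall>x \<in> B. p x \<le> M)"
proof (intro iffI conjI ballI)
  assume B: "bounded_subset A B"
  then show "B \<subseteq> carrier A" by (simp add: bounded_subset_def)
  fix p assume p: "p \<in> P"
  interpret p: Cstar_seminormed_algebra A p by (rule P_seminorm[OF p])
  have "openin (topo A) {y \<in> carrier A. pmax {p} y < 1}" "\<zero> \<in> {y \<in> carrier A. pmax {p} y < 1}"
    using p openin_zero_ball[of "{p}" 1] by (simp_all add: pmax_less_iff)
  then obtain r where r: "r > 0" "\<And>c. cmod c \<ge> r \<Longrightarrow> B \<subseteq> (\<lambda>v. c \<odot> v) ` {y \<in> carrier A. pmax {p} y < 1}"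
    using B unfolding bounded_subset_def absorbs_def by blast
  have "p x \<le> r" if "x \<in> B" for x
  proof -
    obtain v where v: "v \<in> carrier A" "pmax {p} v < 1" "x = complex_of_real r \<odot> v"
      using r(2)[of "complex_of_real r"] r(1) \<open>x \<in> B\<close> by auto
    then show ?thesis using r(1) by (simp add: p.p_sm pmax_less_iff)
  qed
  then show "\<exists>M. \<forall>x \<in> B. p x \<le> M" by blast
next
  assume B: "B \<subseteq> carrier A \<and> (\<forall>p \<in> P. \<exists>M. \<forall>x \<in> B. p x \<le> M)"
  then obtain M where M: "\<And>p x. \<lbrakk>p \<in> P; x \<in> B\<rbrakk> \<Longrightarrow> p x \<le> M p" by metis
  show "bounded_subset A B"
    unfolding bounded_subset_def
  proof (intro conjI allI impI)
    show "B \<subseteq> carrier A" using B by blast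
    fix U assume U: "openin (topo A) U \<and> \<zero> \<in> U"
    obtain F e where F: "finite F" "F \<subseteq> P" "0 < e" "{y \<in> carrier A. pmax F y < e} \<subseteq> U"
      by (rule zero_nbhd[OF conjunct1[OF U] conjunct2[OF U]])
    interpret p: Cstar_seminormed_algebra A "pmax F" by (rule pmax_seminorm[OF F(1,2)])
    define m where "m = Max (insert 0 (M ` F))"
    have m: "0 \<le> m" "\<And>p. p \<in> F \<Longrightarrow> M p \<le> m" using F(1) by (auto simp: m_def)
    have xm: "pmax F x \<le> m" if "x \<in> B" for x
      using F(1,2) order_trans[OF M[OF _ that] m(2)] m(1) by (auto simp: pmax_le_iff)
    show "absorbs A U B"
      unfolding absorbs_def
    proof (intro exI conjI allI impI subsetI)
      \<comment> \<open>\<open>m + 1\<close> instead of \<open>m\<close> keeps the radius positive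
        and makes the bound \<open>m / cmod c < e\<close> strict.\<close>
      show "(m + 1) / e > 0" using m F by simp
      fix c x assume c: "(m + 1) / e \<le> cmod c" and x: "x \<in> B"
      have x': "x \<in> carrier A" using B x by blast
      have c0: "0 < cmod c" using less_le_trans[OF divide_pos_pos[of "m + 1" e] c] m(1) F(3) by linarith
      have "pmax F (inverse c \<odot> x) \<le> m / cmod c"
        using xm[OF x] x' c0 by (simp add: p.p_sm norm_inverse divide_inverse mult.commute mult_right_mono)
      also have "\<dots> < e" using c c0 F(3) m by (simp add: field_simps)
      finally have "inverse c \<odot> x \<in> U" using F(4) x' by blast
      moreover have "x = c \<odot> (inverse c \<odot> x)" using x' c0 by (simp add: sm_sm)
      ultimately show "x \<in> (\<lambda>v. c \<odot> v) ` U" by blast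
    qed
  qed
qed

section \<open>Continuity as domination by finitely many seminorms\<close>

text \<open>Scaling turns the bound 1 on a neighbourhood into domination with the constant
  \<open>2 / e\<close>, where the 2 keeps the scaled element inside the open ball;
  \<open>p_le_of_le_mult\<close> then removes the constant.\<close>

lemma Cstar_seminorm_le_pmax:
  assumes r: "Cstar_seminorm A r" and U: "openin (topo A) U" "\<zero> \<in> U" "\<And>x. x \<in> U \<Longrightarrow> r x \<le> 1"
  obtains F where "finite F" "F \<subseteq> P" "\<And>x. x \<in> carrier A \<Longrightarrow> r x \<le> pmax F x"
proof -
  interpret r: Cstar_seminormed_algebra A r using r by unfold_locales
  obtain F e where F: "finite F" "F \<subseteq> P" "0 < e" "{y \<in> carrier A. pmax F y < e} \<subseteq> U"
    by (rule zero_nbhd[OF U(1,2)])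
  interpret p: Cstar_seminormed_algebra A "pmax F" by (rule pmax_seminorm[OF F(1,2)])
  have scaled: "t * r x \<le> 1" if x: "x \<in> carrier A" and t: "0 < t" "t * pmax F x < e" for x t
  proof -
    have "complex_of_real t \<odot> x \<in> U" using F x t by (intro subsetD[OF F(4)]) (simp add: p.p_sm)
    then have "r (complex_of_real t \<odot> x) \<le> 1" by (rule U)
    then show ?thesis using x t by (simp add: r.p_sm)
  qed
  have "r x \<le> (2 / e) * pmax F x" if x: "x \<in> carrier A" for x
  proof (cases "pmax F x = 0")
    case True
    have "r x = 0"
    proof (rule ccontr)
      assume "r x \<noteq> 0"
      then have "0 < r x" using r.p_nonneg[OF x] by linarith
      \<comment> \<open>The whole line through \<open>x\<close> lies in the ball, and the multiple
        by \<open>2 / r x\<close> would have seminorm 2.\<close>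
      then show False using scaled[OF x, of "2 / r x"] True F(3) by simp
    qed
    then show ?thesis using True by simp
  next
    case False
    then have "0 < pmax F x" using p.p_nonneg[OF x] by linarith
    then show ?thesis using scaled[OF x, of "e / (2 * pmax F x)"] F(3) by (simp add: field_simps)
  qed
  then have "r x \<le> pmax F x" if "x \<in> carrier A" for x
    using p.p_le_of_le_mult[OF r _ that] by blast
  then show ?thesis using that F by blast
qed

text \<open>Compatibility with subtraction reduces continuity to an estimate at the origin.\<close>

lemma continuous_map_le_pmax:
  assumes B: "Cstar_topological_algebra B Q"
    and u: "\<And>x. x \<in> carrier A \<Longrightarrow> u x \<in> carrier B"
    and diff: "\<And>x y. \<lbrakk>x \<in> carrier A; y \<in> carrier A\<rbrakk> \<Longrightarrow> u (x \<ominus> y) = u x \<ominus>\<^bsub>B\<^esub> u y"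
    and le: "\<And>q. q \<in> Q \<Longrightarrow> \<exists>F. finite F \<and> F \<subseteq> P \<and> (\<forall>x \<in> carrier A. q (u x) \<le> pmax F x)"
  shows "continuous_map (topo A) (topo B) u"
proof -
  interpret B: Cstar_topological_algebra B Q by fact
  show ?thesis
    unfolding continuous_map_def topspace_topo B.topspace_topo
  proof (intro conjI allI impI)
    show "u \<in> carrier A \<rightarrow> carrier B" using u by blast
    fix U assume U: "openin (topo B) U"
    show "openin (topo A) {x \<in> carrier A. u x \<in> U}"
      unfolding openin_topo
    proof (intro conjI ballI)
      fix x assume "x \<in> {x \<in> carrier A. u x \<in> U}"
      then have x: "x \<in> carrier A" "u x \<in> U" by auto
      obtain G e where G: "finite G" "G \<subseteq> Q" "0 < e" "{y \<in> carrier B. pmax G (y \<ominus>\<^bsub>B\<^esub> u x) < e} \<subseteq> U"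
        using U x(2) unfolding B.openin_topo by meson
      obtain f where f: "\<And>q. q \<in> Q \<Longrightarrow> finite (f q) \<and> f q \<subseteq> P \<and> (\<forall>x \<in> carrier A. q (u x) \<le> pmax (f q) x)"
        using le by metis
      let ?F = "\<Union> (f ` G)"
      have F: "finite ?F" "?F \<subseteq> P" using G f by blast+
      have "q (u z) \<le> pmax ?F z" if "z \<in> carrier A" "q \<in> G" for z q
        using f[of q] that G(2) pmax_mono[OF F(1), of "f q" z] by force
      then have le_F: "pmax G (u z) \<le> pmax ?F z" if z: "z \<in> carrier A" for z
        using G(1) F(1) z by (simp add: pmax_le_iff)
      have "u y \<in> U" if "y \<in> carrier A" "pmax ?F (y \<ominus> x) < e" for y
      proof (rule subsetD[OF G(4)])
        have "pmax G (u (y \<ominus> x)) < e"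
          using le_less_trans[OF le_F that(2)] that(1) x by simp
        then show "u y \<in> {y \<in> carrier B. pmax G (y \<ominus>\<^bsub>B\<^esub> u x) < e}" using that x u by (simp add: diff)
      qed
      then show "\<exists>F e. finite F \<and> F \<subseteq> P \<and> e > 0 \<and> {y \<in> carrier A. pmax F (y \<ominus> x) < e} \<subseteq> {x \<in> carrier A. u x \<in> U}"
        using F G(3) by blast
    qed auto
  qed
qed

lemma continuous_character:
  assumes u: "u \<in> star_characters A" and F: "finite F" "F \<subseteq> P" and le: "\<And>x. x \<in> carrier A \<Longrightarrow> cmod (u x) \<le> pmax F x"
  shows "continuous_map (topo A) euclidean u"
  unfolding continuous_map_def
proof (intro conjI allI impI)
  fix U :: "complex set" assume "openin euclidean U"
  then have U: "open U" by simp
  show "openin (topo A) {x \<in> topspace (topo A). u x \<in> U}"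
    unfolding openin_topo
  proof (intro conjI ballI)
    fix x assume "x \<in> {x \<in> topspace (topo A). u x \<in> U}"
    then have x: "x \<in> carrier A" "u x \<in> U" by auto
    then obtain e where e: "e > 0" "ball (u x) e \<subseteq> U" using U open_contains_ball by blast
    have "u y \<in> U" if "y \<in> carrier A" "pmax F (y \<ominus> x) < e" for y
      using le[of "y \<ominus> x"] that x e by (auto simp: star_character_minus[OF u] dist_norm norm_minus_commute intro!: subsetD[OF e(2)])
    then show "\<exists>F e. finite F \<and> F \<subseteq> P \<and> e > 0 \<and> {y \<in> carrier A. pmax F (y \<ominus> x) < e} \<subseteq> {x \<in> topspace (topo A). u x \<in> U}"
      using F e(1) by (auto intro!: exI[of _ F] exI[of _ e])
  qed auto
qed auto

text \<open>A continuous character has modulus below 1 near zero, and its modulus is a C*-seminorm,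
  so no constant appears. Hence the spectrum is the union of the sets of characters dominated by
  some \<open>pmax F\<close>.\<close>

lemma continuous_character_iff:
  assumes u: "u \<in> star_characters A"
  shows "continuous_map (topo A) euclidean u \<longleftrightarrow>
    (\<exists>F. finite F \<and> F \<subseteq> P \<and> (\<forall>x \<in> carrier A. cmod (u x) \<le> pmax F x))"
proof
  assume "continuous_map (topo A) euclidean u"
  then have "openin (topo A) {x \<in> topspace (topo A). u x \<in> ball 0 1}"
    by (rule openin_continuous_map_preimage) simp
  then obtain F where "finite F" "F \<subseteq> P" "\<And>x. x \<in> carrier A \<Longrightarrow> cmod (u x) \<le> pmax F x"
    by (rule Cstar_seminorm_le_pmax[OF Cstar_seminorm_star_character[OF involutive_algebra_axioms u]])
      (simp_all add: star_character_zero[OF u] dist_norm)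
  then show "\<exists>F. finite F \<and> F \<subseteq> P \<and> (\<forall>x \<in> carrier A. cmod (u x) \<le> pmax F x)" by blast
qed (use continuous_character[OF u] in blast)

end

section \<open>The spectrum and the algebra of continuous functions\<close>

lemma topspace_spectrum: "topspace (spectrum A) = Kstar_hom A complex_Kstar"
  by (auto simp: spectrum_def Kstar_hom_def extensional_def PiE_def)

lemma continuous_map_spectrum_eval:
  "x \<in> carrier A \<Longrightarrow> continuous_map (spectrum A) euclidean (\<lambda>u. u x)"
  unfolding spectrum_def
  by (rule continuous_map_from_subtopology) (rule continuous_map_product_projection)

lemma continuous_map_into_spectrum:
  assumes "\<And>t. t \<in> topspace X \<Longrightarrow> f t \<in> Kstar_hom A complex_Kstar"
    and "\<And>x. x \<in> carrier A \<Longrightarrow> continuous_map X euclidean (\<lambda>t. f t x)"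
  shows "continuous_map X (spectrum A) f"
  unfolding spectrum_def continuous_map_in_subtopology continuous_map_componentwise
  using assms by (auto simp: Kstar_hom_def)

lemma Tychonoff_spectrum: "Tychonoff_space (spectrum A)"
  unfolding Tychonoff_space_def spectrum_def
  by (intro conjI completely_regular_space_subtopology Hausdorff_space_subtopology)
    (simp_all add: completely_regular_space_product_topology Hausdorff_space_product_topology
      metrizable_imp_completely_regular_space metrizable_space_euclidean)

text \<open>Each law equates two continuous functions of finitely many coordinates.\<close>

lemma closedin_star_characters:
  assumes "involutive_algebra A"
  shows "closedin (product_topology (\<lambda>_. euclidean) (carrier A)) (star_characters A)"
proof -
  interpret involutive_algebra A by fact
  let ?X = "product_topology (\<lambda>_. euclidean :: complex topology) (carrier A)"
  have proj: "continuous_map ?X euclidean (\<lambda>u. u x)" if "x \<in> carrier A" for x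
    by (rule continuous_map_product_projection[OF that])
  have eq: "closedin ?X {u \<in> topspace ?X. f u = g u}"
    if "continuous_map ?X euclidean f" "continuous_map ?X euclidean g" for f g :: "_ \<Rightarrow> complex"
  proof -
    have "closedin ?X {u \<in> topspace ?X. f u - g u \<in> {0}}"
      by (rule closedin_continuous_map_preimage[OF continuous_map_diff[OF that]]) simp
    then show ?thesis by simp
  qed
  have mult: "continuous_map ?X euclidean (\<lambda>u. f u * g u)"
    if "continuous_map ?X euclidean f" "continuous_map ?X euclidean g" for f g :: "_ \<Rightarrow> complex"
    using that by (simp add: continuous_map_atin tendsto_mult)
  have cnj: "continuous_map ?X euclidean (\<lambda>u. cnj (f u))"
    if "continuous_map ?X euclidean f" for f :: "_ \<Rightarrow> complex"
    using that by (simp add: continuous_map_atin tendsto_cnj)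
  have "star_characters A = {u \<in> topspace ?X. u \<one>\<^bsub>A\<^esub> = 1}
      \<inter> (\<Inter>x\<in>carrier A. \<Inter>y\<in>carrier A. {u \<in> topspace ?X. u (x \<oplus>\<^bsub>A\<^esub> y) = u x + u y})
      \<inter> (\<Inter>x\<in>carrier A. \<Inter>y\<in>carrier A. {u \<in> topspace ?X. u (x \<otimes>\<^bsub>A\<^esub> y) = u x * u y})
      \<inter> (\<Inter>c. \<Inter>x\<in>carrier A. {u \<in> topspace ?X. u (c \<odot>\<^bsub>A\<^esub> x) = c * u x})
      \<inter> (\<Inter>x\<in>carrier A. {u \<in> topspace ?X. u (star A x) = cnj (u x)})"
    unfolding star_characters_def by (auto simp: PiE_def)
  moreover have "closedin ?X \<dots>"
    by (intro closedin_Int closedin_INT eq mult cnj continuous_map_add proj) (auto intro: proj)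
  ultimately show ?thesis by simp
qed

text \<open>A closed subset of a product of discs, as in the Banach--Alaoglu theorem.\<close>

lemma compactin_star_characters:
  assumes "involutive_algebra A"
  shows "compactin (product_topology (\<lambda>_. euclidean) (carrier A))
    {u \<in> star_characters A. \<forall>x \<in> carrier A. cmod (u x) \<le> r x}"
proof -
  have eq: "{u \<in> star_characters A. \<forall>x \<in> carrier A. cmod (u x) \<le> r x}
      = PiE (carrier A) (\<lambda>x. cball 0 (r x)) \<inter> star_characters A"
    by (auto simp: star_characters_def PiE_def)
  have "compactin (product_topology (\<lambda>_. euclidean) (carrier A)) (PiE (carrier A) (\<lambda>x. cball (0::complex) (r x)))"
    by (simp add: compactin_PiE)
  then show ?thesis
    unfolding eq by (rule compact_Int_closedin[OF _ closedin_star_characters[OF assms]])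
qed

text \<open>Compactness holds in the full product; the assumed continuity of the dominated
  characters places the set inside the spectrum.\<close>

lemma compactin_spectrum:
  assumes "involutive_algebra A"
    and "\<And>u. \<lbrakk>u \<in> star_characters A; \<And>x. x \<in> carrier A \<Longrightarrow> cmod (u x) \<le> r x\<rbrakk> \<Longrightarrow> continuous_map (topo A) euclidean u"
  shows "compactin (spectrum A) {u \<in> star_characters A. \<forall>x \<in> carrier A. cmod (u x) \<le> r x}"
  unfolding spectrum_def compactin_subtopology
  using assms by (auto intro: compactin_star_characters simp: Kstar_hom_complex_Kstar)

section \<open>The function algebra with the compact-open topology\<close>

lemma involutive_algebraI:
  fixes A (structure)
  assumes "\<And>x y. \<lbrakk>x \<in> carrier A; y \<in> carrier A\<rbrakk> \<Longrightarrow> x \<oplus> y \<in> carrier A"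
    and "\<zero> \<in> carrier A"
    and "\<And>x y z. \<lbrakk>x \<in> carrier A; y \<in> carrier A; z \<in> carrier A\<rbrakk> \<Longrightarrow> (x \<oplus> y) \<oplus> z = x \<oplus> (y \<oplus> z)"
    and "\<And>x y. \<lbrakk>x \<in> carrier A; y \<in> carrier A\<rbrakk> \<Longrightarrow> x \<oplus> y = y \<oplus> x"
    and "\<And>x. x \<in> carrier A \<Longrightarrow> \<zero> \<oplus> x = x"
    and "\<And>x. x \<in> carrier A \<Longrightarrow> \<exists>y \<in> carrier A. y \<oplus> x = \<zero>"
    and "\<And>x y. \<lbrakk>x \<in> carrier A; y \<in> carrier A\<rbrakk> \<Longrightarrow> x \<otimes> y \<in> carrier A"
    and "\<one> \<in> carrier A"
    and "\<And>x y z. \<lbrakk>x \<in> carrier A; y \<in> carrier A; z \<in> carrier A\<rbrakk> \<Longrightarrow> (x \<otimes> y) \<otimes> z = x \<otimes> (y \<otimes> z)"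
    and "\<And>x. x \<in> carrier A \<Longrightarrow> \<one> \<otimes> x = x"
    and "\<And>x y. \<lbrakk>x \<in> carrier A; y \<in> carrier A\<rbrakk> \<Longrightarrow> x \<otimes> y = y \<otimes> x"
    and "\<And>x y z. \<lbrakk>x \<in> carrier A; y \<in> carrier A; z \<in> carrier A\<rbrakk> \<Longrightarrow> (x \<oplus> y) \<otimes> z = x \<otimes> z \<oplus> y \<otimes> z"
    and "\<And>c x. x \<in> carrier A \<Longrightarrow> c \<odot> x \<in> carrier A"
    and "\<And>c d x. x \<in> carrier A \<Longrightarrow> (c + d) \<odot> x = c \<odot> x \<oplus> d \<odot> x"
    and "\<And>c x y. \<lbrakk>x \<in> carrier A; y \<in> carrier A\<rbrakk> \<Longrightarrow> c \<odot> (x \<oplus> y) = c \<odot> x \<oplus> c \<odot> y"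
    and "\<And>c d x. x \<in> carrier A \<Longrightarrow> (c * d) \<odot> x = c \<odot> (d \<odot> x)"
    and "\<And>x. x \<in> carrier A \<Longrightarrow> 1 \<odot> x = x"
    and "\<And>c x y. \<lbrakk>x \<in> carrier A; y \<in> carrier A\<rbrakk> \<Longrightarrow> (c \<odot> x) \<otimes> y = c \<odot> (x \<otimes> y)"
    and "\<And>x. x \<in> carrier A \<Longrightarrow> star A x \<in> carrier A"
    and "\<And>x y. \<lbrakk>x \<in> carrier A; y \<in> carrier A\<rbrakk> \<Longrightarrow> star A (x \<oplus> y) = star A x \<oplus> star A y"
    and "\<And>c x. x \<in> carrier A \<Longrightarrow> star A (c \<odot> x) = cnj c \<odot> star A x"
    and "\<And>x. x \<in> carrier A \<Longrightarrow> star A (star A x) = x"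
    and "\<And>x y. \<lbrakk>x \<in> carrier A; y \<in> carrier A\<rbrakk> \<Longrightarrow> star A (x \<otimes> y) = star A y \<otimes> star A x"
  shows "involutive_algebra A"
proof -
  have "cring A"
    by (intro cringI abelian_groupI comm_monoidI) (use assms in simp_all)
  then have "algebra complex_ring A"
    by (intro algebraI cring_complex_ring) (use assms in simp_all)
  then show ?thesis
    by (intro involutive_algebra.intro involutive_algebra_axioms.intro) (use assms in simp_all)
qed

lemma cont_algebra_simps:
  "x \<otimes>\<^bsub>cont_algebra T\<^esub> y = (\<lambda>t \<in> topspace T. x t * y t)"
  "\<one>\<^bsub>cont_algebra T\<^esub> = (\<lambda>t \<in> topspace T. 1)"
  "\<zero>\<^bsub>cont_algebra T\<^esub> = (\<lambda>t \<in> topspace T. 0)"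
  "x \<oplus>\<^bsub>cont_algebra T\<^esub> y = (\<lambda>t \<in> topspace T. x t + y t)"
  "c \<odot>\<^bsub>cont_algebra T\<^esub> x = (\<lambda>t \<in> topspace T. c * x t)"
  "star (cont_algebra T) x = (\<lambda>t \<in> topspace T. cnj (x t))"
  by (simp_all add: cont_algebra_def cont_star_algebra_def star_algebra.extend_def top_star_algebra.fields_def)

lemma carrier_cont_algebra:
  "f \<in> carrier (cont_algebra T) \<longleftrightarrow> f \<in> extensional (topspace T) \<and> continuous_map T euclidean f"
  by (simp add: cont_algebra_def cont_star_algebra_def star_algebra.extend_def top_star_algebra.fields_def)

lemma cont_algebra_eqI:
  "\<lbrakk>f \<in> carrier (cont_algebra T); g \<in> carrier (cont_algebra T); \<And>t. t \<in> topspace T \<Longrightarrow> f t = g t\<rbrakk> \<Longrightarrow> f = g"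
  by (auto simp: carrier_cont_algebra intro: extensionalityI)

lemma restrict_in_cont_algebra [simp]:
  "restrict f (topspace T) \<in> carrier (cont_algebra T) \<longleftrightarrow> continuous_map T euclidean f"
  by (auto simp: carrier_cont_algebra intro: continuous_map_eq)

lemma cont_algebraD: "f \<in> carrier (cont_algebra T) \<Longrightarrow> continuous_map T euclidean f"
  by (simp add: carrier_cont_algebra)

lemma continuous_map_complex_mult:
  fixes f g :: "'b \<Rightarrow> complex"
  shows "\<lbrakk>continuous_map T euclidean f; continuous_map T euclidean g\<rbrakk> \<Longrightarrow> continuous_map T euclidean (\<lambda>t. f t * g t)"
  by (simp add: continuous_map_atin tendsto_mult)

lemma continuous_map_cnj: "continuous_map T euclidean f \<Longrightarrow> continuous_map T euclidean (\<lambda>t. cnj (f t))"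
  by (simp add: continuous_map_atin tendsto_cnj)

lemma continuous_map_Re: "continuous_map T euclidean f \<Longrightarrow> continuous_map T euclidean (\<lambda>t. Re (f t))"
  by (simp add: continuous_map_atin tendsto_Re)

lemma continuous_map_Im: "continuous_map T euclidean f \<Longrightarrow> continuous_map T euclidean (\<lambda>t. Im (f t))"
  by (simp add: continuous_map_atin tendsto_Im)

lemma continuous_map_complex_of_real:
  "continuous_map T euclidean f \<Longrightarrow> continuous_map T euclidean (\<lambda>t. complex_of_real (f t))"
  by (simp add: continuous_map_atin tendsto_of_real)

lemma continuous_map_sqrt:
  "continuous_map T euclidean f \<Longrightarrow> continuous_map T euclidean (\<lambda>t. sqrt (f t))"
  by (simp add: continuous_map_atin tendsto_real_sqrt)

lemmas cont_intros = continuous_map_complex_mult continuous_map_cnj continuous_map_Re continuous_map_Im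
  continuous_map_complex_of_real continuous_map_sqrt continuous_map_add continuous_map_diff continuous_map_norm
  cont_algebraD

lemma involutive_algebra_cont_algebra: "involutive_algebra (cont_algebra T)"
proof (rule involutive_algebraI, goal_cases)
  \<comment> \<open>The sixth premise asks for an additive inverse, which needs an explicit
    witness.\<close>
  case (6 x)
  have "(\<lambda>t \<in> topspace T. - x t) \<in> carrier (cont_algebra T)"
    using 6 by (simp add: cont_algebraD)
  moreover have "(\<lambda>t \<in> topspace T. - x t) \<oplus>\<^bsub>cont_algebra T\<^esub> x = \<zero>\<^bsub>cont_algebra T\<^esub>"
    by (auto simp: cont_algebra_simps)
  ultimately show ?case by blast
qed (simp_all add: cont_algebra_simps cont_intros,
     (auto simp: fun_eq_iff algebra_simps carrier_cont_algebra extensional_def)+)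

lemma minus_cont_algebra:
  assumes "f \<in> carrier (cont_algebra T)" "g \<in> carrier (cont_algebra T)"
  shows "f \<ominus>\<^bsub>cont_algebra T\<^esub> g = (\<lambda>t \<in> topspace T. f t - g t)"
proof -
  interpret involutive_algebra "cont_algebra T" by (rule involutive_algebra_cont_algebra)
  show ?thesis
    using assms by (simp add: minus_eq_sm cont_algebra_simps restrict_def fun_eq_iff)
qed

text \<open>Continuous functions are bounded on compact sets, so the \<open>Sup\<close> in
  \<open>sup_seminorm\<close> is a true supremum.\<close>

lemma
  assumes "compactin T K" "f \<in> carrier (cont_algebra T)"
  shows le_sup_seminorm: "t \<in> K \<Longrightarrow> cmod (f t) \<le> sup_seminorm K f"
    and sup_seminorm_le_iff: "sup_seminorm K f \<le> M \<longleftrightarrow> 0 \<le> M \<and> (\<forall>t \<in> K. cmod (f t) \<le> M)"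
proof -
  have "compactin euclidean ((\<lambda>t. cmod (f t)) ` K)"
    by (rule image_compactin[OF assms(1) continuous_map_norm[OF cont_algebraD[OF assms(2)]]])
  then have bdd: "bdd_above (insert 0 ((\<lambda>t. cmod (f t)) ` K))"
    by (simp add: bounded_imp_bdd_above compact_imp_bounded)
  then show "t \<in> K \<Longrightarrow> cmod (f t) \<le> sup_seminorm K f"
    unfolding sup_seminorm_def by (auto intro: cSup_upper)
  show "sup_seminorm K f \<le> M \<longleftrightarrow> 0 \<le> M \<and> (\<forall>t \<in> K. cmod (f t) \<le> M)"
    unfolding sup_seminorm_def by (subst cSup_le_iff[OF _ bdd]) auto
qed

lemma sup_seminorm_nonneg: "\<lbrakk>compactin T K; f \<in> carrier (cont_algebra T)\<rbrakk> \<Longrightarrow> 0 \<le> sup_seminorm K f"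
  using sup_seminorm_le_iff[of T K f "sup_seminorm K f"] by simp

lemma Cstar_seminorm_sup_seminorm:
  assumes K: "compactin T K"
  shows "Cstar_seminorm (cont_algebra T) (sup_seminorm K)"
  unfolding Cstar_seminorm_def
proof (intro conjI ballI allI)
  interpret involutive_algebra "cont_algebra T" by (rule involutive_algebra_cont_algebra)
  have KT: "\<And>t. t \<in> K \<Longrightarrow> t \<in> topspace T" using compactin_subset_topspace[OF K] by blast
  note le = le_sup_seminorm[OF K] and iff = sup_seminorm_le_iff[OF K] and nonneg = sup_seminorm_nonneg[OF K]
  fix f g assume f: "f \<in> carrier (cont_algebra T)" and g: "g \<in> carrier (cont_algebra T)"
  have "cmod (f t + g t) \<le> sup_seminorm K f + sup_seminorm K g" if "t \<in> K" for t
    using norm_triangle_ineq[of "f t" "g t"] le[OF f that] le[OF g that] by linarith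
  then show "sup_seminorm K (f \<oplus>\<^bsub>cont_algebra T\<^esub> g) \<le> sup_seminorm K f + sup_seminorm K g"
    using f g nonneg KT by (subst iff) (auto simp: cont_algebra_simps(4) cont_intros)
next
  interpret involutive_algebra "cont_algebra T" by (rule involutive_algebra_cont_algebra)
  have KT: "\<And>t. t \<in> K \<Longrightarrow> t \<in> topspace T" using compactin_subset_topspace[OF K] by blast
  note le = le_sup_seminorm[OF K] and iff = sup_seminorm_le_iff[OF K] and nonneg = sup_seminorm_nonneg[OF K]
  fix c f assume f: "f \<in> carrier (cont_algebra T)"
  let ?g = "c \<odot>\<^bsub>cont_algebra T\<^esub> f"
  have g: "?g \<in> carrier (cont_algebra T)" using f by simp
  have gt: "cmod (?g t) = cmod c * cmod (f t)" if "t \<in> K" for t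
    using KT[OF that] by (simp add: cont_algebra_simps norm_mult)
  show "sup_seminorm K ?g = cmod c * sup_seminorm K f"
  proof (rule antisym)
    show "sup_seminorm K ?g \<le> cmod c * sup_seminorm K f"
      using le[OF f] nonneg[OF f] by (subst iff[OF g]) (auto simp: gt mult_left_mono)
    show "cmod c * sup_seminorm K f \<le> sup_seminorm K ?g"
    proof (cases "c = 0")
      case False
      have "sup_seminorm K f \<le> sup_seminorm K ?g / cmod c"
        using le[OF g] nonneg[OF g] False by (subst iff[OF f]) (auto simp: gt field_simps)
      then show ?thesis using False by (simp add: field_simps)
    qed (use nonneg[OF g] in simp)
  qed
next
  interpret involutive_algebra "cont_algebra T" by (rule involutive_algebra_cont_algebra)
  have KT: "\<And>t. t \<in> K \<Longrightarrow> t \<in> topspace T" using compactin_subset_topspace[OF K] by blast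
  note le = le_sup_seminorm[OF K] and iff = sup_seminorm_le_iff[OF K] and nonneg = sup_seminorm_nonneg[OF K]
  fix f assume f: "f \<in> carrier (cont_algebra T)"
  let ?g = "f \<otimes>\<^bsub>cont_algebra T\<^esub> star (cont_algebra T) f"
  have g: "?g \<in> carrier (cont_algebra T)" using f by simp
  have gt: "cmod (?g t) = (cmod (f t))\<^sup>2" if "t \<in> K" for t
    using KT[OF that] by (simp add: cont_algebra_simps norm_mult power2_eq_square)
  show "sup_seminorm K ?g = (sup_seminorm K f)\<^sup>2"
  proof (rule antisym)
    show "sup_seminorm K ?g \<le> (sup_seminorm K f)\<^sup>2"
      using le[OF f] by (subst iff[OF g]) (auto simp: gt power_mono)
    have "sup_seminorm K f \<le> sqrt (sup_seminorm K ?g)"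
      using le[OF g] nonneg[OF g] by (subst iff[OF f]) (auto simp: gt real_le_rsqrt)
    then show "(sup_seminorm K f)\<^sup>2 \<le> sup_seminorm K ?g"
      using nonneg[OF f] nonneg[OF g] by (metis power_mono real_sqrt_pow2)
  qed
qed

abbreviation compact_seminorms :: "'b topology \<Rightarrow> (('b \<Rightarrow> complex) \<Rightarrow> real) set" where
  "compact_seminorms T \<equiv> sup_seminorm ` {K. compactin T K}"

lemma Cstar_topological_algebra_cont_algebra:
  "Cstar_topological_algebra (cont_algebra T) (compact_seminorms T)"
proof -
  interpret involutive_algebra "cont_algebra T" by (rule involutive_algebra_cont_algebra)
  show ?thesis
  proof unfold_locales
    show "Cstar_seminorm (cont_algebra T) p" if "p \<in> compact_seminorms T" for p
      using that Cstar_seminorm_sup_seminorm by blast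
    \<comment> \<open>The topology was defined from the record without a topology field; carrier and
      subtraction agree in both records.\<close>
    have "topo (cont_algebra T) = seminorm_topology (cont_star_algebra T) (compact_seminorms T)"
      by (simp add: cont_algebra_def star_algebra.extend_def top_star_algebra.fields_def)
    also have "\<dots> = seminorm_topology (cont_algebra T) (compact_seminorms T)"
      by (simp add: seminorm_topology_def a_minus_def a_inv_def m_inv_def cont_algebra_def star_algebra.extend_def
          top_star_algebra.fields_def cont_star_algebra_def)
    finally show "topo (cont_algebra T) = seminorm_topology (cont_algebra T) (compact_seminorms T)" .
  qed
qed

text \<open>A finite union of compact sets is compact, so the family of seminorms is
  directed.\<close>

lemma pmax_compact_seminorms:
  assumes F: "finite F" "F \<subseteq> compact_seminorms T"
  shows "\<exists>K. compactin T K \<and> (\<forall>f \<in> carrier (cont_algebra T). pmax F f \<le> sup_seminorm K f)"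
proof -
  obtain \<K> where \<K>: "finite \<K>" "\<K> \<subseteq> {K. compactin T K}" "F = sup_seminorm ` \<K>"
    using finite_subset_image[OF F] by blast
  have K: "compactin T (\<Union>\<K>)" using \<K> by (intro compactin_Union) auto
  have "pmax F f \<le> sup_seminorm (\<Union>\<K>) f" if f: "f \<in> carrier (cont_algebra T)" for f
  proof -
    have "sup_seminorm L f \<le> sup_seminorm (\<Union>\<K>) f" if "L \<in> \<K>" for L
      using that \<K>(2) le_sup_seminorm[OF K f] sup_seminorm_nonneg[OF K f]
      by (subst sup_seminorm_le_iff[OF _ f]) auto
    then show ?thesis
      using \<K>(3) sup_seminorm_nonneg[OF K f] F(1) by (auto simp: pmax_le_iff)
  qed
  with K show ?thesis by blast
qed

section \<open>Point evaluations on realcompact spaces\<close>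

definition point_eval :: "'b topology \<Rightarrow> 'b \<Rightarrow> ('b \<Rightarrow> complex) \<Rightarrow> complex" where
  "point_eval T t = (\<lambda>f \<in> carrier (cont_algebra T). f t)"

lemma point_eval_star_character: "t \<in> topspace T \<Longrightarrow> point_eval T t \<in> star_characters (cont_algebra T)"
proof -
  interpret involutive_algebra "cont_algebra T" by (rule involutive_algebra_cont_algebra)
  show "t \<in> topspace T \<Longrightarrow> ?thesis"
    unfolding star_characters_def point_eval_def by (simp, simp add: cont_algebra_simps)
qed

lemma point_eval_Kstar_hom:
  assumes t: "t \<in> topspace T"
  shows "point_eval T t \<in> Kstar_hom (cont_algebra T) complex_Kstar"
proof -
  interpret Cstar_topological_algebra "cont_algebra T" "compact_seminorms T"
    by (rule Cstar_topological_algebra_cont_algebra)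
  have K: "compactin T {t}" using t by simp
  have "continuous_map (topo (cont_algebra T)) euclidean (point_eval T t)"
    using K le_sup_seminorm[OF K]
    by (intro continuous_character[OF point_eval_star_character[OF t], of "{sup_seminorm {t}}"])
      (auto simp: point_eval_def intro: order_trans[OF _ le_pmax])
  then show ?thesis
    by (simp add: Kstar_hom_complex_Kstar point_eval_star_character t)
qed

text \<open>Realcompactness speaks of real functions. These are fixed by \<open>star\<close>, so
  \<open>u\<close> is real on them and restricts to a real character; the point found for it
  represents \<open>u\<close> on all functions through real and imaginary parts.\<close>

lemma realcompact_star_character:
  assumes T: "realcompact_space T" and u: "u \<in> star_characters (cont_algebra T)"
  obtains t where "t \<in> topspace T" "u = point_eval T t"
proof -
  interpret involutive_algebra "cont_algebra T" by (rule involutive_algebra_cont_algebra)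
  note u_simps = star_charactersD(2-6)[OF u]
  define c where "c g = (\<lambda>t \<in> topspace T. complex_of_real (g t))" for g :: "_ \<Rightarrow> real"
  define h where "h g = Re (u (c g))" for g
  have c: "c g \<in> carrier (cont_algebra T)" if "continuous_map T euclidean g" for g
    using that by (simp add: c_def cont_intros)
  have "star (cont_algebra T) (c g) = c g" for g by (auto simp: c_def cont_algebra_simps)
  then have uc: "u (c g) = of_real (h g)" if "continuous_map T euclidean g" for g
    using u_simps(5)[OF c[OF that]] by (simp add: h_def complex_eq_iff)
  have cont: "continuous_map T euclidean f" if "f \<in> real_continuous_functions T" for f
    using that by (simp add: real_continuous_functions_def)
  have "real_character T h"
    unfolding real_character_def
  proof (intro conjI ballI allI)
    fix f g assume f: "f \<in> real_continuous_functions T" and g: "g \<in> real_continuous_functions T"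
    have "c (\<lambda>t\<in>topspace T. f t + g t) = c f \<oplus>\<^bsub>cont_algebra T\<^esub> c g"
      "c (\<lambda>t\<in>topspace T. f t * g t) = c f \<otimes>\<^bsub>cont_algebra T\<^esub> c g"
      by (auto simp: c_def cont_algebra_simps)
    then show "h (\<lambda>t\<in>topspace T. f t + g t) = h f + h g" "h (\<lambda>t\<in>topspace T. f t * g t) = h f * h g"
      using f g by (simp_all add: h_def u_simps c cont) (simp_all add: uc cont)
  next
    fix d f assume f: "f \<in> real_continuous_functions T"
    have "c (\<lambda>t\<in>topspace T. d * f t) = complex_of_real d \<odot>\<^bsub>cont_algebra T\<^esub> c f"
      by (auto simp: c_def cont_algebra_simps)
    then show "h (\<lambda>t\<in>topspace T. d * f t) = d * h f"
      using f by (simp add: h_def u_simps c cont)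
  next
    have "c (\<lambda>t\<in>topspace T. 1) = \<one>\<^bsub>cont_algebra T\<^esub>" by (auto simp: c_def cont_algebra_simps)
    then show "h (\<lambda>t\<in>topspace T. 1) = 1" by (simp add: h_def u_simps)
  qed
  then obtain t where t: "t \<in> topspace T" "\<And>f. f \<in> real_continuous_functions T \<Longrightarrow> h f = f t"
    using T unfolding realcompact_space_def by blast
  have "u f = f t" if f: "f \<in> carrier (cont_algebra T)" for f
  proof -
    let ?re = "\<lambda>t \<in> topspace T. Re (f t)" and ?im = "\<lambda>t \<in> topspace T. Im (f t)"
    have re: "?re \<in> real_continuous_functions T" and im: "?im \<in> real_continuous_functions T"
      using cont_algebraD[OF f]
      by (auto simp: real_continuous_functions_def intro: continuous_map_eq[OF continuous_map_Re] continuous_map_eq[OF continuous_map_Im])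
    have "f = c ?re \<oplus>\<^bsub>cont_algebra T\<^esub> \<i> \<odot>\<^bsub>cont_algebra T\<^esub> c ?im"
    proof (rule cont_algebra_eqI[OF f])
      show "c ?re \<oplus>\<^bsub>cont_algebra T\<^esub> \<i> \<odot>\<^bsub>cont_algebra T\<^esub> c ?im \<in> carrier (cont_algebra T)"
        by (intro add.m_closed sm_closed c cont re im)
    qed (simp add: c_def cont_algebra_simps complex_eq)
    then have "u f = u (c ?re \<oplus>\<^bsub>cont_algebra T\<^esub> \<i> \<odot>\<^bsub>cont_algebra T\<^esub> c ?im)"
      by (rule arg_cong)
    also have "\<dots> = u (c ?re) + \<i> * u (c ?im)"
      by (simp only: u_simps c[OF cont[OF re]] c[OF cont[OF im]] sm_closed)
    also have "\<dots> = f t"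
      using t(1) by (simp only: uc[OF cont[OF re]] uc[OF cont[OF im]] t(2)[OF re] t(2)[OF im] restrict_apply' flip: complex_eq)
    finally show ?thesis .
  qed
  then have "u = point_eval T t"
    using star_charactersD(1)[OF u] by (intro extensionalityI[of _ "carrier (cont_algebra T)"]) (auto simp: point_eval_def)
  with t that show ?thesis by blast
qed

text \<open>Realcompactness gives surjectivity; complete regularity supplies the functions that
  separate points and make the map open.\<close>

theorem homeomorphic_map_point_eval:
  assumes T: "realcompact_space T"
  shows "homeomorphic_map T (spectrum (cont_algebra T)) (point_eval T)"
proof (rule bijective_open_imp_homeomorphic_map)
  have Ty: "completely_regular_space T" "Hausdorff_space T"
    using T by (auto simp: realcompact_space_def Tychonoff_space_def)
  show "continuous_map T (spectrum (cont_algebra T)) (point_eval T)"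
    by (rule continuous_map_into_spectrum[OF point_eval_Kstar_hom]) (simp_all add: point_eval_def cont_algebraD)
  show "point_eval T ` topspace T = topspace (spectrum (cont_algebra T))"
  proof
    show "point_eval T ` topspace T \<subseteq> topspace (spectrum (cont_algebra T))"
      using point_eval_Kstar_hom by (auto simp: topspace_spectrum)
    show "topspace (spectrum (cont_algebra T)) \<subseteq> point_eval T ` topspace T"
      by (auto simp: topspace_spectrum Kstar_hom_complex_Kstar elim!: realcompact_star_character[OF T])
  qed
  have bump: "\<exists>f \<in> carrier (cont_algebra T). f t = 0 \<and> (\<forall>s \<in> topspace T - U. f s = 1)"
    if U: "openin T U" "t \<in> U" for U t
  proof -
    have "closedin T (topspace T - U) \<and> t \<in> topspace T - (topspace T - U)"
      using U openin_subset[of T U] by auto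
    then obtain g :: "_ \<Rightarrow> real" where g: "continuous_map T (top_of_set {0..1}) g" "g t = 0" "g ` (topspace T - U) \<subseteq> {1}"
      using Ty(1) unfolding completely_regular_space_def by metis
    let ?f = "\<lambda>t \<in> topspace T. complex_of_real (g t)"
    have "?f \<in> carrier (cont_algebra T)"
      using g(1) by (simp add: continuous_map_in_subtopology cont_intros)
    moreover have "?f t = 0" "\<forall>s \<in> topspace T - U. ?f s = 1" using g U openin_subset[of T U] by auto
    ultimately show ?thesis by blast
  qed
  show "inj_on (point_eval T) (topspace T)"
  proof (rule inj_onI, rule ccontr)
    fix s t assume st: "s \<in> topspace T" "t \<in> topspace T" "point_eval T s = point_eval T t" "s \<noteq> t"
    obtain U where U: "openin T U" "t \<in> U" "s \<notin> U"
      using Ty(2) st unfolding Hausdorff_space_def disjnt_iff by metis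
    obtain f where "f \<in> carrier (cont_algebra T)" "f t = 0" "f s = 1"
      using bump[OF U(1,2)] U(3) st(1) by blast
    then show False using fun_cong[OF st(3), of f] by (simp add: point_eval_def)
  qed
  show "open_map T (spectrum (cont_algebra T)) (point_eval T)"
    unfolding open_map_def
  proof (intro allI impI)
    fix U assume U: "openin T U"
    show "openin (spectrum (cont_algebra T)) (point_eval T ` U)"
    proof (subst openin_subopen, intro ballI)
      fix u assume "u \<in> point_eval T ` U"
      then obtain t where t: "t \<in> U" "u = point_eval T t" by blast
      obtain f where f: "f \<in> carrier (cont_algebra T)" "f t = 0" "\<forall>s \<in> topspace T - U. f s = 1"
        using bump[OF U t(1)] by blast
      \<comment> \<open>\<open>f\<close> equals 1 off \<open>U\<close>, so a point evaluation
        \<open>v\<close> with \<open>cmod (v f) < 1\<close> comes from a point of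
        \<open>U\<close>.\<close>
      let ?V = "{v \<in> topspace (spectrum (cont_algebra T)). v f \<in> ball 0 1}"
      have "openin (spectrum (cont_algebra T)) ?V"
        by (rule openin_continuous_map_preimage[OF continuous_map_spectrum_eval[OF f(1)]]) simp
      moreover have "u \<in> ?V"
        using t f U openin_subset[OF U] point_eval_Kstar_hom[of t T] by (auto simp: topspace_spectrum point_eval_def)
      moreover have "?V \<subseteq> point_eval T ` U"
      proof
        fix v assume v: "v \<in> ?V"
        then obtain s where s: "s \<in> topspace T" "v = point_eval T s"
          by (auto simp: topspace_spectrum Kstar_hom_complex_Kstar elim!: realcompact_star_character[OF T])
        then show "v \<in> point_eval T ` U" using v f by (force simp: point_eval_def)
      qed
      ultimately show "\<exists>V. openin (spectrum (cont_algebra T)) V \<and> u \<in> V \<and> V \<subseteq> point_eval T ` U" by blast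
    qed
  qed
qed

text \<open>The characters dominated by \<open>r\<close> form a compact set, each is evaluation at a
  point of \<open>T\<close>, and the homeomorphism \<open>point_eval\<close> carries compactness
  back.\<close>

lemma compactin_realcompact:
  assumes T: "realcompact_space T"
  shows "compactin T {t \<in> topspace T. \<forall>f \<in> carrier (cont_algebra T). cmod (f t) \<le> r f}"
proof -
  have "compactin (spectrum (cont_algebra T))
      {u \<in> star_characters (cont_algebra T). \<forall>f \<in> carrier (cont_algebra T). cmod (u f) \<le> r f}"
    using point_eval_Kstar_hom[of _ T]
    by (intro compactin_spectrum involutive_algebra_cont_algebra)
      (auto simp: Kstar_hom_complex_Kstar elim!: realcompact_star_character[OF T])
  also have "{u \<in> star_characters (cont_algebra T). \<forall>f \<in> carrier (cont_algebra T). cmod (u f) \<le> r f}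
      = point_eval T ` {t \<in> topspace T. \<forall>f \<in> carrier (cont_algebra T). cmod (f t) \<le> r f}"
    using point_eval_star_character by (auto elim!: realcompact_star_character[OF T] simp: point_eval_def)
  finally show ?thesis
    using homeomorphic_map_compactness[OF homeomorphic_map_point_eval[OF T], of "{t \<in> topspace T. \<forall>f \<in> carrier (cont_algebra T). cmod (f t) \<le> r f}"]
    by auto
qed

section \<open>Completeness for k_C-spaces\<close>

text \<open>A Cauchy filter converges to its pointwise limit uniformly on compact sets, so the limit
  is continuous on each of them, and the k_C-condition makes it continuous.\<close>

lemma complete_cont_algebra:
  assumes T: "kC_space T"
  shows "complete_algebra (cont_algebra T)"
  unfolding complete_algebra_def
proof (intro allI impI)
  interpret Cstar_topological_algebra "cont_algebra T" "compact_seminorms T"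
    by (rule Cstar_topological_algebra_cont_algebra)
  fix \<F> assume F: "Cauchy_filter (cont_algebra T) \<F>"
  then have bot: "\<F> \<noteq> bot" by (simp add: Cauchy_filter_def)
  have small: "\<exists>S \<subseteq> carrier (cont_algebra T). (\<forall>\<^sub>F f in \<F>. f \<in> S) \<and> (\<forall>f \<in> S. \<forall>g \<in> S. \<forall>t \<in> K. dist (f t) (g t) < e)"
    if K: "compactin T K" and e: "e > 0" for K e
  proof -
    obtain S where S: "S \<subseteq> carrier (cont_algebra T)" "\<forall>\<^sub>F f in \<F>. f \<in> S"
      "\<forall>f \<in> S. \<forall>g \<in> S. pmax {sup_seminorm K} (f \<ominus>\<^bsub>cont_algebra T\<^esub> g) < e"
      using F[unfolded Cauchy_filter_iff, THEN conjunct2, rule_format, of "{sup_seminorm K}" e] K e by blast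
    have "dist (f t) (g t) < e" if "f \<in> S" "g \<in> S" "t \<in> K" for f g t
    proof -
      have car: "f \<in> carrier (cont_algebra T)" "g \<in> carrier (cont_algebra T)" using S that by auto
      have "cmod ((f \<ominus>\<^bsub>cont_algebra T\<^esub> g) t) \<le> sup_seminorm K (f \<ominus>\<^bsub>cont_algebra T\<^esub> g)"
        by (rule le_sup_seminorm[OF K minus_closed[OF car] that(3)])
      also have "\<dots> < e" using S(3) that by (simp add: pmax_less_iff)
      finally show ?thesis
        using car that(3) compactin_subset_topspace[OF K] by (auto simp: minus_cont_algebra dist_norm)
    qed
    with S show ?thesis by blast
  qed
  have "\<exists>l. ((\<lambda>f. f t) \<longlongrightarrow> l) \<F>" if t: "t \<in> topspace T" for t
  proof -
    have "cauchy_filter (filtermap (\<lambda>f. f t) \<F>)"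
      unfolding cauchy_filter_metric_filtermap
    proof (intro allI impI)
      fix e :: real assume "e > 0"
      with small[of "{t}" e] t show "\<exists>P. eventually P \<F> \<and> (\<forall>f g. P f \<and> P g \<longrightarrow> dist (f t) (g t) < e)"
        by (auto intro: exI[of _ "\<lambda>f. f \<in> S" for S])
    qed
    then have "\<exists>l. filtermap (\<lambda>f. f t) \<F> \<le> nhds l"
      using bot by (intro cauchy_filter_complete_converges[of _ UNIV]) (simp_all add: filtermap_bot_iff complete_UNIV)
    then show ?thesis by (simp add: filterlim_def)
  qed
  then obtain l0 where l0: "\<And>t. t \<in> topspace T \<Longrightarrow> ((\<lambda>f. f t) \<longlongrightarrow> l0 t) \<F>" by metis
  have unif: "\<forall>\<^sub>F f in \<F>. f \<in> carrier (cont_algebra T) \<and> (\<forall>t \<in> K. dist (f t) (l0 t) \<le> e)"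
    if K: "compactin T K" and e: "e > 0" for K e
  proof -
    obtain S where S: "S \<subseteq> carrier (cont_algebra T)" "\<forall>\<^sub>F f in \<F>. f \<in> S"
      "\<forall>f \<in> S. \<forall>g \<in> S. \<forall>t \<in> K. dist (f t) (g t) < e"
      using small[OF K e] by blast
    \<comment> \<open>Letting \<open>g\<close> run to its limit weakens the strict bound to
      \<open>\<le>\<close>.\<close>
    have "dist (f t) (l0 t) \<le> e" if "f \<in> S" "t \<in> K" for f t
    proof (rule tendsto_upperbound[OF _ _ bot])
      show "((\<lambda>g. dist (f t) (g t)) \<longlongrightarrow> dist (f t) (l0 t)) \<F>"
        using that compactin_subset_topspace[OF K] by (intro tendsto_intros l0) auto
      show "\<forall>\<^sub>F g in \<F>. dist (f t) (g t) \<le> e"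
        using S(2) by (rule eventually_mono) (use S(3) that in \<open>auto intro: less_imp_le\<close>)
    qed
    then show ?thesis using S by (auto elim: eventually_mono)
  qed
  have "continuous_map (subtopology T K) euclidean l0" if K: "compactin T K" for K
    unfolding mtopology_is_euclidean[symmetric]
  proof (rule Met_TC.continuous_map_uniform_limit[OF _ _ bot, where f = "\<lambda>f. f"])
    show "\<forall>\<^sub>F f in \<F>. continuous_map (subtopology T K) Met_TC.mtopology f"
      using unif[OF K, of 1] by (auto elim!: eventually_mono intro!: continuous_map_from_subtopology dest: cont_algebraD)
    fix e :: real assume e: "0 < e"
    show "\<forall>\<^sub>F f in \<F>. \<forall>t \<in> topspace (subtopology T K). l0 t \<in> UNIV \<and> dist (f t) (l0 t) < e"
      using unif[OF K, of "e / 2"] e by (auto elim!: eventually_mono)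
  qed
  then have "continuous_map T euclidean l0" using T by (simp add: kC_space_def)
  then have l: "restrict l0 (topspace T) \<in> carrier (cont_algebra T)" (is "?l \<in> _") by simp
  have "limitin (topo (cont_algebra T)) (\<lambda>f. f) ?l \<F>"
    unfolding limitin_topo
  proof (intro conjI l allI impI)
    fix F e assume F: "finite F" "F \<subseteq> compact_seminorms T" and e: "(e::real) > 0"
    obtain K where K: "compactin T K" "\<And>f. f \<in> carrier (cont_algebra T) \<Longrightarrow> pmax F f \<le> sup_seminorm K f"
      using pmax_compact_seminorms[OF F] by blast
    have "e / 2 > 0" using e by simp
    from unif[OF K(1) this]
    show "\<forall>\<^sub>F f in \<F>. f \<in> carrier (cont_algebra T) \<and> pmax F (f \<ominus>\<^bsub>cont_algebra T\<^esub> ?l) < e"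
    proof (rule eventually_mono)
      fix f assume f: "f \<in> carrier (cont_algebra T) \<and> (\<forall>t \<in> K. dist (f t) (l0 t) \<le> e / 2)"
      then have "sup_seminorm K (f \<ominus>\<^bsub>cont_algebra T\<^esub> ?l) \<le> e / 2"
        using l e compactin_subset_topspace[OF K(1)]
        by (subst sup_seminorm_le_iff[OF K(1) minus_closed[OF _ l]]) (auto simp: minus_cont_algebra dist_norm)
      then show "f \<in> carrier (cont_algebra T) \<and> pmax F (f \<ominus>\<^bsub>cont_algebra T\<^esub> ?l) < e"
        using K(2)[of "f \<ominus>\<^bsub>cont_algebra T\<^esub> ?l"] f l e by auto
    qed
  qed
  then show "\<exists>l. limitin (topo (cont_algebra T)) (\<lambda>f. f) l \<F>" by blast
qed

text \<open>The Hausdorff property holds because single points are compact.\<close>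

theorem Kstar_algebra_cont_algebra:
  assumes T: "kC_space T"
  shows "Kstar_algebra (cont_algebra T)"
proof -
  interpret Cstar_topological_algebra "cont_algebra T" "compact_seminorms T"
    by (rule Cstar_topological_algebra_cont_algebra)
  have "Hausdorff_space (topo (cont_algebra T))"
    unfolding Hausdorff_iff
  proof (intro ballI impI)
    fix f assume f: "f \<in> carrier (cont_algebra T)" and 0: "\<forall>p \<in> compact_seminorms T. p f = 0"
    have "f t = 0" if t: "t \<in> topspace T" for t
      using 0 le_sup_seminorm[of T "{t}" f t] f t by simp
    then show "f = \<zero>\<^bsub>cont_algebra T\<^esub>"
      using f by (intro cont_algebra_eqI[OF f]) (auto simp: cont_algebra_simps)
  qed
  then show ?thesis
    unfolding Kstar_algebra_def
    using involutive_algebra_axioms complete_cont_algebra[OF T] Cstar_seminorms topo_eq by blast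
qed

section \<open>Bornivorous sets and their essential supremum\<close>

locale bornivorous_set =
  fixes T :: "'b topology" and V :: "('b \<Rightarrow> complex) set"
  assumes convex: "absolutely_convex (cont_algebra T) V"
    and bornivorous: "\<And>B. bounded_subset (cont_algebra T) B \<Longrightarrow> absorbs (cont_algebra T) V B"
begin

sublocale Cstar_topological_algebra "cont_algebra T" "compact_seminorms T"
  by (rule Cstar_topological_algebra_cont_algebra)

lemma V_carrier: "f \<in> V \<Longrightarrow> f \<in> carrier (cont_algebra T)"
  using convex by (auto simp: absolutely_convex_def)

lemma V_scale:
  assumes f: "f \<in> V" and c: "cmod c \<le> 1"
  shows "c \<odot>\<^bsub>cont_algebra T\<^esub> f \<in> V"
proof -
  have "c \<odot>\<^bsub>cont_algebra T\<^esub> f \<oplus>\<^bsub>cont_algebra T\<^esub> 0 \<odot>\<^bsub>cont_algebra T\<^esub> f \<in> V"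
    using convex f c unfolding absolutely_convex_def by auto
  then show ?thesis using V_carrier[OF f] by simp
qed

text \<open>The radius \<open>r\<close> is common to all \<open>n\<close>, so a term may be compared
  with a scalar that depends on its own index.\<close>

lemma bounded_sequence:
  assumes f: "\<And>n. f n \<in> carrier (cont_algebra T)"
    and bdd: "\<And>K. compactin T K \<Longrightarrow> \<exists>M. \<forall>n::nat. \<forall>t \<in> K. cmod (f n t) \<le> M"
  shows "\<exists>r>0. \<forall>c n. r \<le> cmod c \<longrightarrow> (\<exists>v \<in> V. f n = c \<odot>\<^bsub>cont_algebra T\<^esub> v)"
proof -
  have "bounded_subset (cont_algebra T) (range f)"
    unfolding bounded_subset_iff
  proof (intro conjI ballI)
    fix p assume "p \<in> compact_seminorms T"
    then obtain K where K: "compactin T K" "p = sup_seminorm K" by blast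
    obtain M where M: "\<And>n t. t \<in> K \<Longrightarrow> cmod (f n t) \<le> M" using bdd[OF K(1)] by blast
    have "p (f n) \<le> max 0 M" for n
      unfolding K(2) sup_seminorm_le_iff[OF K(1) f] using M by (auto intro: max.coboundedI2)
    then show "\<exists>M. \<forall>g \<in> range f. p g \<le> M" by blast
  qed (use f in auto)
  then have "absorbs (cont_algebra T) V (range f)" by (rule bornivorous)
  then show ?thesis unfolding absorbs_def by blast
qed

text \<open>Absolute convexity as defined admits the empty set; absorbing the zero sequence shows
  that \<open>V\<close> has an element.\<close>

lemma zero_in_V: "\<zero>\<^bsub>cont_algebra T\<^esub> \<in> V"
proof -
  have "cmod (\<zero>\<^bsub>cont_algebra T\<^esub> t) \<le> 0" if "compactin T K" "t \<in> K" for K t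
    using that compactin_subset_topspace[of T K] by (auto simp: cont_algebra_simps)
  then obtain r where r: "0 < r" "\<And>c n. r \<le> cmod c \<Longrightarrow> \<exists>v \<in> V. \<zero>\<^bsub>cont_algebra T\<^esub> = c \<odot>\<^bsub>cont_algebra T\<^esub> v"
    using bounded_sequence[of "\<lambda>_. \<zero>\<^bsub>cont_algebra T\<^esub>"] zero_closed by meson
  obtain v where "v \<in> V" using r(2)[of "complex_of_real r"] r(1) by auto
  then show ?thesis using V_scale[of v 0] V_carrier[of v] by simp
qed

text \<open>\<open>M\<close> is an essential bound of \<open>f\<close> if \<open>V\<close> does not see the set where \<open>\<bar>f\<bar> > M\<close>. The infimum of
  the essential bounds is the supremum of \<open>\<bar>f\<bar>\<close> over the support of \<open>V\<close>.\<close>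

definition essential_bound :: "('b \<Rightarrow> complex) \<Rightarrow> real \<Rightarrow> bool" where
  "essential_bound f M \<longleftrightarrow> 0 \<le> M \<and>
     (\<forall>h \<in> carrier (cont_algebra T). (\<forall>t \<in> topspace T. cmod (f t) \<le> M \<longrightarrow> h t = 0) \<longrightarrow> h \<in> V)"

definition essential_sup :: "('b \<Rightarrow> complex) \<Rightarrow> real" where
  "essential_sup f = Inf {M. essential_bound f M}"

text \<open>Otherwise there are \<open>h n\<close> outside \<open>V\<close> vanishing where
  \<open>cmod (f t) \<le> n\<close>. On a compact set \<open>f\<close> is bounded, so all but
  finitely many \<open>h n\<close> vanish there and even their multiples by \<open>n\<close> form a
  bounded sequence. As \<open>V\<close> absorbs it, \<open>h n\<close> lies in \<open>V\<close> as
  soon as \<open>n\<close> reaches the radius.\<close>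

lemma essential_bound_exists:
  assumes f: "f \<in> carrier (cont_algebra T)"
  shows "\<exists>n::nat. essential_bound f n"
proof (rule ccontr)
  assume "\<nexists>n::nat. essential_bound f n"
  then have "\<forall>n::nat. \<exists>h \<in> carrier (cont_algebra T). (\<forall>t \<in> topspace T. cmod (f t) \<le> n \<longrightarrow> h t = 0) \<and> h \<notin> V"
    by (simp add: essential_bound_def)
  then obtain h where h: "\<And>n. h n \<in> carrier (cont_algebra T)" "\<And>n. h n \<notin> V"
    "\<And>n t. \<lbrakk>t \<in> topspace T; cmod (f t) \<le> real n\<rbrakk> \<Longrightarrow> h n t = 0"
    by metis
  define g where "g n = of_nat n \<odot>\<^bsub>cont_algebra T\<^esub> h n" for n
  have g: "g n \<in> carrier (cont_algebra T)" for n by (simp add: g_def h)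
  have "\<exists>r>0. \<forall>c n. r \<le> cmod c \<longrightarrow> (\<exists>v \<in> V. g n = c \<odot>\<^bsub>cont_algebra T\<^esub> v)"
  proof (rule bounded_sequence[OF g])
    fix K assume K: "compactin T K"
    obtain m where m: "sup_seminorm K f \<le> real m" using real_arch_simple by blast
    define M where "M = Max (insert 0 ((\<lambda>n. sup_seminorm K (g n)) ` {..m}))"
    have "cmod (g n t) \<le> M" if t: "t \<in> K" for n t
    proof (cases "n \<le> m")
      case True
      then have "sup_seminorm K (g n) \<le> M" unfolding M_def by (intro Max_ge) auto
      then show ?thesis using le_sup_seminorm[OF K g t] by (meson order_trans)
    next
      case False
      then have "cmod (f t) \<le> n" using le_sup_seminorm[OF K f t] m by simp
      then have "g n t = 0"
        using t compactin_subset_topspace[OF K] h(3) by (auto simp: g_def cont_algebra_simps)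
      then show ?thesis by (simp add: M_def)
    qed
    then show "\<exists>M. \<forall>n. \<forall>t \<in> K. cmod (g n t) \<le> M" by blast
  qed
  then obtain r where r: "0 < r" "\<And>c n. r \<le> cmod c \<Longrightarrow> \<exists>v \<in> V. g n = c \<odot>\<^bsub>cont_algebra T\<^esub> v"
    by blast
  obtain n :: nat where n: "r \<le> real n" using real_arch_simple by blast
  then obtain v where v: "v \<in> V" "g n = of_nat n \<odot>\<^bsub>cont_algebra T\<^esub> v" using r(2)[of "of_nat n" n] by auto
  have n0: "n \<noteq> 0" using n r(1) by auto
  have "h n = inverse (of_nat n) \<odot>\<^bsub>cont_algebra T\<^esub> g n"
    using n0 h by (simp add: g_def sm_sm)
  also have "\<dots> = v" using n0 V_carrier[OF v(1)] by (simp add: v(2) sm_sm)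
  finally show False using v(1) h(2) by blast
qed

lemma essential_bound_mono: "\<lbrakk>essential_bound f M; M \<le> N\<rbrakk> \<Longrightarrow> essential_bound f N"
  unfolding essential_bound_def by (meson order_trans)

lemma essential_sup_le: "essential_bound f M \<Longrightarrow> essential_sup f \<le> M"
  unfolding essential_sup_def by (rule cInf_lower) (auto simp: essential_bound_def intro: bdd_belowI[of _ 0])

lemma essential_sup_ge:
  assumes "f \<in> carrier (cont_algebra T)" "\<And>M. essential_bound f M \<Longrightarrow> N \<le> M"
  shows "N \<le> essential_sup f"
  unfolding essential_sup_def using essential_bound_exists[OF assms(1)] assms(2) by (intro cInf_greatest) auto

lemma essential_sup_less:
  assumes "f \<in> carrier (cont_algebra T)" "essential_sup f < N"
  shows "essential_bound f N"
  using essential_sup_ge[of f N] assms essential_bound_mono by (meson le_less_linear less_imp_le not_le)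

lemma essential_sup_nonneg: "f \<in> carrier (cont_algebra T) \<Longrightarrow> 0 \<le> essential_sup f"
  by (rule essential_sup_ge) (auto simp: essential_bound_def)

text \<open>\<open>V\<close> is convex but need not be closed under sums. Doubling is harmless for
  functions that belong to \<open>V\<close> because of where they vanish.\<close>

lemma halves_in_V:
  assumes "f \<in> carrier (cont_algebra T)" "g \<in> carrier (cont_algebra T)"
    and "2 \<odot>\<^bsub>cont_algebra T\<^esub> f \<in> V" "2 \<odot>\<^bsub>cont_algebra T\<^esub> g \<in> V"
  shows "f \<oplus>\<^bsub>cont_algebra T\<^esub> g \<in> V"
proof -
  have "(1 / 2) \<odot>\<^bsub>cont_algebra T\<^esub> (2 \<odot>\<^bsub>cont_algebra T\<^esub> f) \<oplus>\<^bsub>cont_algebra T\<^esub> (1 / 2) \<odot>\<^bsub>cont_algebra T\<^esub> (2 \<odot>\<^bsub>cont_algebra T\<^esub> g) \<in> V"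
    using convex assms(3,4) unfolding absolutely_convex_def by (simp add: norm_divide)
  then show ?thesis using assms by (simp add: sm_sm)
qed

text \<open>Where \<open>h\<close> is nonzero, the excess \<open>u\<close> of
  \<open>cmod (f t)\<close> over \<open>M\<close> and the excess \<open>v\<close> of
  \<open>cmod (g t)\<close> over \<open>N\<close> add up to more than \<open>e\<close>. Their
  proportions split \<open>h\<close> into a part vanishing where \<open>cmod (f t) \<le> M\<close>
  and a part vanishing where \<open>cmod (g t) \<le> N\<close>.\<close>

lemma essential_bound_add:
  assumes f: "f \<in> carrier (cont_algebra T)" and g: "g \<in> carrier (cont_algebra T)"
    and M: "essential_bound f M" and N: "essential_bound g N" and e: "0 < e"
  shows "essential_bound (f \<oplus>\<^bsub>cont_algebra T\<^esub> g) (M + N + e)"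
  unfolding essential_bound_def
proof (intro conjI ballI impI)
  show "0 \<le> M + N + e" using M N e by (simp add: essential_bound_def)
  fix h assume h: "h \<in> carrier (cont_algebra T)"
    and h0: "\<forall>t \<in> topspace T. cmod ((f \<oplus>\<^bsub>cont_algebra T\<^esub> g) t) \<le> M + N + e \<longrightarrow> h t = 0"
  \<comment> \<open>The cut-off at \<open>e\<close> keeps the denominator positive and the quotients
    continuous; where \<open>h\<close> is nonzero it is inactive.\<close>
  define u v w where "u t = max 0 (cmod (f t) - M)" and "v t = max 0 (cmod (g t) - N)"
    and "w t = max e (u t + v t)" for t
  have w: "0 < w t" for t using e by (simp add: w_def)
  have cont: "continuous_map T euclidean u" "continuous_map T euclidean v"
    unfolding u_def v_def
    by (intro continuous_map_real_max continuous_map_diff continuous_map_norm continuous_map_const[THEN iffD2]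
        cont_algebraD[OF f] cont_algebraD[OF g]; simp)+
  then have "continuous_map T euclidean w"
    unfolding w_def by (intro continuous_map_real_max continuous_map_add) simp_all
  then have quot: "continuous_map T euclidean (\<lambda>t. h t * complex_of_real (a t / w t))"
    if "continuous_map T euclidean a" for a
    using w that
    by (intro continuous_map_complex_mult continuous_map_complex_of_real continuous_map_real_divide cont_algebraD[OF h])
      (simp_all add: less_imp_neq[THEN not_sym])
  let ?h1 = "\<lambda>t \<in> topspace T. h t * complex_of_real (u t / w t)"
  let ?h2 = "\<lambda>t \<in> topspace T. h t * complex_of_real (v t / w t)"
  have car: "?h1 \<in> carrier (cont_algebra T)" "?h2 \<in> carrier (cont_algebra T)"
    using quot[OF cont(1)] quot[OF cont(2)] by simp_all
  have "h = ?h1 \<oplus>\<^bsub>cont_algebra T\<^esub> ?h2"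
  proof (rule cont_algebra_eqI[OF h])
    fix t assume t: "t \<in> topspace T"
    show "h t = (?h1 \<oplus>\<^bsub>cont_algebra T\<^esub> ?h2) t"
    proof (cases "h t = 0")
      case False
      then have "M + N + e < cmod (f t + g t)" using h0 t by (force simp: cont_algebra_simps)
      then have "e < u t + v t" using norm_triangle_ineq[of "f t" "g t"] by (auto simp: u_def v_def)
      then have "u t / w t + v t / w t = 1" using w[of t] e by (simp add: w_def flip: add_divide_distrib)
      then have "complex_of_real (u t / w t) + complex_of_real (v t / w t) = 1" by (metis of_real_1 of_real_add)
      then show ?thesis using t by (simp add: cont_algebra_simps flip: distrib_left del: of_real_divide)
    qed (use t in \<open>simp add: cont_algebra_simps\<close>)
  qed (use car in simp)
  moreover have "2 \<odot>\<^bsub>cont_algebra T\<^esub> ?h1 \<in> V"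
    using M sm_closed[OF car(1), of 2] unfolding essential_bound_def
    by (auto simp: cont_algebra_simps u_def)
  moreover have "2 \<odot>\<^bsub>cont_algebra T\<^esub> ?h2 \<in> V"
    using N sm_closed[OF car(2), of 2] unfolding essential_bound_def
    by (auto simp: cont_algebra_simps v_def)
  ultimately show "h \<in> V" using halves_in_V[OF car] by simp
qed

lemma essential_bound_scale:
  assumes c: "c \<noteq> 0"
  shows "essential_bound (c \<odot>\<^bsub>cont_algebra T\<^esub> f) (cmod c * M) \<longleftrightarrow> essential_bound f M"
  using c by (simp add: essential_bound_def cont_algebra_simps norm_mult zero_le_mult_iff cong: ball_cong)

lemma essential_bound_square:
  assumes M: "0 \<le> M"
  shows "essential_bound (f \<otimes>\<^bsub>cont_algebra T\<^esub> star (cont_algebra T) f) (M\<^sup>2) \<longleftrightarrow> essential_bound f M"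
  using M by (simp add: essential_bound_def cont_algebra_simps norm_mult power2_eq_square[symmetric] power_mono_iff cong: ball_cong)

lemma essential_bound_zero: "essential_bound \<zero>\<^bsub>cont_algebra T\<^esub> 0"
  unfolding essential_bound_def
proof (intro conjI ballI impI)
  fix h assume "h \<in> carrier (cont_algebra T)" "\<forall>t \<in> topspace T. cmod (\<zero>\<^bsub>cont_algebra T\<^esub> t) \<le> 0 \<longrightarrow> h t = 0"
  then have "h = \<zero>\<^bsub>cont_algebra T\<^esub>"
    by (intro cont_algebra_eqI[of h T]) (auto simp: cont_algebra_simps(3))
  then show "h \<in> V" using zero_in_V by simp
qed simp

lemma Cstar_seminorm_essential_sup: "Cstar_seminorm (cont_algebra T) essential_sup"
  unfolding Cstar_seminorm_def
proof (intro conjI ballI allI)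
  fix f g assume f: "f \<in> carrier (cont_algebra T)" and g: "g \<in> carrier (cont_algebra T)"
  show "essential_sup (f \<oplus>\<^bsub>cont_algebra T\<^esub> g) \<le> essential_sup f + essential_sup g"
  proof (rule field_le_epsilon)
    fix e :: real assume e: "0 < e"
    \<comment> \<open>Two thirds of the slack go into the two approximations, the last one into
      \<open>essential_bound_add\<close>.\<close>
    have "essential_bound f (essential_sup f + e / 3)" "essential_bound g (essential_sup g + e / 3)"
      using f g e by (auto intro!: essential_sup_less)
    then have "essential_bound (f \<oplus>\<^bsub>cont_algebra T\<^esub> g) ((essential_sup f + e / 3) + (essential_sup g + e / 3) + e / 3)"
      using e by (intro essential_bound_add f g) auto
    from essential_sup_le[OF this]
    show "essential_sup (f \<oplus>\<^bsub>cont_algebra T\<^esub> g) \<le> essential_sup f + essential_sup g + e" by simp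
  qed
next
  fix c f assume f: "f \<in> carrier (cont_algebra T)"
  have cf: "c \<odot>\<^bsub>cont_algebra T\<^esub> f \<in> carrier (cont_algebra T)" using f by simp
  show "essential_sup (c \<odot>\<^bsub>cont_algebra T\<^esub> f) = cmod c * essential_sup f"
  proof (cases "c = 0")
    case True
    then show ?thesis
      using f essential_sup_le[OF essential_bound_zero] essential_sup_nonneg[OF zero_closed] by simp
  next
    case False
    show ?thesis
    proof (rule antisym)
      have "essential_sup (c \<odot>\<^bsub>cont_algebra T\<^esub> f) / cmod c \<le> essential_sup f"
        using essential_sup_le[of "c \<odot>\<^bsub>cont_algebra T\<^esub> f"] False
        by (intro essential_sup_ge[OF f]) (metis divide_le_eq essential_bound_scale mult.commute zero_less_norm_iff)
      then show "essential_sup (c \<odot>\<^bsub>cont_algebra T\<^esub> f) \<le> cmod c * essential_sup f"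
        using False by (simp add: divide_le_eq mult.commute)
      show "cmod c * essential_sup f \<le> essential_sup (c \<odot>\<^bsub>cont_algebra T\<^esub> f)"
      proof (rule essential_sup_ge[OF cf])
        fix M assume M: "essential_bound (c \<odot>\<^bsub>cont_algebra T\<^esub> f) M"
        then have "essential_bound f (M / cmod c)"
          using False essential_bound_scale[OF False, of f "M / cmod c"] by simp
        from essential_sup_le[OF this] show "cmod c * essential_sup f \<le> M"
          using False by (simp add: pos_le_divide_eq mult.commute)
      qed
    qed
  qed
next
  fix f assume f: "f \<in> carrier (cont_algebra T)"
  let ?g = "f \<otimes>\<^bsub>cont_algebra T\<^esub> star (cont_algebra T) f"
  have g: "?g \<in> carrier (cont_algebra T)" using f by simp
  show "essential_sup ?g = (essential_sup f)\<^sup>2"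
  proof (rule antisym)
    show "(essential_sup f)\<^sup>2 \<le> essential_sup ?g"
    proof (rule essential_sup_ge[OF g])
      fix M assume M: "essential_bound ?g M"
      then have M0: "0 \<le> M" by (simp add: essential_bound_def)
      have "essential_bound f (sqrt M)"
        using M M0 essential_bound_square[of "sqrt M" f] by simp
      from essential_sup_le[OF this] show "(essential_sup f)\<^sup>2 \<le> M"
        using essential_sup_nonneg[OF f] M0 by (metis power_mono real_sqrt_pow2)
    qed
    have "sqrt (essential_sup ?g) \<le> essential_sup f"
    proof (rule essential_sup_ge[OF f])
      fix M assume M: "essential_bound f M"
      then have M0: "0 \<le> M" by (simp add: essential_bound_def)
      have "essential_bound ?g (M\<^sup>2)" using M M0 by (simp only: essential_bound_square)
      from essential_sup_le[OF this] show "sqrt (essential_sup ?g) \<le> M"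
        using M0 essential_sup_nonneg[OF g] by (simp add: real_le_lsqrt)
    qed
    then show "essential_sup ?g \<le> (essential_sup f)\<^sup>2"
      by (rule sqrt_le_D)
  qed
qed

text \<open>The functions of modulus at most 1 form a bounded set for the compact-open topology, so
  \<open>V\<close> absorbs it.\<close>

lemma uniformly_small_in_V:
  "\<exists>d>0. \<forall>f \<in> carrier (cont_algebra T). (\<forall>t \<in> topspace T. cmod (f t) \<le> d) \<longrightarrow> f \<in> V"
proof -
  let ?B = "{f \<in> carrier (cont_algebra T). \<forall>t \<in> topspace T. cmod (f t) \<le> 1}"
  have "bounded_subset (cont_algebra T) ?B"
    unfolding bounded_subset_iff
  proof (intro conjI ballI)
    fix p assume "p \<in> compact_seminorms T"
    then obtain K where K: "compactin T K" "p = sup_seminorm K" by blast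
    have "\<forall>g \<in> ?B. p g \<le> 1"
      unfolding K(2) using K compactin_subset_topspace[OF K(1)] by (auto simp: sup_seminorm_le_iff[OF K(1)])
    then show "\<exists>M. \<forall>g \<in> ?B. p g \<le> M" by blast
  qed auto
  then obtain r where r: "0 < r" "\<And>c. r \<le> cmod c \<Longrightarrow> ?B \<subseteq> (\<lambda>v. c \<odot>\<^bsub>cont_algebra T\<^esub> v) ` V"
    using bornivorous unfolding absorbs_def by blast
  show ?thesis
  proof (intro exI[of _ "1 / r"] conjI ballI impI)
    show "0 < 1 / r" using r by simp
    fix f assume f: "f \<in> carrier (cont_algebra T)" and small: "\<forall>t \<in> topspace T. cmod (f t) \<le> 1 / r"
    have "complex_of_real r \<odot>\<^bsub>cont_algebra T\<^esub> f \<in> ?B"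
      using f r(1) small sm_closed[OF f, of "complex_of_real r"] by (simp add: cont_algebra_simps norm_mult field_simps)
    then obtain v where v: "v \<in> V" "complex_of_real r \<odot>\<^bsub>cont_algebra T\<^esub> f = complex_of_real r \<odot>\<^bsub>cont_algebra T\<^esub> v"
      using r(2)[of "complex_of_real r"] r(1) by auto
    have "f = complex_of_real (1 / r) \<odot>\<^bsub>cont_algebra T\<^esub> (complex_of_real r \<odot>\<^bsub>cont_algebra T\<^esub> f)"
      using f r(1) by (simp add: sm_sm)
    also have "\<dots> = v" using V_carrier[OF v(1)] r(1) by (simp add: v(2) sm_sm)
    finally show "f \<in> V" using v(1) by simp
  qed
qed

text \<open>By norming characters, which are points of \<open>T\<close>,
  \<open>essential_sup f\<close> is at most the supremum over \<open>?K\<close>. A function with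
  \<open>essential_sup f < d / 2\<close> is cut off at modulus \<open>d / 2\<close>: the truncation
  is uniformly small, the remainder vanishes where \<open>cmod (f t) \<le> d / 2\<close>, and both
  lie in \<open>V\<close> even after doubling.\<close>

lemma zero_neighbourhood:
  assumes T: "realcompact_space T"
  shows "\<exists>U. openin (topo (cont_algebra T)) U \<and> \<zero>\<^bsub>cont_algebra T\<^esub> \<in> U \<and> U \<subseteq> V"
proof -
  interpret r: Cstar_seminormed_algebra "cont_algebra T" essential_sup
    using Cstar_seminorm_essential_sup by unfold_locales
  let ?K = "{t \<in> topspace T. \<forall>f \<in> carrier (cont_algebra T). cmod (f t) \<le> essential_sup f}"
  have K: "compactin T ?K" by (rule compactin_realcompact[OF T])
  have sup: "essential_sup f \<le> sup_seminorm ?K f" if f: "f \<in> carrier (cont_algebra T)" for f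
  proof (cases "0 < essential_sup f")
    case True
    then obtain u where u: "u \<in> star_characters (cont_algebra T)"
      "\<forall>g \<in> carrier (cont_algebra T). cmod (u g) \<le> essential_sup g" "cmod (u f) = essential_sup f"
      using r.norming_character[OF f] by blast
    obtain t where t: "t \<in> topspace T" "u = point_eval T t" by (rule realcompact_star_character[OF T u(1)])
    have "t \<in> ?K" using u(2) t by (simp add: point_eval_def)
    from le_sup_seminorm[OF K f this] show ?thesis using u(3) t(2) f by (simp add: point_eval_def)
  next
    case False
    then show ?thesis using sup_seminorm_nonneg[OF K f] by simp
  qed
  obtain d where d: "0 < d" "\<And>f. \<lbrakk>f \<in> carrier (cont_algebra T); \<And>t. t \<in> topspace T \<Longrightarrow> cmod (f t) \<le> d\<rbrakk> \<Longrightarrow> f \<in> V"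
    using uniformly_small_in_V by blast
  let ?U = "{f \<in> carrier (cont_algebra T). pmax {sup_seminorm ?K} f < d / 2}"
  have "?U \<subseteq> V"
  proof
    fix f assume "f \<in> ?U"
    then have f: "f \<in> carrier (cont_algebra T)" "sup_seminorm ?K f < d / 2"
      by (simp_all only: mem_Collect_eq pmax_less_iff finite.intros ball_simps)
    then have f: "f \<in> carrier (cont_algebra T)" "essential_sup f < d / 2"
      using sup[OF f(1)] by linarith+
    have ess: "essential_bound f (d / 2)" by (rule essential_sup_less[OF f])
    \<comment> \<open>The factor \<open>d / 2 / w t\<close> truncates \<open>f\<close> to modulus at
      most \<open>d / 2\<close> and is 1 where \<open>f\<close> is already that small.\<close>
    define w where "w t = max (d / 2) (cmod (f t))" for t
    have w: "0 < w t" for t using d(1) by (simp add: w_def)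
    have "continuous_map T euclidean w"
      unfolding w_def by (intro continuous_map_real_max continuous_map_norm cont_algebraD f) simp
    then have cont: "continuous_map T euclidean (\<lambda>t. f t * complex_of_real (d / 2 / w t))"
      using w less_irrefl
      by (intro continuous_map_complex_mult continuous_map_complex_of_real continuous_map_real_divide cont_algebraD[OF f(1)]) (simp_all add: less_imp_neq[THEN not_sym])
    let ?f1 = "\<lambda>t \<in> topspace T. f t * complex_of_real (d / 2 / w t)"
    let ?f2 = "f \<ominus>\<^bsub>cont_algebra T\<^esub> ?f1"
    have f1: "?f1 \<in> carrier (cont_algebra T)" using cont by simp
    have f2: "?f2 \<in> carrier (cont_algebra T)" using f1 f(1) by simp
    have "f = ?f1 \<oplus>\<^bsub>cont_algebra T\<^esub> ?f2"
      using f1 f2 f(1) by (intro cont_algebra_eqI[OF f(1)]) (simp_all, simp add: cont_algebra_simps minus_cont_algebra)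
    moreover have "2 \<odot>\<^bsub>cont_algebra T\<^esub> ?f1 \<in> V"
    proof (rule d(2)[OF sm_closed[OF f1]])
      fix t assume t: "t \<in> topspace T"
      have "cmod (f t) * (d / 2 / w t) \<le> d / 2"
        using w[of t] d(1) by (simp add: w_def field_simps)
      then show "cmod ((2 \<odot>\<^bsub>cont_algebra T\<^esub> ?f1) t) \<le> d"
        using t w[of t] d(1) by (simp add: cont_algebra_simps norm_mult norm_divide)
    qed
    moreover have "2 \<odot>\<^bsub>cont_algebra T\<^esub> ?f2 \<in> V"
    proof -
      have "(2 \<odot>\<^bsub>cont_algebra T\<^esub> ?f2) t = 0" if "t \<in> topspace T" "cmod (f t) \<le> d / 2" for t
        using that d(1) f(1) f1 by (simp add: cont_algebra_simps minus_cont_algebra w_def max_absorb1)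
      then show ?thesis using ess sm_closed[OF f2, of 2] unfolding essential_bound_def by blast
    qed
    ultimately show "f \<in> V" using halves_in_V[OF f1 f2] by simp
  qed
  moreover have "openin (topo (cont_algebra T)) ?U"
    using K by (intro openin_zero_ball) auto
  moreover have "\<zero>\<^bsub>cont_algebra T\<^esub> \<in> ?U"
    using d(1) K zero_in_ball[of "{sup_seminorm ?K}" "d / 2" "\<zero>\<^bsub>cont_algebra T\<^esub>"] by simp
  ultimately show ?thesis by blast
qed

end

theorem bornological_cont_algebra:
  assumes "realcompact_space T"
  shows "bornological (cont_algebra T)"
  unfolding bornological_def
proof (intro allI impI)
  fix V assume "absolutely_convex (cont_algebra T) V \<and> (\<forall>B. bounded_subset (cont_algebra T) B \<longrightarrow> absorbs (cont_algebra T) V B)"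
  then interpret bornivorous_set T V by unfold_locales auto
  show "\<exists>U. openin (topo (cont_algebra T)) U \<and> \<zero>\<^bsub>cont_algebra T\<^esub> \<in> U \<and> U \<subseteq> V"
    by (rule zero_neighbourhood[OF assms])
qed

section \<open>Bornological $K^*$-algebras are function algebras\<close>

text \<open>The Stone--Weierstrass theorem of the library is stated for types of class \<open>t2_space\<close>, which has
  no instance for function types; hence this copy of the product topology.\<close>

typedef ('i, 'a) product_point = "UNIV :: ('i \<Rightarrow> 'a) set"
  morphisms coords Point by simp

instantiation product_point :: (type, topological_space) topological_space
begin

definition open_product_point :: "('a, 'b) product_point set \<Rightarrow> bool" where
  "open_product_point S \<longleftrightarrow> open {f. Point f \<in> S}"

instance
proof
  show "open (UNIV :: ('a, 'b) product_point set)" by (simp add: open_product_point_def)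
  show "open (S \<inter> T)" if "open S" "open T" for S T :: "('a, 'b) product_point set"
    using open_Int[OF that[unfolded open_product_point_def]] by (simp add: open_product_point_def Collect_conj_eq)
  show "open (\<Union> K)" if "\<forall>S \<in> K. open S" for K :: "('a, 'b) product_point set set"
  proof -
    have "{f. Point f \<in> \<Union> K} = (\<Union>S \<in> K. {f. Point f \<in> S})" by auto
    then show ?thesis using that by (auto simp: open_product_point_def)
  qed
qed

end

lemma open_coords_vimage: "open U \<Longrightarrow> open {p. coords p i \<in> U}"
  using open_vimage[OF _ continuous_on_product_coordinates[of i], of U]
  by (simp add: open_product_point_def Point_inverse vimage_def)

instance product_point :: (type, t2_space) t2_space
proof
  fix p q :: "('a, 'b) product_point"
  assume "p \<noteq> q"
  then obtain i where "coords p i \<noteq> coords q i" by (metis coords_inject ext)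
  then obtain U V where "open U" "open V" "coords p i \<in> U" "coords q i \<in> V" "U \<inter> V = {}"
    using hausdorff[of "coords p i" "coords q i"] by blast
  then show "\<exists>U V. open U \<and> open V \<and> p \<in> U \<and> q \<in> V \<and> U \<inter> V = {}"
    by (intro exI[of _ "{p. coords p i \<in> U}"] exI[of _ "{p. coords p i \<in> V}"])
      (auto simp: open_coords_vimage)
qed

lemma continuous_on_coords: "continuous_on S (\<lambda>p. coords p i)"
proof (rule continuous_on_subset[OF _ subset_UNIV])
  show "continuous_on UNIV (\<lambda>p. coords p i)"
    unfolding continuous_on_open_vimage[OF open_UNIV]
    using open_coords_vimage by (auto simp: vimage_def)
qed

lemma continuous_map_Point:
  fixes X :: "('i \<Rightarrow> 'a::topological_space) topology"
  assumes "\<And>i. continuous_map X euclidean (\<lambda>u. u i)"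
  shows "continuous_map X euclidean Point"
proof -
  have X: "continuous_map X euclidean (\<lambda>u. u)"
    unfolding euclidean_product_topology[symmetric] continuous_map_componentwise_UNIV
    using assms by (simp add: euclidean_product_topology)
  show ?thesis
    unfolding continuous_map_def
  proof (intro conjI allI impI)
    fix S :: "('i, 'a) product_point set" assume "openin euclidean S"
    then have "open {f. Point f \<in> S}" by (simp add: open_product_point_def)
    then show "openin X {u \<in> topspace X. Point u \<in> S}"
      using openin_continuous_map_preimage[OF X, of "{f. Point f \<in> S}"] by simp
  qed auto
qed

section \<open>Equicontinuous sets of characters and the Gelfand transform\<close>

locale bornological_Kstar_algebra = Cstar_topological_algebra +
  assumes Hausdorff: "Hausdorff_space (topo A)"
    and complete: "complete_algebra A"
    and bornological: "bornological A"
begin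

text \<open>For finite \<open>F \<subseteq> P\<close> these sets are compact and together exhaust
  the spectrum; uniform estimates on them are estimates for the topology of
  \<open>A\<close>.\<close>

definition equicont :: "('a \<Rightarrow> real) set \<Rightarrow> ('a \<Rightarrow> complex) set" where
  "equicont F = {u \<in> star_characters A. \<forall>x \<in> carrier A. cmod (u x) \<le> pmax F x}"

lemma equicontD: "\<lbrakk>u \<in> equicont F; x \<in> carrier A\<rbrakk> \<Longrightarrow> cmod (u x) \<le> pmax F x"
  by (simp add: equicont_def)

lemma equicont_subset: "\<lbrakk>finite F; F \<subseteq> P\<rbrakk> \<Longrightarrow> equicont F \<subseteq> topspace (spectrum A)"
  unfolding topspace_spectrum Kstar_hom_complex_Kstar equicont_def using continuous_character by blast

lemma compactin_equicont: "\<lbrakk>finite F; F \<subseteq> P\<rbrakk> \<Longrightarrow> compactin (spectrum A) (equicont F)"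
  unfolding equicont_def
  by (rule compactin_spectrum[OF involutive_algebra_axioms]) (rule continuous_character)

lemma in_equicont: "u \<in> topspace (spectrum A) \<Longrightarrow> \<exists>F. finite F \<and> F \<subseteq> P \<and> u \<in> equicont F"
  unfolding topspace_spectrum Kstar_hom_complex_Kstar equicont_def using continuous_character_iff by blast

lemma spectrum_star_characters: "u \<in> topspace (spectrum A) \<Longrightarrow> u \<in> star_characters A"
  by (simp add: topspace_spectrum Kstar_hom_complex_Kstar)

text \<open>\<open>norming_character\<close> makes \<open>pmax F\<close> the supremum of the moduli
  over \<open>equicont F\<close>; the assumption \<open>0 \<le> M\<close> takes care of an empty
  \<open>equicont F\<close>.\<close>

lemma pmax_le_of_characters:
  assumes F: "finite F" "F \<subseteq> P" and x: "x \<in> carrier A" and M: "0 \<le> M" "\<And>u. u \<in> equicont F \<Longrightarrow> cmod (u x) \<le> M"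
  shows "pmax F x \<le> M"
proof (cases "0 < pmax F x")
  case True
  interpret p: Cstar_seminormed_algebra A "pmax F" by (rule pmax_seminorm[OF F])
  obtain u where u: "u \<in> star_characters A" "\<forall>y \<in> carrier A. cmod (u y) \<le> pmax F y" "cmod (u x) = pmax F x"
    using p.norming_character[OF x True] by blast
  then have "u \<in> equicont F" by (simp add: equicont_def)
  from M(2)[OF this] u(3) show ?thesis by simp
qed (use M in simp)

text \<open>Each \<open>p (x \<ominus> y)\<close> is bounded by the moduli of characters that vanish
  at \<open>x \<ominus> y\<close>, so it is 0, and the topology is Hausdorff.\<close>

lemma spectrum_separates:
  assumes x: "x \<in> carrier A" and y: "y \<in> carrier A" and eq: "\<And>u. u \<in> topspace (spectrum A) \<Longrightarrow> u x = u y"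
  shows "x = y"
proof -
  have "p (x \<ominus> y) = 0" if p: "p \<in> P" for p
  proof -
    have "pmax {p} (x \<ominus> y) \<le> 0"
      using x y p eq equicont_subset[of "{p}"]
      by (intro pmax_le_of_characters) (auto simp: equicont_def star_character_minus)
    then show ?thesis
      using Cstar_seminormed_algebra.p_nonneg[OF P_seminorm[OF p], of "x \<ominus> y"] x y
      by (auto simp: pmax_le_iff intro: antisym)
  qed
  then have "x \<ominus> y = \<zero>" using Hausdorff x y unfolding Hausdorff_iff by blast
  moreover have "x = (x \<ominus> y) \<oplus> y" using x y by (simp add: minus_eq a_assoc l_neg)
  ultimately show ?thesis using y by simp
qed

text \<open>Stone--Weierstrass on \<open>equicont F\<close>, for the ring of those real functions
  that come from elements of \<open>A\<close>.\<close>

lemma approximation_real: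
  assumes F: "finite F" "F \<subseteq> P" and e: "0 < e"
    and f: "continuous_map (subtopology (spectrum A) (equicont F)) euclidean (f :: _ \<Rightarrow> real)"
  shows "\<exists>x \<in> carrier A. \<forall>u \<in> equicont F. cmod (u x - complex_of_real (f u)) < e"
proof -
  let ?S = "Point ` equicont F"
  have sub: "equicont F \<subseteq> topspace (spectrum A)" by (rule equicont_subset[OF F])
  have ext: "coords p \<in> star_characters A" if "p \<in> ?S" for p
    using that by (auto simp: equicont_def Point_inverse)
  note char = star_charactersD(2-6)[OF ext]
  have ev: "continuous_map (spectrum A) euclidean (\<lambda>u. u x)" for x
  proof (cases "x \<in> carrier A")
    \<comment> \<open>\<open>Point\<close> involves all coordinates; at those outside the carrier
      every character has the constant value \<open>undefined\<close>.\<close>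
    case False
    then have eq: "undefined = u x" if "u \<in> topspace (spectrum A)" for u
      using that by (auto simp: topspace_spectrum Kstar_hom_def extensional_def)
    show ?thesis by (rule continuous_map_eq[where f = "\<lambda>_. undefined"]) (simp, rule eq)
  qed (rule continuous_map_spectrum_eval)
  then have "compactin euclidean ?S"
    by (intro image_compactin[OF compactin_equicont[OF F]] continuous_map_Point)
  then have S: "compact ?S" by simp
  define R where "R = {g. \<exists>x \<in> carrier A. \<forall>p \<in> ?S. coords p x = complex_of_real (g p)}"
  interpret R: function_ring_on R ?S
  proof
    show "compact ?S" by (rule S)
    fix g h assume g: "g \<in> R"
    then obtain x where x: "x \<in> carrier A" "\<And>p. p \<in> ?S \<Longrightarrow> coords p x = complex_of_real (g p)"
      unfolding R_def by blast
    have "continuous_on ?S (\<lambda>p. Re (coords p x))" by (intro continuous_intros continuous_on_coords)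
    then show "continuous_on ?S g" by (rule continuous_on_eq) (use x(2) in simp)
    assume "h \<in> R"
    then obtain y where y: "y \<in> carrier A" "\<And>p. p \<in> ?S \<Longrightarrow> coords p y = complex_of_real (h p)"
      unfolding R_def by blast
    show "(\<lambda>p. g p + h p) \<in> R"
      unfolding R_def using x y char by (intro CollectI bexI[of _ "x \<oplus> y"]) (simp_all del: image_iff)
    show "(\<lambda>p. g p * h p) \<in> R"
      unfolding R_def using x y char by (intro CollectI bexI[of _ "x \<otimes> y"]) (simp_all del: image_iff)
  next
    show "(\<lambda>_. c) \<in> R" for c
      unfolding R_def using char by (intro CollectI bexI[of _ "complex_of_real c \<odot> \<one>"]) (simp_all del: image_iff)
  next
    \<comment> \<open>Through the involution, real and imaginary parts of transforms lie in
      \<open>R\<close>, and one of them separates \<open>p\<close> and \<open>q\<close>.\<close>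
    fix p q assume p: "p \<in> ?S" and q: "q \<in> ?S" and "p \<noteq> q"
    then have "coords p \<noteq> coords q" by (simp add: coords_inject)
    then obtain x where x: "x \<in> carrier A" "coords p x \<noteq> coords q x"
      using star_charactersD(1)[OF ext[OF p]] star_charactersD(1)[OF ext[OF q]] by (meson extensionalityI)
    have "(\<lambda>p. Re (coords p x)) \<in> R"
      unfolding R_def using x char
      by (intro CollectI bexI[of _ "(1 / 2) \<odot> (x \<oplus> star A x)"]) (simp_all del: image_iff add: complex_eq_iff)
    moreover have "(\<lambda>p. Im (coords p x)) \<in> R"
      unfolding R_def using x char
      by (intro CollectI bexI[of _ "(- \<i> / 2) \<odot> (x \<oplus> (- 1) \<odot> star A x)"]) (simp_all del: image_iff add: complex_eq_iff)
    moreover have "Re (coords p x) \<noteq> Re (coords q x) \<or> Im (coords p x) \<noteq> Im (coords q x)"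
      using x(2) by (simp add: complex_eq_iff)
    ultimately show "\<exists>g \<in> R. g p \<noteq> g q" by (elim disjE) (erule rev_bexI, assumption)+
  qed
  have "continuous_map (top_of_set ?S) (spectrum A) coords"
    using sub by (intro continuous_map_into_spectrum)
      (auto simp: topspace_spectrum Point_inverse intro: continuous_on_coords)
  then have "continuous_map (top_of_set ?S) (subtopology (spectrum A) (equicont F)) coords"
    by (auto simp: continuous_map_in_subtopology Point_inverse)
  then have "continuous_on ?S (\<lambda>p. f (coords p))"
    using continuous_map_compose[OF _ f] by (fastforce simp: o_def)
  then obtain g where g: "g \<in> R" "\<forall>p \<in> ?S. \<bar>f (coords p) - g p\<bar> < e"
    using R.Stone_Weierstrass_basic e by blast
  then obtain x where x: "x \<in> carrier A" "\<And>p. p \<in> ?S \<Longrightarrow> coords p x = complex_of_real (g p)"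
    unfolding R_def by blast
  have "cmod (u x - complex_of_real (f u)) < e" if "u \<in> equicont F" for u
  proof -
    have "u x = complex_of_real (g (Point u))" "\<bar>f u - g (Point u)\<bar> < e"
      using x(2)[of "Point u"] g(2) that by (auto simp: Point_inverse)
    then show ?thesis by (simp flip: of_real_diff add: abs_minus_commute)
  qed
  with x(1) show ?thesis by blast
qed

lemma approximation:
  assumes F: "finite F" "F \<subseteq> P" and e: "0 < e"
    and f: "continuous_map (subtopology (spectrum A) (equicont F)) euclidean f"
  shows "\<exists>x \<in> carrier A. \<forall>u \<in> equicont F. cmod (u x - f u) < e"
proof -
  have e2: "0 < e / 2" using e by simp
  obtain x where x: "x \<in> carrier A" "\<And>u. u \<in> equicont F \<Longrightarrow> cmod (u x - complex_of_real (Re (f u))) < e / 2"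
    using approximation_real[OF F e2 continuous_map_Re[OF f]] by blast
  obtain y where y: "y \<in> carrier A" "\<And>u. u \<in> equicont F \<Longrightarrow> cmod (u y - complex_of_real (Im (f u))) < e / 2"
    using approximation_real[OF F e2 continuous_map_Im[OF f]] by blast
  have "cmod (u (x \<oplus> \<i> \<odot> y) - f u) < e" if u: "u \<in> equicont F" for u
  proof -
    have "u (x \<oplus> \<i> \<odot> y) - f u = (u x - complex_of_real (Re (f u))) + \<i> * (u y - complex_of_real (Im (f u)))"
      using u x(1) y(1) by (simp add: equicont_def star_charactersD complex_eq_iff)
    also have "cmod \<dots> \<le> cmod (u x - complex_of_real (Re (f u))) + cmod (u y - complex_of_real (Im (f u)))"
      using norm_triangle_ineq[of "u x - complex_of_real (Re (f u))" "\<i> * (u y - complex_of_real (Im (f u)))"]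
      by (simp add: norm_mult)
    also have "\<dots> < e" using x(2)[OF u] y(2)[OF u] by simp
    finally show ?thesis .
  qed
  then show ?thesis using x(1) y(1) by (intro bexI[of _ "x \<oplus> \<i> \<odot> y"]) auto
qed

text \<open>The sets \<open>S (F, e)\<close> of elements within \<open>e\<close> of \<open>f\<close>
  on \<open>equicont F\<close> are nonempty by \<open>approximation\<close> and generate a filter.
  It is Cauchy because \<open>pmax F\<close> is a supremum over \<open>equicont F\<close>, and each
  \<open>u\<close> in the spectrum takes the value \<open>f u\<close> at its limit.\<close>

theorem transform_surjective:
  assumes f: "\<And>F. \<lbrakk>finite F; F \<subseteq> P\<rbrakk> \<Longrightarrow> continuous_map (subtopology (spectrum A) (equicont F)) euclidean f"
  shows "\<exists>x \<in> carrier A. \<forall>u \<in> topspace (spectrum A). u x = f u"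
proof -
  define B where "B = {(F, e::real). finite F \<and> F \<subseteq> P \<and> 0 < e}"
  define S where "S = (\<lambda>(F, e). {x \<in> carrier A. \<forall>u \<in> equicont F. cmod (u x - f u) < e})"
  define \<F> where "\<F> = (INF b\<in>B. principal (S b))"
  have B: "({}, 1) \<in> B" by (simp add: B_def)
  have dir: "\<exists>c \<in> B. principal (S c) \<le> inf (principal (S a)) (principal (S b))" if ab: "a \<in> B" "b \<in> B" for a b
  proof -
    obtain F d G e where ab': "a = (F, d)" "b = (G, e)" by (metis surj_pair)
    have FG: "finite F" "finite G" "(F \<union> G, min d e) \<in> B" using ab by (auto simp: ab' B_def)
    have "equicont F \<subseteq> equicont (F \<union> G)" "equicont G \<subseteq> equicont (F \<union> G)"
      using FG by (auto simp: equicont_def intro: order_trans[OF _ pmax_mono])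
    then have "S (F \<union> G, min d e) \<subseteq> S a \<inter> S b" by (auto simp: S_def ab')
    then show ?thesis using FG(3) by (intro bexI[of _ "(F \<union> G, min d e)"]) auto
  qed
  have ev: "eventually Q \<F> \<longleftrightarrow> (\<exists>b \<in> B. \<forall>x \<in> S b. Q x)" for Q
    unfolding \<F>_def using eventually_INF_base[OF _ dir, of Q] B by (auto simp: eventually_principal)
  have ne: "\<exists>x. x \<in> S b" if "b \<in> B" for b
    using that approximation f by (fastforce simp: B_def S_def)
  then have bot: "\<F> \<noteq> bot" unfolding trivial_limit_def ev by blast
  have "Cauchy_filter A \<F>"
    unfolding Cauchy_filter_iff
  proof (intro conjI bot allI impI)
    fix F e assume F: "finite F" "F \<subseteq> P" and e: "(e::real) > 0"
    \<comment> \<open>Two approximants within \<open>e / 4\<close> differ by at most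
      \<open>e / 2\<close> on \<open>equicont F\<close>, which leaves room for the strict bound by
      \<open>e\<close>.\<close>
    let ?b = "(F, e / 4)"
    have b: "?b \<in> B" using F e by (simp add: B_def)
    have "pmax F (x \<ominus> y) < e" if xy: "x \<in> S ?b" "y \<in> S ?b" for x y
    proof -
      have car: "x \<in> carrier A" "y \<in> carrier A" using xy by (auto simp: S_def)
      have "cmod (u (x \<ominus> y)) \<le> e / 2" if u: "u \<in> equicont F" for u
      proof -
        have "u (x \<ominus> y) = (u x - f u) - (u y - f u)" using u car by (simp add: equicont_def star_character_minus)
        also have "cmod \<dots> \<le> cmod (u x - f u) + cmod (u y - f u)" by (rule norm_triangle_ineq4)
        also have "\<dots> \<le> e / 4 + e / 4" using xy u by (intro add_mono) (auto simp: S_def intro: less_imp_le)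
        finally show ?thesis by simp
      qed
      then have "pmax F (x \<ominus> y) \<le> e / 2" using F car e by (intro pmax_le_of_characters) auto
      then show ?thesis using e by simp
    qed
    then show "\<exists>S \<subseteq> carrier A. (\<forall>\<^sub>F x in \<F>. x \<in> S) \<and> (\<forall>x \<in> S. \<forall>y \<in> S. pmax F (x \<ominus> y) < e)"
      using b by (intro exI[of _ "S ?b"] conjI) (auto simp: ev, auto simp: S_def)
  qed
  then obtain l where l: "limitin (topo A) (\<lambda>x. x) l \<F>" using complete unfolding complete_algebra_def by blast
  then have lc: "l \<in> carrier A" unfolding limitin_topo by blast
  have "u l = f u" if u: "u \<in> topspace (spectrum A)" for u
  proof -
    obtain F where F: "finite F" "F \<subseteq> P" "u \<in> equicont F" using in_equicont[OF u] by blast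
    have "cmod (u l - f u) \<le> 0"
    proof (rule field_le_epsilon)
      fix e :: real assume e: "0 < e"
      then have e2: "0 < e / 2" by simp
      have "(F, e / 2) \<in> B" using F e by (simp add: B_def)
      then have "\<forall>\<^sub>F x in \<F>. x \<in> S (F, e / 2)" unfolding ev by blast
      moreover have "\<forall>\<^sub>F x in \<F>. x \<in> carrier A \<and> pmax F (x \<ominus> l) < e / 2"
        using l F(1,2) e2 unfolding limitin_topo by blast
      ultimately have "\<forall>\<^sub>F x in \<F>. x \<in> S (F, e / 2) \<and> x \<in> carrier A \<and> pmax F (x \<ominus> l) < e / 2"
        by (rule eventually_conj)
      then obtain x where x: "x \<in> S (F, e / 2)" "x \<in> carrier A" "pmax F (x \<ominus> l) < e / 2"
        using eventually_happens'[OF bot] by blast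
      have "u l - f u = (u x - f u) - u (x \<ominus> l)"
        using star_character_minus[OF spectrum_star_characters[OF u] x(2) lc] by simp
      also have "cmod \<dots> \<le> cmod (u x - f u) + cmod (u (x \<ominus> l))" by (rule norm_triangle_ineq4)
      also have "\<dots> \<le> e / 2 + e / 2"
        using x(1) F(3) equicontD[OF F(3), of "x \<ominus> l"] x(2,3) lc by (intro add_mono) (auto simp: S_def)
      finally show "cmod (u l - f u) \<le> 0 + e" by simp
    qed
    then show ?thesis by simp
  qed
  then show ?thesis using lc by blast
qed

lemma transform_surjective_continuous:
  assumes "continuous_map (spectrum A) euclidean f"
  shows "\<exists>x \<in> carrier A. \<forall>u \<in> topspace (spectrum A). u x = f u"
  by (rule transform_surjective) (rule continuous_map_from_subtopology[OF assms])

text \<open>Equicontinuous sets are compact, so a function continuous on compact sets is the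
  transform of an element, and transforms are continuous.\<close>

theorem kC_spectrum: "kC_space (spectrum A)"
  unfolding kC_space_def
proof (intro conjI Tychonoff_spectrum allI impI)
  fix f :: "('a \<Rightarrow> complex) \<Rightarrow> complex"
  assume f: "\<forall>K. compactin (spectrum A) K \<longrightarrow> continuous_map (subtopology (spectrum A) K) euclidean f"
  then obtain x where x: "x \<in> carrier A" "\<forall>u \<in> topspace (spectrum A). u x = f u"
    using transform_surjective[of f] compactin_equicont by blast
  show "continuous_map (spectrum A) euclidean f"
    by (rule continuous_map_eq[OF continuous_map_spectrum_eval[OF x(1)]]) (use x(2) in simp)
qed

section \<open>Automatic continuity and realcompactness of the spectrum\<close>

text \<open>On each equicontinuous set the values of the \<open>x n\<close> are uniformly bounded,
  so geometric weights make the series uniformly convergent there, and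
  \<open>transform_surjective\<close> turns the sum into an element.\<close>

lemma weighted_square_sum:
  assumes B: "\<And>n. x n \<in> carrier A" and bdd: "\<And>p. p \<in> P \<Longrightarrow> \<exists>M. \<forall>n::nat. p (x n) \<le> M"
  shows "\<exists>y \<in> carrier A. \<forall>u \<in> topspace (spectrum A).
    u y = complex_of_real (\<Sum>n. (1 / 2) ^ n * (cmod (u (x n)))\<^sup>2) \<and> summable (\<lambda>n. (1 / 2) ^ n * (cmod (u (x n)))\<^sup>2)"
proof -
  let ?g = "\<lambda>n u. (1 / 2) ^ n * (cmod (u (x n)))\<^sup>2 :: real"
  have bound: "\<exists>M. \<forall>n. \<forall>u \<in> equicont F. norm (?g n u) \<le> (1 / 2) ^ n * M" if F: "finite F" "F \<subseteq> P" for F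
  proof -
    obtain M where M: "\<And>p n. p \<in> P \<Longrightarrow> p (x n) \<le> M p" using bdd by metis
    define m where "m = Max (insert 0 (M ` F))"
    have m: "0 \<le> m" "\<And>p. p \<in> F \<Longrightarrow> M p \<le> m" using F(1) by (auto simp: m_def)
    have "pmax F (x n) \<le> m" for n
      using F m(1) order_trans[OF M m(2)] by (auto simp: pmax_le_iff)
    then have "cmod (u (x n)) \<le> m" if "u \<in> equicont F" for u n
      using equicontD[OF that B] order_trans by blast
    then show ?thesis
      by (intro exI[of _ "m\<^sup>2"]) (auto intro!: mult_left_mono power_mono)
  qed
  have summ: "summable (\<lambda>n. (1 / 2 :: real) ^ n * M)" for M
    by (intro summable_mult2 summable_geometric) simp
  have "continuous_map (subtopology (spectrum A) (equicont F)) euclidean (\<lambda>u. \<Sum>n. ?g n u)"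
    if F: "finite F" "F \<subseteq> P" for F
  proof -
    obtain M where M: "\<forall>n. \<forall>u \<in> equicont F. norm (?g n u) \<le> (1 / 2) ^ n * M" using bound[OF F] by blast
    have unif: "uniform_limit (equicont F) (\<lambda>n u. \<Sum>i<n. ?g i u) (\<lambda>u. suminf (\<lambda>n. ?g n u)) sequentially"
      by (rule Weierstrass_m_test[OF _ summ[of M]]) (use M in blast)
    show ?thesis
      unfolding mtopology_is_euclidean[symmetric]
    proof (rule Met_TC.continuous_map_uniform_limit[where F = sequentially and f = "\<lambda>n u. \<Sum>i<n. ?g i u"])
      have "continuous_map (spectrum A) euclidean (\<lambda>u. \<Sum>i<n. ?g i u)" for n
        by (intro continuous_map_sum continuous_map_real_mult continuous_map_real_pow continuous_map_norm
            continuous_map_spectrum_eval B) simp_all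
      then show "\<forall>\<^sub>F n in sequentially. continuous_map (subtopology (spectrum A) (equicont F)) Met_TC.mtopology (\<lambda>u. \<Sum>i<n. ?g i u)"
        by (simp add: continuous_map_from_subtopology)
      show "\<forall>\<^sub>F n in sequentially. \<forall>u \<in> topspace (subtopology (spectrum A) (equicont F)).
          suminf (\<lambda>n. ?g n u) \<in> UNIV \<and> dist (\<Sum>i<n. ?g i u) (suminf (\<lambda>n. ?g n u)) < e" if "0 < e" for e
        using uniform_limitD[OF unif that] by (rule eventually_mono) simp
    qed simp
  qed
  then obtain y where y: "y \<in> carrier A" "\<forall>u \<in> topspace (spectrum A). u y = complex_of_real (\<Sum>n. ?g n u)"
    using transform_surjective[of "\<lambda>u. complex_of_real (\<Sum>n. ?g n u)"] continuous_map_complex_of_real by blast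
  have "summable (\<lambda>n. ?g n u)" if "u \<in> topspace (spectrum A)" for u
  proof -
    obtain F where F: "finite F" "F \<subseteq> P" "u \<in> equicont F" using in_equicont \<open>u \<in> topspace (spectrum A)\<close> by blast
    obtain M where "\<forall>n. \<forall>u \<in> equicont F. norm (?g n u) \<le> (1 / 2) ^ n * M" using bound[OF F(1,2)] by blast
    then have M: "\<forall>n. norm (?g n u) \<le> (1 / 2) ^ n * M" using F(3) by blast
    show ?thesis by (rule summable_comparison_test'[OF summ[of M], of 0]) (use M in blast)
  qed
  then show ?thesis using y by blast
qed

text \<open>Characters that are not assumed to be continuous are still monotone on positive functions, since
  these have square roots in the algebra. If a $C^*$-seminorm \<open>r\<close> were unbounded on a sequence \<open>x\<^sub>n\<close> in a
  bounded set, it would therefore be infinite at \<open>\<Sum> 2\<^sup>-\<^sup>n x\<^sub>n x\<^sub>n\<^sup>*\<close>.\<close>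

theorem Cstar_seminorm_continuous:
  assumes r: "Cstar_seminorm A r"
  shows "\<exists>F. finite F \<and> F \<subseteq> P \<and> (\<forall>x \<in> carrier A. r x \<le> pmax F x)"
proof -
  interpret r: Cstar_seminormed_algebra A r using r by unfold_locales
  have bdd: "\<exists>M. \<forall>x \<in> B. r x \<le> M" if B: "bounded_subset A B" for B
  proof (rule ccontr)
    assume "\<nexists>M. \<forall>x \<in> B. r x \<le> M"
    \<comment> \<open>The growth \<open>4 ^ n\<close> beats the weights: squared and multiplied by
      \<open>(1 / 2) ^ n\<close> it becomes \<open>8 ^ n\<close>.\<close>
    then have "\<forall>n::nat. \<exists>x \<in> B. 4 ^ n < r x" by (meson not_le)
    then obtain x where xB: "\<And>n. x n \<in> B" and big: "\<And>n. 4 ^ n < r (x n)" by metis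
    have x: "x n \<in> carrier A" for n using B xB unfolding bounded_subset_iff by blast
    have "\<exists>M. \<forall>n. p (x n) \<le> M" if "p \<in> P" for p
      using B xB that unfolding bounded_subset_iff by blast
    from weighted_square_sum[where x = x, OF x this] obtain y where y0: "y \<in> carrier A"
      "\<forall>u \<in> topspace (spectrum A). u y = complex_of_real (\<Sum>n. (1 / 2) ^ n * (cmod (u (x n)))\<^sup>2)
        \<and> summable (\<lambda>n. (1 / 2) ^ n * (cmod (u (x n)))\<^sup>2)"
      by (rule bexE)
    note y = y0(1) conjunct1[OF bspec[OF y0(2)]] conjunct2[OF bspec[OF y0(2)]]
    have "8 ^ n \<le> r y" for n
    proof -
      have pos: "0 < r (x n)" using big[of n] by (rule less_trans[rotated]) simp
      obtain v where v: "v \<in> star_characters A" "\<forall>z \<in> carrier A. cmod (v z) \<le> r z" "cmod (v (x n)) = r (x n)"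
        using r.norming_character[OF x pos] by blast
      let ?d = "\<lambda>u. Re (u y) - (1 / 2) ^ n * (cmod (u (x n)))\<^sup>2"
      have d: "0 \<le> ?d u" if "u \<in> topspace (spectrum A)" for u
      proof -
        have "(\<Sum>i\<in>{n}. (1 / 2) ^ i * (cmod (u (x i)))\<^sup>2) \<le> (\<Sum>i. (1 / 2) ^ i * (cmod (u (x i)))\<^sup>2)"
          by (rule sum_le_suminf[OF y(3)[OF that]]) auto
        then show ?thesis by (simp add: y(2)[OF that])
      qed
      have "continuous_map (spectrum A) euclidean (\<lambda>u. complex_of_real (sqrt (?d u)))"
        by (intro cont_intros continuous_map_real_mult continuous_map_real_pow continuous_map_spectrum_eval x y(1)) simp_all
      then obtain s where s: "s \<in> carrier A" "\<forall>u \<in> topspace (spectrum A). u s = complex_of_real (sqrt (?d u))"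
        using transform_surjective_continuous by blast
      \<comment> \<open>Here \<open>s\<close> is the square root of the rest of the series. Being an
        identity in the algebra, this also holds under \<open>v\<close>, a character not known to be
        continuous.\<close>
      have "y = ((1 / 2) ^ n) \<odot> (x n \<otimes> star A (x n)) \<oplus> s \<otimes> star A s"
      proof (rule spectrum_separates)
        fix u assume u: "u \<in> topspace (spectrum A)"
        note char = star_charactersD[OF spectrum_star_characters[OF u]]
        have "u (((1 / 2) ^ n) \<odot> (x n \<otimes> star A (x n)) \<oplus> s \<otimes> star A s)
            = (1 / 2) ^ n * (u (x n) * cnj (u (x n))) + u s * cnj (u s)"
          using x[of n] s(1) char by simp
        also have "\<dots> = complex_of_real ((1 / 2) ^ n * (cmod (u (x n)))\<^sup>2 + (sqrt (?d u))\<^sup>2)"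
        proof -
          have "u s * cnj (u s) = complex_of_real ((sqrt (?d u))\<^sup>2)"
            by (simp only: bspec[OF s(2) u] complex_cnj_complex_of_real power2_eq_square of_real_mult)
          moreover have "((1 / 2) ^ n :: complex) = complex_of_real ((1 / 2) ^ n)" by simp
          ultimately show ?thesis
            by (simp only: complex_norm_square[symmetric] of_real_add of_real_mult)
        qed
        also have "\<dots> = complex_of_real (Re (u y))" using d[OF u] by simp
        also have "\<dots> = u y" by (simp add: y(2)[OF u])
        finally show "u y = u (((1 / 2) ^ n) \<odot> (x n \<otimes> star A (x n)) \<oplus> s \<otimes> star A s)" ..
      qed (use x[of n] s(1) y(1) in auto)
      then have "v y = (1 / 2) ^ n * (v (x n) * cnj (v (x n))) + v s * cnj (v s)"
        using star_charactersD[OF v(1)] x[of n] s(1) by simp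
      then have "v y = complex_of_real ((1 / 2) ^ n * (cmod (v (x n)))\<^sup>2 + (cmod (v s))\<^sup>2)"
        by (simp only: complex_norm_square[symmetric] of_real_add of_real_mult of_real_power of_real_divide of_real_1 of_real_numeral)
      then have "(1 / 2) ^ n * (r (x n))\<^sup>2 \<le> cmod (v y)"
        using v(3) by (simp only: norm_of_real) simp
      also have "\<dots> \<le> r y" using v(2) y(1) by blast
      finally have "(1 / 2) ^ n * (r (x n))\<^sup>2 \<le> r y" .
      moreover have "(8::real) ^ n = (1 / 2) ^ n * (4 ^ n)\<^sup>2"
        by (simp flip: power_mult_distrib add: power2_eq_square)
      moreover have "(1 / 2) ^ n * (4 ^ n)\<^sup>2 \<le> (1 / 2 :: real) ^ n * (r (x n))\<^sup>2"
        using big[of n] by (intro mult_left_mono power_mono) auto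
      ultimately show ?thesis by linarith
    qed
    moreover obtain n where "r y < 8 ^ n" using real_arch_pow[of 8 "r y"] by auto
    ultimately show False by (meson not_le)
  qed
  \<comment> \<open>By \<open>bdd\<close> the unit ball of \<open>r\<close> absorbs bounded sets, so
    it is a neighbourhood of zero in a bornological algebra.\<close>
  let ?V = "{x \<in> carrier A. r x \<le> 1}"
  have "absolutely_convex A ?V"
    unfolding absolutely_convex_def
  proof (intro conjI ballI allI impI)
    fix x y a b assume xy: "x \<in> ?V" "y \<in> ?V" and ab: "cmod a + cmod b \<le> 1"
    have "r (a \<odot> x \<oplus> b \<odot> y) \<le> cmod a * r x + cmod b * r y"
      using xy r.p_add[of "a \<odot> x" "b \<odot> y"] by (simp add: r.p_sm)
    also have "\<dots> \<le> cmod a * 1 + cmod b * 1" using xy by (intro add_mono mult_left_mono) auto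
    finally show "a \<odot> x \<oplus> b \<odot> y \<in> ?V" using xy ab by simp
  qed auto
  moreover have "absorbs A ?V B" if B: "bounded_subset A B" for B
  proof -
    obtain M where M: "\<And>x. x \<in> B \<Longrightarrow> r x \<le> M" using bdd[OF B] by blast
    have car: "x \<in> carrier A" if "x \<in> B" for x using B that unfolding bounded_subset_iff by blast
    show ?thesis
      unfolding absorbs_def
    \<comment> \<open>The 1 in the maximum makes \<open>c\<close> invertible.\<close>
    proof (intro exI[of _ "max M 1"] conjI allI impI subsetI)
      fix c x assume c: "max M 1 \<le> cmod c" and x: "x \<in> B"
      then have "c \<noteq> 0" by auto
      then have "x = c \<odot> (inverse c \<odot> x)"
        using car[OF x] by (simp add: sm_sm)
      moreover have "inverse (cmod c) * r x \<le> 1"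
        using \<open>c \<noteq> 0\<close> M[OF x] c by (simp add: field_simps)
      then have "r (inverse c \<odot> x) \<le> 1"
        using car[OF x] by (simp add: r.p_sm norm_inverse)
      ultimately have "x = c \<odot> (inverse c \<odot> x)" "r (inverse c \<odot> x) \<le> 1" by blast+
      then show "x \<in> (\<lambda>v. c \<odot> v) ` ?V" using car[OF x] by blast
    qed simp
  qed
  ultimately obtain U where U: "openin (topo A) U" "\<zero> \<in> U" "U \<subseteq> ?V"
    using bornological unfolding bornological_def by blast
  show ?thesis
  proof (rule Cstar_seminorm_le_pmax[OF r U(1,2)])
    show "r x \<le> 1" if "x \<in> U" for x using U(3) that by blast
  qed blast
qed

text \<open>The modulus of a character is a C*-seminorm, and all of these are continuous.\<close>

lemma star_character_continuous:
  assumes "u \<in> star_characters A"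
  shows "u \<in> topspace (spectrum A)"
proof -
  obtain F where "finite F" "F \<subseteq> P" "\<forall>x \<in> carrier A. cmod (u x) \<le> pmax F x"
    using Cstar_seminorm_continuous[OF Cstar_seminorm_star_character[OF involutive_algebra_axioms assms]] by blast
  then show ?thesis
    using continuous_character[OF assms] assms by (simp add: topspace_spectrum Kstar_hom_complex_Kstar)
qed

text \<open>Composing \<open>h\<close> with the real and imaginary parts of transforms gives an
  algebraic character of \<open>A\<close>. It is automatically continuous, hence a point of the
  spectrum, and it represents \<open>h\<close> because every continuous function is a
  transform.\<close>

theorem realcompact_spectrum: "realcompact_space (spectrum A)"
  unfolding realcompact_space_def
proof (intro conjI Tychonoff_spectrum allI impI)
  let ?X = "spectrum A"
  fix h assume h: "real_character ?X h"
  define re im where "re x = (\<lambda>u \<in> topspace ?X. Re (u x))" and "im x = (\<lambda>u \<in> topspace ?X. Im (u x))" for x :: 'a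
  have C: "restrict g (topspace ?X) \<in> real_continuous_functions ?X" if "continuous_map ?X euclidean g" for g
    using that by (auto simp: real_continuous_functions_def intro: continuous_map_eq)
  have reim: "re x \<in> real_continuous_functions ?X" "im x \<in> real_continuous_functions ?X" if "x \<in> carrier A" for x
    unfolding re_def im_def by (intro C cont_intros continuous_map_spectrum_eval that)+
  note cmr = continuous_map_real_mult continuous_map_add continuous_map_diff continuous_map_const[THEN iffD2]
  have contD: "continuous_map ?X euclidean g" if "g \<in> real_continuous_functions ?X" for g
    using that by (simp add: real_continuous_functions_def)
  have h_add: "h (\<lambda>u \<in> topspace ?X. f u + g u) = h f + h g"
    and h_mult: "h (\<lambda>u \<in> topspace ?X. f u * g u) = h f * h g"
    and h_scale: "h (\<lambda>u \<in> topspace ?X. c * f u) = c * h f"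
    if "f \<in> real_continuous_functions ?X" "g \<in> real_continuous_functions ?X" for f g c
    using h that unfolding real_character_def by blast+
  have h_one: "h (\<lambda>u \<in> topspace ?X. 1) = 1" using h unfolding real_character_def by blast
  have h_lin: "h (\<lambda>u \<in> topspace ?X. a * f u + b * g u) = a * h f + b * h g"
    if f: "f \<in> real_continuous_functions ?X" and g: "g \<in> real_continuous_functions ?X" for f g a b
  proof -
    have sc: "(\<lambda>u \<in> topspace ?X. c * k u) \<in> real_continuous_functions ?X" if "k \<in> real_continuous_functions ?X" for k c
      by (intro C cmr contD that) simp
    have "(\<lambda>u \<in> topspace ?X. a * f u + b * g u)
        = (\<lambda>u \<in> topspace ?X. (\<lambda>u \<in> topspace ?X. a * f u) u + (\<lambda>u \<in> topspace ?X. b * g u) u)" by auto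
    then show ?thesis by (simp only: h_add[OF sc[OF f] sc[OF g]] h_scale[OF f f] h_scale[OF g g])
  qed
  have h_zero: "h (\<lambda>u \<in> topspace ?X. 0) = 0"
    using h_scale[OF reim(1)[OF zero_closed] reim(1)[OF zero_closed], of 0] by simp
  have h_bilin: "h (\<lambda>u \<in> topspace ?X. a * (f u * g u) + b * (k u * l u)) = a * (h f * h g) + b * (h k * h l)"
    if "f \<in> real_continuous_functions ?X" "g \<in> real_continuous_functions ?X"
      "k \<in> real_continuous_functions ?X" "l \<in> real_continuous_functions ?X" for f g k l a b
  proof -
    have pr: "(\<lambda>u \<in> topspace ?X. f u * g u) \<in> real_continuous_functions ?X"
      "(\<lambda>u \<in> topspace ?X. k u * l u) \<in> real_continuous_functions ?X"
      by (intro C cmr contD that)+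
    have "(\<lambda>u \<in> topspace ?X. a * (f u * g u) + b * (k u * l u))
        = (\<lambda>u \<in> topspace ?X. a * (\<lambda>u \<in> topspace ?X. f u * g u) u + b * (\<lambda>u \<in> topspace ?X. k u * l u) u)" by auto
    then show ?thesis by (simp only: h_lin[OF pr] h_mult[OF that(1,2)] h_mult[OF that(3,4)])
  qed
  define v where "v = (\<lambda>x \<in> carrier A. Complex (h (re x)) (h (im x)))"
  have "v \<in> star_characters A"
    unfolding star_characters_def
  proof (intro CollectI conjI ballI allI)
    show "v \<in> extensional (carrier A)" by (simp add: v_def)
  next
    fix x y assume x: "x \<in> carrier A" and y: "y \<in> carrier A"
    have "re (x \<oplus> y) = (\<lambda>u \<in> topspace ?X. re x u + re y u)" "im (x \<oplus> y) = (\<lambda>u \<in> topspace ?X. im x u + im y u)"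
      using x y by (auto simp: re_def im_def star_charactersD[OF spectrum_star_characters])
    then show "v (x \<oplus> y) = v x + v y"
      using x y by (simp add: v_def complex_eq_iff h_add reim)
    \<comment> \<open>The coefficients 1 and -1 are written out to match
      \<open>h_bilin\<close>.\<close>
    have "re (x \<otimes> y) = (\<lambda>u \<in> topspace ?X. 1 * (re x u * re y u) + (- 1) * (im x u * im y u))"
      "im (x \<otimes> y) = (\<lambda>u \<in> topspace ?X. 1 * (re x u * im y u) + 1 * (im x u * re y u))"
      using x y by (auto simp: re_def im_def star_charactersD[OF spectrum_star_characters])
    then have "h (re (x \<otimes> y)) = 1 * (h (re x) * h (re y)) + (- 1) * (h (im x) * h (im y))"
      "h (im (x \<otimes> y)) = 1 * (h (re x) * h (im y)) + 1 * (h (im x) * h (re y))"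
      using x y by (simp_all only: h_bilin reim)
    then show "v (x \<otimes> y) = v x * v y"
      using x y by (simp add: v_def complex_eq_iff)
  next
    have "re \<one> = (\<lambda>u \<in> topspace ?X. 1)" "im \<one> = (\<lambda>u \<in> topspace ?X. 0)"
      by (auto simp: re_def im_def star_charactersD[OF spectrum_star_characters])
    then show "v \<one> = 1" by (simp add: v_def h_one h_zero complex_eq_iff)
  next
    fix c x assume x: "x \<in> carrier A"
    have "re (c \<odot> x) = (\<lambda>u \<in> topspace ?X. Re c * re x u + (- Im c) * im x u)"
      "im (c \<odot> x) = (\<lambda>u \<in> topspace ?X. Im c * re x u + Re c * im x u)"
      using x by (auto simp: re_def im_def star_charactersD[OF spectrum_star_characters])
    then have "h (re (c \<odot> x)) = Re c * h (re x) + (- Im c) * h (im x)"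
      "h (im (c \<odot> x)) = Im c * h (re x) + Re c * h (im x)"
      using x by (simp_all only: h_lin reim)
    then show "v (c \<odot> x) = c * v x"
      using x by (simp add: v_def complex_eq_iff)
  next
    fix x assume x: "x \<in> carrier A"
    have "re (star A x) = re x" "im (star A x) = (\<lambda>u \<in> topspace ?X. (- 1) * im x u)"
      using x by (auto simp: re_def im_def star_charactersD[OF spectrum_star_characters])
    then have "h (re (star A x)) = h (re x)" "h (im (star A x)) = (- 1) * h (im x)"
      using h_scale[OF reim(2)[OF x] reim(2)[OF x], of "- 1"] by simp_all
    then show "v (star A x) = cnj (v x)"
      using x by (simp add: v_def complex_eq_iff)
  qed
  then have v: "v \<in> topspace ?X" by (rule star_character_continuous)
  have "h f = f v" if f: "f \<in> real_continuous_functions ?X" for f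
  proof -
    obtain x where x: "x \<in> carrier A" "\<forall>u \<in> topspace ?X. u x = complex_of_real (f u)"
      using transform_surjective_continuous[OF continuous_map_complex_of_real[OF contD[OF f]]] by blast
    have "re x = f"
      using f x(2) unfolding re_def real_continuous_functions_def
      by (intro extensionalityI[of _ "topspace ?X"]) auto
    then have "h f = Re (v x)" using x(1) by (simp add: v_def)
    also have "\<dots> = f v" by (simp add: bspec[OF x(2) v])
    finally show ?thesis .
  qed
  with v show "\<exists>t \<in> topspace ?X. \<forall>f \<in> real_continuous_functions ?X. h f = f t" by blast
qed

end

section \<open>The Gelfand isomorphism\<close>

lemma bornological_Kstar_algebraI:
  assumes "Kstar_algebra A" "bornological A"
  shows "\<exists>P. bornological_Kstar_algebra A P"
proof -
  obtain P where "\<forall>p \<in> P. Cstar_seminorm A p" "topo A = seminorm_topology A P" "involutive_algebra A"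
    using assms(1) unfolding Kstar_algebra_def by blast
  then have "bornological_Kstar_algebra A P"
    using assms
    by (intro bornological_Kstar_algebra.intro Cstar_topological_algebra.intro
        Cstar_topological_algebra_axioms.intro bornological_Kstar_algebra_axioms.intro) (auto simp: Kstar_algebra_def)
  then show ?thesis ..
qed

lemma Kstar_homD:
  assumes "u \<in> Kstar_hom A B"
  shows "u \<in> extensional (carrier A)"
    and "x \<in> carrier A \<Longrightarrow> u x \<in> carrier B"
    and "\<lbrakk>x \<in> carrier A; y \<in> carrier A\<rbrakk> \<Longrightarrow> u (x \<oplus>\<^bsub>A\<^esub> y) = u x \<oplus>\<^bsub>B\<^esub> u y"
    and "\<lbrakk>x \<in> carrier A; y \<in> carrier A\<rbrakk> \<Longrightarrow> u (x \<otimes>\<^bsub>A\<^esub> y) = u x \<otimes>\<^bsub>B\<^esub> u y"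
    and "u \<one>\<^bsub>A\<^esub> = \<one>\<^bsub>B\<^esub>"
    and "x \<in> carrier A \<Longrightarrow> u (c \<odot>\<^bsub>A\<^esub> x) = c \<odot>\<^bsub>B\<^esub> u x"
    and "x \<in> carrier A \<Longrightarrow> u (star A x) = star B (u x)"
    and "continuous_map (topo A) (topo B) u"
  using assms by (auto simp: Kstar_hom_def ring_hom_def)

lemma Kstar_homI:
  assumes "u \<in> extensional (carrier A)"
    and "\<And>x. x \<in> carrier A \<Longrightarrow> u x \<in> carrier B"
    and "\<And>x y. \<lbrakk>x \<in> carrier A; y \<in> carrier A\<rbrakk> \<Longrightarrow> u (x \<oplus>\<^bsub>A\<^esub> y) = u x \<oplus>\<^bsub>B\<^esub> u y"
    and "\<And>x y. \<lbrakk>x \<in> carrier A; y \<in> carrier A\<rbrakk> \<Longrightarrow> u (x \<otimes>\<^bsub>A\<^esub> y) = u x \<otimes>\<^bsub>B\<^esub> u y"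
    and "u \<one>\<^bsub>A\<^esub> = \<one>\<^bsub>B\<^esub>"
    and "\<And>c x. x \<in> carrier A \<Longrightarrow> u (c \<odot>\<^bsub>A\<^esub> x) = c \<odot>\<^bsub>B\<^esub> u x"
    and "\<And>x. x \<in> carrier A \<Longrightarrow> u (star A x) = star B (u x)"
    and "continuous_map (topo A) (topo B) u"
  shows "u \<in> Kstar_hom A B"
  using assms by (auto simp: Kstar_hom_def ring_hom_def)

text \<open>The algebraic laws of the inverse follow from those of \<open>u\<close>; its continuity
  is assumed separately.\<close>

lemma Kstar_isoI:
  assumes A: "involutive_algebra A" and u: "u \<in> Kstar_hom A B"
    and v: "\<And>y. y \<in> carrier B \<Longrightarrow> v y \<in> carrier A" "\<And>y. y \<in> carrier B \<Longrightarrow> u (v y) = y"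
    and vu: "\<And>x. x \<in> carrier A \<Longrightarrow> v (u x) = x"
    and cont: "continuous_map (topo B) (topo A) v" and ext: "v \<in> extensional (carrier B)"
  shows "Kstar_iso A B u"
proof -
  interpret involutive_algebra A by fact
  have v_eq: "v y = x" if "x \<in> carrier A" "u x = y" for x y using vu[OF that(1)] that(2) by simp
  have "v \<in> Kstar_hom B A"
    by (rule Kstar_homI[OF ext v(1)]) (use cont v Kstar_homD(3-7)[OF u] in \<open>auto intro!: v_eq\<close>)
  then show ?thesis
    using u v(2) vu unfolding Kstar_iso_def by blast
qed

definition gelfand :: "('a, 'm) top_star_algebra_scheme \<Rightarrow> 'a \<Rightarrow> ('a \<Rightarrow> complex) \<Rightarrow> complex" where
  "gelfand A = (\<lambda>x \<in> carrier A. \<lambda>u \<in> topspace (spectrum A). u x)"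

text \<open>Continuity of the transform: a supremum over a compact set of characters is a
  C*-seminorm on \<open>A\<close>, hence continuous as \<open>A\<close> is bornological. Continuity
  of the inverse: by norming characters each \<open>p\<close> is dominated by the supremum over the
  compact set \<open>equicont {p}\<close>.\<close>

theorem (in bornological_Kstar_algebra) Kstar_iso_gelfand:
  "Kstar_iso A (cont_algebra (spectrum A)) (gelfand A)"
proof -
  let ?X = "spectrum A"
  let ?C = "cont_algebra ?X"
  interpret C: Cstar_topological_algebra ?C "compact_seminorms ?X" by (rule Cstar_topological_algebra_cont_algebra)
  have car: "gelfand A x \<in> carrier ?C" if "x \<in> carrier A" for x
    using continuous_map_spectrum_eval[OF that] that by (simp add: gelfand_def)
  note char = star_charactersD[OF spectrum_star_characters]
  have hom:
    "\<And>x y. \<lbrakk>x \<in> carrier A; y \<in> carrier A\<rbrakk> \<Longrightarrow> gelfand A (x \<oplus> y) = gelfand A x \<oplus>\<^bsub>?C\<^esub> gelfand A y"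
    "\<And>x y. \<lbrakk>x \<in> carrier A; y \<in> carrier A\<rbrakk> \<Longrightarrow> gelfand A (x \<otimes> y) = gelfand A x \<otimes>\<^bsub>?C\<^esub> gelfand A y"
    "gelfand A \<one> = \<one>\<^bsub>?C\<^esub>"
    "\<And>c x. x \<in> carrier A \<Longrightarrow> gelfand A (c \<odot> x) = c \<odot>\<^bsub>?C\<^esub> gelfand A x"
    "\<And>x. x \<in> carrier A \<Longrightarrow> gelfand A (star A x) = star ?C (gelfand A x)"
    by (auto simp: gelfand_def cont_algebra_simps char)
  have minus: "gelfand A (x \<ominus> y) = gelfand A x \<ominus>\<^bsub>?C\<^esub> gelfand A y" if "x \<in> carrier A" "y \<in> carrier A" for x y
    using that by (simp add: minus_eq_sm C.minus_eq_sm hom car)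
  have cont: "continuous_map (topo A) (topo ?C) (gelfand A)"
  proof (rule continuous_map_le_pmax[OF C.Cstar_topological_algebra_axioms car minus])
    fix q assume "q \<in> compact_seminorms ?X"
    then obtain K where K: "compactin ?X K" "q = sup_seminorm K" by blast
    then interpret q: Cstar_seminormed_algebra ?C q
      by unfold_locales (simp add: Cstar_seminorm_sup_seminorm)
    have "Cstar_seminorm A (\<lambda>x. q (gelfand A x))"
      unfolding Cstar_seminorm_def by (simp add: hom car q.p_add q.p_sm q.p_mult_star)
    then show "\<exists>F. finite F \<and> F \<subseteq> P \<and> (\<forall>x \<in> carrier A. q (gelfand A x) \<le> pmax F x)"
      by (rule Cstar_seminorm_continuous)
  qed
  have u: "gelfand A \<in> Kstar_hom A ?C"
    by (rule Kstar_homI) (use car hom cont in \<open>auto simp: gelfand_def\<close>)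
  have "\<exists>x \<in> carrier A. gelfand A x = f" if f: "f \<in> carrier ?C" for f
  proof -
    obtain x where x: "x \<in> carrier A" "\<forall>u \<in> topspace ?X. u x = f u"
      using transform_surjective_continuous[OF cont_algebraD[OF f]] by blast
    have "gelfand A x = f"
      by (rule cont_algebra_eqI[OF car[OF x(1)] f]) (use x in \<open>simp add: gelfand_def\<close>)
    with x show ?thesis by blast
  qed
  then obtain w where w: "\<And>f. f \<in> carrier ?C \<Longrightarrow> w f \<in> carrier A" "\<And>f. f \<in> carrier ?C \<Longrightarrow> gelfand A (w f) = f"
    by metis
  define v where "v = restrict w (carrier ?C)"
  have v: "v f \<in> carrier A" "gelfand A (v f) = f" if "f \<in> carrier ?C" for f
    using w that by (simp_all add: v_def)
  have inj: "x = y" if "x \<in> carrier A" "y \<in> carrier A" "gelfand A x = gelfand A y" for x y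
  proof (rule spectrum_separates[OF that(1,2)])
    show "u x = u y" if "u \<in> topspace ?X" for u
      using fun_cong[OF \<open>gelfand A x = gelfand A y\<close>, of u] \<open>x \<in> carrier A\<close> \<open>y \<in> carrier A\<close> that by (simp add: gelfand_def)
  qed
  have vu: "v (gelfand A x) = x" if "x \<in> carrier A" for x
    using v[OF car[OF that]] that by (intro inj) auto
  show ?thesis
  proof (rule Kstar_isoI[where v = v, OF involutive_algebra_axioms u v(1) v(2) vu])
    have minus_v: "v (f \<ominus>\<^bsub>?C\<^esub> g) = v f \<ominus> v g" if "f \<in> carrier ?C" "g \<in> carrier ?C" for f g
      using that v by (intro inj) (simp_all add: minus)
    show "continuous_map (topo ?C) (topo A) v"
    proof (rule C.continuous_map_le_pmax[OF Cstar_topological_algebra_axioms v(1) minus_v])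
      fix p assume p: "p \<in> P"
      let ?K = "equicont {p}"
      have K: "compactin ?X ?K" using p by (intro compactin_equicont) auto
      have "p (v f) \<le> pmax {sup_seminorm ?K} f" if f: "f \<in> carrier ?C" for f
      proof -
        have "cmod (u (v f)) \<le> sup_seminorm ?K f" if u: "u \<in> ?K" for u
        proof -
          have "f u = u (v f)"
            using v[OF f] u equicont_subset[of "{p}"] p by (metis (no_types, lifting) empty_subsetI finite.emptyI finite_insert gelfand_def insert_subset restrict_apply' subsetD)
          then show ?thesis using le_sup_seminorm[OF K f u] by simp
        qed
        then have "pmax {p} (v f) \<le> sup_seminorm ?K f"
          using p v(1)[OF f] sup_seminorm_nonneg[OF K f] by (intro pmax_le_of_characters) auto
        moreover have "p (v f) \<le> pmax {p} (v f)" "sup_seminorm ?K f \<le> pmax {sup_seminorm ?K} f"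
          by (simp_all add: le_pmax)
        ultimately show ?thesis by linarith
      qed
      then show "\<exists>F. finite F \<and> F \<subseteq> compact_seminorms ?X \<and> (\<forall>f \<in> carrier ?C. p (v f) \<le> pmax F f)"
        using K by (intro exI[of _ "{sup_seminorm ?K}"]) auto
    qed
    show "v \<in> extensional (carrier ?C)" unfolding v_def by (rule restrict_extensional)
  qed
qed

section \<open>Categories\<close>

lemma opposite_simps [simp]:
  "Obj (opposite X) = Obj X" "Hom (opposite X) A B = Hom X B A" "Ident (opposite X) = Ident X"
  "Comp (opposite X) A B C g f = Comp X C B A f g"
  by (simp_all add: opposite_def)

lemma category_opposite: "category X \<Longrightarrow> category (opposite X)"
  by (unfold_locales) (auto intro: category.Ident_in_Hom category.Comp_in_Hom
      simp: category.Comp_Ident_left category.Comp_Ident_right category.Comp_assoc)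

text \<open>Objects \<open>G B\<close> are chosen together with isomorphisms \<open>e B\<close>. A
  morphism is conjugated by these and lifted through the full functor \<open>F\<close>; faithfulness
  transfers each equation from \<open>Y\<close> back to \<open>X\<close>.\<close>

theorem equivalent_categoriesI:
  assumes F: "is_functor X Y F"
    and faithful: "\<And>A B f g. \<lbrakk>A \<in> Obj X; B \<in> Obj X; f \<in> Hom X A B; g \<in> Hom X A B; on_Hom F A B f = on_Hom F A B g\<rbrakk> \<Longrightarrow> f = g"
    and full: "\<And>A B h. \<lbrakk>A \<in> Obj X; B \<in> Obj X; h \<in> Hom Y (on_Obj F A) (on_Obj F B)\<rbrakk> \<Longrightarrow> \<exists>f \<in> Hom X A B. on_Hom F A B f = h"
    and surj: "\<And>B. B \<in> Obj Y \<Longrightarrow> \<exists>A \<in> Obj X. \<exists>e. iso_in Y (on_Obj F A) B e"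
  shows "equivalent_categories X Y"
proof -
  interpret F: is_functor X Y F by fact
  let ?F = "on_Obj F"
  obtain G e where G: "\<And>B. B \<in> Obj Y \<Longrightarrow> G B \<in> Obj X" and e_iso: "\<And>B. B \<in> Obj Y \<Longrightarrow> iso_in Y (?F (G B)) B (e B)"
    using surj by metis
  then obtain e' where e: "\<And>B. B \<in> Obj Y \<Longrightarrow> e B \<in> Hom Y (?F (G B)) B"
    and e': "\<And>B. B \<in> Obj Y \<Longrightarrow> e' B \<in> Hom Y B (?F (G B))"
    and e'e: "\<And>B. B \<in> Obj Y \<Longrightarrow> Comp Y (?F (G B)) B (?F (G B)) (e' B) (e B) = Ident Y (?F (G B))"
    and ee': "\<And>B. B \<in> Obj Y \<Longrightarrow> Comp Y B (?F (G B)) B (e B) (e' B) = Ident Y B"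
    unfolding iso_in_def by metis
  note FObj = F.on_Obj
  obtain L where L: "\<And>A B h. \<lbrakk>A \<in> Obj X; B \<in> Obj X; h \<in> Hom Y (?F A) (?F B)\<rbrakk> \<Longrightarrow> L A B h \<in> Hom X A B"
    and FL: "\<And>A B h. \<lbrakk>A \<in> Obj X; B \<in> Obj X; h \<in> Hom Y (?F A) (?F B)\<rbrakk> \<Longrightarrow> on_Hom F A B (L A B h) = h"
    using full by metis
  define m where "m B C h = Comp Y (?F (G B)) C (?F (G C)) (e' C) (Comp Y (?F (G B)) B C h (e B))" for B C h
  have m: "m B C h \<in> Hom Y (?F (G B)) (?F (G C))" if "B \<in> Obj Y" "C \<in> Obj Y" "h \<in> Hom Y B C" for B C h
    unfolding m_def using that by (meson F.Y.Comp_in_Hom FObj G e e')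
  define H where "H = \<lparr>on_Obj = G, on_Hom = (\<lambda>B C h. L (G B) (G C) (m B C h))\<rparr>"
  have HO: "on_Obj H = G" and HH: "\<And>B C h. on_Hom H B C h = L (G B) (G C) (m B C h)" by (simp_all add: H_def)
  have FH: "on_Hom F (G B) (G C) (on_Hom H B C h) = m B C h" if "B \<in> Obj Y" "C \<in> Obj Y" "h \<in> Hom Y B C" for B C h
    unfolding HH using that by (intro FL G m)
  \<comment> \<open>This square is the naturality of \<open>e\<close>.\<close>
  have e_m: "Comp Y (?F (G B)) (?F (G C)) C (e C) (m B C h) = Comp Y (?F (G B)) B C h (e B)"
    if B: "B \<in> Obj Y" and C: "C \<in> Obj Y" and h: "h \<in> Hom Y B C" for B C h
  proof -
    have he: "Comp Y (?F (G B)) B C h (e B) \<in> Hom Y (?F (G B)) C"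
      using B C h by (meson F.Y.Comp_in_Hom FObj G e)
    have "Comp Y (?F (G B)) (?F (G C)) C (e C) (m B C h)
        = Comp Y (?F (G B)) C C (Comp Y C (?F (G C)) C (e C) (e' C)) (Comp Y (?F (G B)) B C h (e B))"
      unfolding m_def by (rule F.Y.Comp_assoc[OF FObj[OF G[OF B]] C FObj[OF G[OF C]] C he e'[OF C] e[OF C]])
    then show ?thesis by (simp add: ee'[OF C] F.Y.Comp_Ident_left[OF FObj[OF G[OF B]] C he])
  qed
  \<comment> \<open>Left cancellation of \<open>e C\<close>, so that functoriality of
    \<open>m\<close> can be checked after composing with \<open>e\<close>.\<close>
  have mono_e: "f = g" if C: "C \<in> Obj Y" and D: "D \<in> Obj Y" and f: "f \<in> Hom Y D (?F (G C))" and g: "g \<in> Hom Y D (?F (G C))"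
    and eq: "Comp Y D (?F (G C)) C (e C) f = Comp Y D (?F (G C)) C (e C) g" for C D f g
  proof -
    have "Comp Y D C (?F (G C)) (e' C) (Comp Y D (?F (G C)) C (e C) k) = k" if k: "k \<in> Hom Y D (?F (G C))" for k
      using F.Y.Comp_assoc[OF D FObj[OF G[OF C]] C FObj[OF G[OF C]] k e[OF C] e'[OF C]]
      by (simp add: e'e[OF C] F.Y.Comp_Ident_left[OF D FObj[OF G[OF C]] k])
    then show ?thesis using f g eq by metis
  qed
  have "is_functor Y X H"
  proof unfold_locales
    show "on_Obj H B \<in> Obj X" if "B \<in> Obj Y" for B using that by (simp add: HO G)
    show "on_Hom H B C h \<in> Hom X (on_Obj H B) (on_Obj H C)" if "B \<in> Obj Y" "C \<in> Obj Y" "h \<in> Hom Y B C" for B C h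
      unfolding HO HH using that by (intro L G m)
    show "on_Hom H B B (Ident Y B) = Ident X (on_Obj H B)" if B: "B \<in> Obj Y" for B
    proof -
      note I = F.Y.Ident_in_Hom[OF B]
      have "m B B (Ident Y B) = Ident Y (?F (G B))"
        unfolding m_def by (simp add: F.Y.Comp_Ident_left[OF FObj[OF G[OF B]] B e[OF B]] e'e[OF B])
      then have "on_Hom F (G B) (G B) (on_Hom H B B (Ident Y B)) = on_Hom F (G B) (G B) (Ident X (G B))"
        using F.on_Ident[OF G[OF B]] FH[OF B B I] by simp
      then show ?thesis
        unfolding HO by (rule faithful[OF G[OF B] G[OF B], rotated 2])
          (use B I in \<open>simp_all add: HH L G m F.X.Ident_in_Hom\<close>)
    qed
    show "on_Hom H B D (Comp Y B C D k h) = Comp X (on_Obj H B) (on_Obj H C) (on_Obj H D) (on_Hom H C D k) (on_Hom H B C h)"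
      if B: "B \<in> Obj Y" and C: "C \<in> Obj Y" and D: "D \<in> Obj Y" and h: "h \<in> Hom Y B C" and k: "k \<in> Hom Y C D" for B C D h k
    proof -
      note FGB = FObj[OF G[OF B]] and FGC = FObj[OF G[OF C]] and FGD = FObj[OF G[OF D]]
      note kh = F.Y.Comp_in_Hom[OF B C D h k] and mh = m[OF B C h] and mk = m[OF C D k]
      have Hh: "on_Hom H B C h \<in> Hom X (G B) (G C)" and Hk: "on_Hom H C D k \<in> Hom X (G C) (G D)"
        unfolding HH using B C D h k by (auto intro: L G m)
      have "Comp Y (?F (G B)) (?F (G D)) D (e D) (Comp Y (?F (G B)) (?F (G C)) (?F (G D)) (m C D k) (m B C h))
          = Comp Y (?F (G B)) (?F (G C)) D (Comp Y (?F (G C)) (?F (G D)) D (e D) (m C D k)) (m B C h)"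
        by (rule F.Y.Comp_assoc[OF FGB FGC FGD D mh mk e[OF D]])
      also have "\<dots> = Comp Y (?F (G B)) (?F (G C)) D (Comp Y (?F (G C)) C D k (e C)) (m B C h)"
        by (simp add: e_m[OF C D k])
      also have "\<dots> = Comp Y (?F (G B)) C D k (Comp Y (?F (G B)) (?F (G C)) C (e C) (m B C h))"
        by (rule F.Y.Comp_assoc[OF FGB FGC C D mh e[OF C] k, symmetric])
      also have "\<dots> = Comp Y (?F (G B)) C D k (Comp Y (?F (G B)) B C h (e B))"
        by (simp add: e_m[OF B C h])
      also have "\<dots> = Comp Y (?F (G B)) B D (Comp Y B C D k h) (e B)"
        by (rule F.Y.Comp_assoc[OF FGB B C D e[OF B] h k])
      also have "\<dots> = Comp Y (?F (G B)) (?F (G D)) D (e D) (m B D (Comp Y B C D k h))"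
        by (simp add: e_m[OF B D kh])
      finally have "m B D (Comp Y B C D k h) = Comp Y (?F (G B)) (?F (G C)) (?F (G D)) (m C D k) (m B C h)"
        by (intro mono_e[OF D FGB m[OF B D kh] F.Y.Comp_in_Hom[OF FGB FGC FGD mh mk]]) simp
      then have "on_Hom F (G B) (G D) (on_Hom H B D (Comp Y B C D k h))
          = on_Hom F (G B) (G D) (Comp X (G B) (G C) (G D) (on_Hom H C D k) (on_Hom H B C h))"
        by (simp add: FH[OF B D kh] F.on_Comp[OF G[OF B] G[OF C] G[OF D] Hh Hk] FH[OF B C h] FH[OF C D k])
      then show ?thesis
        unfolding HO
        by (rule faithful[OF G[OF B] G[OF D] _ F.X.Comp_in_Hom[OF G[OF B] G[OF C] G[OF D] Hh Hk], rotated])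
          (unfold HH, intro L G m B D kh)
    qed
  qed
  moreover have "naturally_isomorphic Y Y (comp_functor F H) id_functor"
    unfolding naturally_isomorphic_def
  proof (intro exI[of _ e] conjI ballI)
    fix B assume B: "B \<in> Obj Y"
    show "iso_in Y (on_Obj (comp_functor F H) B) (on_Obj id_functor B) (e B)"
      using e_iso[OF B] by (simp add: comp_functor_def id_functor_def HO)
    fix C h assume C: "C \<in> Obj Y" and h: "h \<in> Hom Y B C"
    show "Comp Y (on_Obj (comp_functor F H) B) (on_Obj (comp_functor F H) C) (on_Obj id_functor C) (e C) (on_Hom (comp_functor F H) B C h)
        = Comp Y (on_Obj (comp_functor F H) B) (on_Obj id_functor B) (on_Obj id_functor C) (on_Hom id_functor B C h) (e B)"
      using e_m[OF B C h] FH[OF B C h] by (simp add: comp_functor_def id_functor_def HO)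
  qed
  moreover have "naturally_isomorphic X X (comp_functor H F) id_functor"
    unfolding naturally_isomorphic_def
  \<comment> \<open>The component at \<open>A\<close> is the lift through \<open>F\<close> of
    \<open>e (?F A)\<close>; the lift of \<open>e' (?F A)\<close> is its inverse.\<close>
  proof (intro exI[of _ "\<lambda>A. L (G (?F A)) A (e (?F A))"] conjI ballI)
    fix A assume A: "A \<in> Obj X"
    note FA = FObj[OF A]
    note GFA = G[OF FA]
    let ?a = "L (G (?F A)) A (e (?F A))" and ?b = "L A (G (?F A)) (e' (?F A))"
    have a: "?a \<in> Hom X (G (?F A)) A" and Fa: "on_Hom F (G (?F A)) A ?a = e (?F A)"
      by (rule L[OF GFA A e[OF FA]], rule FL[OF GFA A e[OF FA]])
    have b: "?b \<in> Hom X A (G (?F A))" and Fb: "on_Hom F A (G (?F A)) ?b = e' (?F A)"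
      by (rule L[OF A GFA e'[OF FA]], rule FL[OF A GFA e'[OF FA]])
    have "Comp X (G (?F A)) A (G (?F A)) ?b ?a = Ident X (G (?F A))"
      by (rule faithful[OF GFA GFA F.X.Comp_in_Hom[OF GFA A GFA a b] F.X.Ident_in_Hom[OF GFA]])
        (simp add: F.on_Comp[OF GFA A GFA a b] Fa Fb F.on_Ident[OF GFA] e'e[OF FA])
    moreover have "Comp X A (G (?F A)) A ?a ?b = Ident X A"
      by (rule faithful[OF A A F.X.Comp_in_Hom[OF A GFA A b a] F.X.Ident_in_Hom[OF A]])
        (simp add: F.on_Comp[OF A GFA A b a] Fa Fb F.on_Ident[OF A] ee'[OF FA])
    ultimately show "iso_in X (on_Obj (comp_functor H F) A) (on_Obj id_functor A) ?a"
      unfolding iso_in_def using a b by (auto simp: comp_functor_def id_functor_def HO)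
    fix B f assume B: "B \<in> Obj X" and f: "f \<in> Hom X A B"
    note FB = FObj[OF B] and Ff = F.on_Hom[OF A B f]
    note GFB = G[OF FB]
    let ?c = "L (G (?F B)) B (e (?F B))" and ?k = "on_Hom H (?F A) (?F B) (on_Hom F A B f)"
    have c: "?c \<in> Hom X (G (?F B)) B" and Fc: "on_Hom F (G (?F B)) B ?c = e (?F B)"
      by (rule L[OF GFB B e[OF FB]], rule FL[OF GFB B e[OF FB]])
    have k: "?k \<in> Hom X (G (?F A)) (G (?F B))"
      unfolding HH by (rule L[OF GFA GFB m[OF FA FB Ff]])
    have "Comp X (G (?F A)) (G (?F B)) B ?c ?k = Comp X (G (?F A)) A B f ?a"
      by (rule faithful[OF GFA B F.X.Comp_in_Hom[OF GFA GFB B k c] F.X.Comp_in_Hom[OF GFA A B a f]])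
        (simp add: F.on_Comp[OF GFA GFB B k c] F.on_Comp[OF GFA A B a f] Fa Fc FH[OF FA FB Ff] e_m[OF FA FB Ff])
    then show "Comp X (on_Obj (comp_functor H F) A) (on_Obj (comp_functor H F) B) (on_Obj id_functor B) ?c (on_Hom (comp_functor H F) A B f)
        = Comp X (on_Obj (comp_functor H F) A) (on_Obj id_functor A) (on_Obj id_functor B) (on_Hom id_functor A B f) ?a"
      by (simp add: comp_functor_def id_functor_def HO)
  qed
  ultimately show ?thesis
    unfolding equivalent_categories_def using F by blast
qed

section \<open>Small copies of spaces and algebras\<close>

lemma homeomorphic_kC_space:
  assumes T: "kC_space T" and "T homeomorphic_space S"
  shows "kC_space S"
proof -
  obtain f g where fg: "homeomorphic_maps T S f g" using assms(2) by (auto simp: homeomorphic_space_def)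
  have f: "continuous_map T S f" and g: "continuous_map S T g" and "\<And>s. s \<in> topspace S \<Longrightarrow> f (g s) = s"
    using fg by (auto simp: homeomorphic_maps_def)
  have "Tychonoff_space S"
    using T assms(2) homeomorphic_completely_regular_space homeomorphic_Hausdorff_space
    unfolding kC_space_def Tychonoff_space_def by blast
  moreover have "continuous_map S euclidean h"
    if h: "\<And>K. compactin S K \<Longrightarrow> continuous_map (subtopology S K) euclidean h" for h :: "_ \<Rightarrow> complex"
  proof -
    have "continuous_map (subtopology T K) euclidean (h \<circ> f)" if K: "compactin T K" for K
    proof (rule continuous_map_compose[OF _ h[OF image_compactin[OF K f]]])
      show "continuous_map (subtopology T K) (subtopology S (f ` K)) f"
        using f by (auto simp: continuous_map_in_subtopology continuous_map_from_subtopology)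
    qed
    then have "continuous_map T euclidean (h \<circ> f)" using T unfolding kC_space_def by blast
    from continuous_map_compose[OF g this] show ?thesis
      by (rule continuous_map_eq) (simp add: \<open>\<And>s. s \<in> topspace S \<Longrightarrow> f (g s) = s\<close>)
  qed
  ultimately show ?thesis unfolding kC_space_def by blast
qed

lemma homeomorphic_realcompact_space:
  assumes T: "realcompact_space T" and "T homeomorphic_space S"
  shows "realcompact_space S"
proof -
  obtain f g where fg: "homeomorphic_maps T S f g" using assms(2) by (auto simp: homeomorphic_space_def)
  have f: "continuous_map T S f" and g: "continuous_map S T g" and f_g: "\<And>s. s \<in> topspace S \<Longrightarrow> f (g s) = s"
    using fg by (auto simp: homeomorphic_maps_def)
  have gS: "g s \<in> topspace T" if "s \<in> topspace S" for s using g that by (auto simp: continuous_map_def)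
  have fT: "f t \<in> topspace S" if "t \<in> topspace T" for t using f that by (auto simp: continuous_map_def)
  have "Tychonoff_space S"
    using T assms(2) homeomorphic_completely_regular_space homeomorphic_Hausdorff_space
    unfolding realcompact_space_def Tychonoff_space_def by blast
  moreover have "\<exists>s \<in> topspace S. \<forall>k \<in> real_continuous_functions S. h k = k s" if h: "real_character S h" for h
  proof -
    let ?g = "\<lambda>k. \<lambda>s \<in> topspace S. k (g s)" and ?f = "\<lambda>k. \<lambda>t \<in> topspace T. k (f t)"
    have gk: "?g k \<in> real_continuous_functions S" if "k \<in> real_continuous_functions T" for k
      using that continuous_map_compose[OF g, of euclidean k]
      by (auto simp: real_continuous_functions_def o_def intro: continuous_map_eq)
    have fk: "?f k \<in> real_continuous_functions T" if "k \<in> real_continuous_functions S" for k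
      using that continuous_map_compose[OF f, of euclidean k]
      by (auto simp: real_continuous_functions_def o_def intro: continuous_map_eq)
    \<comment> \<open>A character for \<open>S\<close> is moved to \<open>T\<close> by pulling
      functions back along \<open>g\<close>.\<close>
    have "real_character T (\<lambda>k. h (?g k))"
      unfolding real_character_def
    proof (intro conjI ballI allI)
      fix k l assume kl: "k \<in> real_continuous_functions T" "l \<in> real_continuous_functions T"
      have "?g (\<lambda>t \<in> topspace T. k t + l t) = (\<lambda>s \<in> topspace S. ?g k s + ?g l s)"
        "?g (\<lambda>t \<in> topspace T. k t * l t) = (\<lambda>s \<in> topspace S. ?g k s * ?g l s)"
        using gS by auto
      then show "h (?g (\<lambda>t \<in> topspace T. k t + l t)) = h (?g k) + h (?g l)"
        "h (?g (\<lambda>t \<in> topspace T. k t * l t)) = h (?g k) * h (?g l)"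
        using h[unfolded real_character_def, THEN conjunct1, rule_format, OF gk[OF kl(1)] gk[OF kl(2)]] by simp_all
    next
      fix c k assume k: "k \<in> real_continuous_functions T"
      have "?g (\<lambda>t \<in> topspace T. c * k t) = (\<lambda>s \<in> topspace S. c * ?g k s)" using gS by auto
      then show "h (?g (\<lambda>t \<in> topspace T. c * k t)) = c * h (?g k)"
        using h[unfolded real_character_def, THEN conjunct2, THEN conjunct1, rule_format, OF gk[OF k]] by simp
    next
      have "?g (\<lambda>t \<in> topspace T. 1) = (\<lambda>s \<in> topspace S. 1 :: real)" using gS by auto
      moreover have "h (\<lambda>s \<in> topspace S. 1) = 1" using h by (simp add: real_character_def)
      ultimately show "h (?g (\<lambda>t \<in> topspace T. 1)) = 1" by (simp only:)
    qed
    then obtain t where t: "t \<in> topspace T" "\<And>k. k \<in> real_continuous_functions T \<Longrightarrow> h (?g k) = k t"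
      using T unfolding realcompact_space_def by blast
    have "h k = k (f t)" if k: "k \<in> real_continuous_functions S" for k
    proof -
      have "?g (?f k) = k"
        using k gS f_g unfolding real_continuous_functions_def
        by (intro extensionalityI[of _ "topspace S"]) auto
      then show ?thesis using t(2)[OF fk[OF k]] t(1) by simp
    qed
    then show ?thesis using fT[OF t(1)] by blast
  qed
  ultimately show ?thesis unfolding realcompact_space_def by blast
qed

section \<open>Transport along an injection\<close>

text \<open>The topology is pulled back along the inverse of \<open>j\<close>.\<close>

lemma homeomorphic_copy:
  assumes j: "inj_on j (topspace T)"
  shows "\<exists>S. topspace S = j ` topspace T \<and> homeomorphic_map T S j"
proof -
  let ?k = "inv_into (topspace T) j"
  let ?S = "pullback_topology (j ` topspace T) ?k T"
  have k: "?k (j t) = t" if "t \<in> topspace T" for t using j that by simp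
  have top: "topspace ?S = j ` topspace T"
    using k by (auto simp: topspace_pullback_topology)
  have "continuous_map ?S T ?k"
    using continuous_map_pullback[of T T id "j ` topspace T" ?k] by simp
  moreover have "continuous_map T ?S j"
  proof (rule continuous_map_pullback')
    have "continuous_map T T (\<lambda>t. t)" by simp
    then show "continuous_map T T (?k \<circ> j)" by (rule continuous_map_eq) (simp add: k)
  qed (auto simp: k)
  ultimately have "homeomorphic_maps T ?S j ?k"
    unfolding homeomorphic_maps_def using k by (auto simp: top)
  then show ?thesis using top homeomorphic_maps_map by blast
qed

text \<open>Built in two stages, since the topology refers to the subtraction of the copy;
  \<open>undefined\<close> is a placeholder. The inverse \<open>k\<close> is meaningful only on the
  image of the carrier.\<close>

definition copy_algebra ::
    "('a, 'm) top_star_algebra_scheme \<Rightarrow> ('a \<Rightarrow> real) set \<Rightarrow> ('a \<Rightarrow> 'b) \<Rightarrow> 'b top_star_algebra" where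
  "copy_algebra A P j = (let k = inv_into (carrier A) j;
     B = \<lparr>carrier = j ` carrier A, monoid.mult = (\<lambda>x y. j (k x \<otimes>\<^bsub>A\<^esub> k y)), one = j \<one>\<^bsub>A\<^esub>, zero = j \<zero>\<^bsub>A\<^esub>,
       add = (\<lambda>x y. j (k x \<oplus>\<^bsub>A\<^esub> k y)), smult = (\<lambda>c x. j (c \<odot>\<^bsub>A\<^esub> k x)), star = (\<lambda>x. j (star A (k x))),
       topo = undefined\<rparr>
     in B\<lparr>topo := seminorm_topology B ((\<lambda>p y. p (k y)) ` P)\<rparr>)"

context bornological_Kstar_algebra
begin

context
  fixes j :: "'a \<Rightarrow> 'c" assumes j: "inj_on j (carrier A)"
begin

private abbreviation k where "k \<equiv> inv_into (carrier A) j"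
private abbreviation B where "B \<equiv> copy_algebra A P j"
private abbreviation Q where "Q \<equiv> (\<lambda>p y. p (k y)) ` P"

lemma copy_algebra_simps:
  "carrier B = j ` carrier A" "x \<otimes>\<^bsub>B\<^esub> y = j (k x \<otimes> k y)" "\<one>\<^bsub>B\<^esub> = j \<one>" "\<zero>\<^bsub>B\<^esub> = j \<zero>"
  "x \<oplus>\<^bsub>B\<^esub> y = j (k x \<oplus> k y)" "c \<odot>\<^bsub>B\<^esub> x = j (c \<odot> k x)" "star B x = j (star A (k x))"
  by (simp_all add: copy_algebra_def Let_def)

lemma topo_copy_algebra: "topo B = seminorm_topology B Q"
  by (simp add: copy_algebra_def Let_def seminorm_topology_def a_minus_def a_inv_def m_inv_def)

private lemma kj [simp]: "x \<in> carrier A \<Longrightarrow> k (j x) = x"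
  using j by simp

private lemma k_closed: "y \<in> carrier B \<Longrightarrow> k y \<in> carrier A"
  by (auto simp: copy_algebra_simps)

private lemma jk: "y \<in> carrier B \<Longrightarrow> j (k y) = y"
  by (auto simp: copy_algebra_simps)

lemma involutive_copy_algebra: "involutive_algebra B"
proof (rule involutive_algebraI, goal_cases)
  case (6 x)
  then show ?case
    by (intro bexI[of _ "j (\<ominus> k x)"]) (auto simp: copy_algebra_simps l_neg)
next
  case (11 x y)
  then show ?case by (auto simp: copy_algebra_simps m_comm)
qed (auto simp: copy_algebra_simps a_ac m_assoc l_distr sm_add_left sm_add_right sm_sm sm_mult_left
    star_add star_smult star_star star_mult)

lemma Cstar_topological_copy_algebra: "Cstar_topological_algebra B Q"
proof -
  interpret B: involutive_algebra B by (rule involutive_copy_algebra)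
  show ?thesis
  proof unfold_locales
    fix q assume "q \<in> Q"
    then obtain p where p: "p \<in> P" "q = (\<lambda>y. p (k y))" by blast
    interpret p: Cstar_seminormed_algebra A p by (rule P_seminorm[OF p(1)])
    show "Cstar_seminorm B q"
      unfolding Cstar_seminorm_def p(2)
      by (auto simp: copy_algebra_simps p.p_add p.p_sm p.p_mult_star)
  qed (rule topo_copy_algebra)
qed

interpretation B: Cstar_topological_algebra B Q by (rule Cstar_topological_copy_algebra)

lemma minus_copy_algebra: "\<lbrakk>x \<in> carrier B; y \<in> carrier B\<rbrakk> \<Longrightarrow> x \<ominus>\<^bsub>B\<^esub> y = j (k x \<ominus> k y)"
  by (auto simp: B.minus_eq_sm) (auto simp: copy_algebra_simps minus_eq_sm)

private lemma k_minus: "\<lbrakk>x \<in> carrier B; y \<in> carrier B\<rbrakk> \<Longrightarrow> k (x \<ominus>\<^bsub>B\<^esub> y) = k x \<ominus> k y"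
  by (simp add: minus_copy_algebra k_closed)

private lemma pmax_Q: "pmax ((\<lambda>p y. p (k y)) ` F) y = pmax F (k y)"
  by (simp add: pmax_def image_image)

private lemma Q_cases:
  assumes "finite G" "G \<subseteq> Q"
  obtains F where "finite F" "F \<subseteq> P" "G = (\<lambda>p y. p (k y)) ` F"
  using finite_subset_image[OF assms] by metis

lemma Kstar_iso_copy_algebra: "Kstar_iso A B (restrict j (carrier A))"
proof (rule Kstar_isoI[where v = "restrict k (carrier B)", OF involutive_algebra_axioms])
  have "continuous_map (topo A) (topo B) (restrict j (carrier A))"
  proof (rule continuous_map_le_pmax[OF B.Cstar_topological_algebra_axioms])
    fix q assume "q \<in> Q"
    then obtain p where p: "p \<in> P" "q = (\<lambda>y. p (k y))" by blast
    then show "\<exists>F. finite F \<and> F \<subseteq> P \<and> (\<forall>x \<in> carrier A. q (restrict j (carrier A) x) \<le> pmax F x)"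
      by (intro exI[of _ "{p}"]) (simp add: le_pmax)
  qed (simp_all add: minus_copy_algebra copy_algebra_simps(1))
  then show "restrict j (carrier A) \<in> Kstar_hom A B"
    by (intro Kstar_homI) (simp_all add: copy_algebra_simps)
  show "continuous_map (topo B) (topo A) (restrict k (carrier B))"
  proof (rule B.continuous_map_le_pmax[OF Cstar_topological_algebra_axioms])
    fix p assume p: "p \<in> P"
    then show "\<exists>F. finite F \<and> F \<subseteq> Q \<and> (\<forall>y \<in> carrier B. p (restrict k (carrier B) y) \<le> pmax F y)"
      by (intro exI[of _ "{\<lambda>y. p (k y)}"]) (auto intro: le_pmax[where p = "\<lambda>y. p (k y)"])
  qed (simp_all add: k_closed k_minus)
qed (simp_all add: k_closed jk, simp add: copy_algebra_simps)

lemma Hausdorff_copy_algebra: "Hausdorff_space (topo B)"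
  unfolding B.Hausdorff_iff
proof (intro ballI impI)
  fix y assume y: "y \<in> carrier B" and "\<forall>q \<in> Q. q y = 0"
  then have "\<forall>p \<in> P. p (k y) = 0" by simp
  then have "k y = \<zero>" using Hausdorff k_closed[OF y] unfolding Hausdorff_iff by blast
  then show "y = \<zero>\<^bsub>B\<^esub>" using jk[OF y] by (simp add: copy_algebra_simps)
qed

lemma complete_copy_algebra: "complete_algebra B"
  unfolding complete_algebra_def
proof (intro allI impI)
  fix \<F> assume cauchy: "Cauchy_filter B \<F>"
  have "Cauchy_filter A (filtermap k \<F>)"
    unfolding Cauchy_filter_iff
  proof (intro conjI allI impI)
    show "filtermap k \<F> \<noteq> bot" using cauchy by (simp add: Cauchy_filter_def filtermap_bot_iff)
    fix F e assume F: "finite F" "F \<subseteq> P" and e: "(e::real) > 0"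
    then obtain S where S: "S \<subseteq> carrier B" "\<forall>\<^sub>F y in \<F>. y \<in> S"
      "\<forall>x \<in> S. \<forall>y \<in> S. pmax ((\<lambda>p y. p (k y)) ` F) (x \<ominus>\<^bsub>B\<^esub> y) < e"
      using cauchy[unfolded B.Cauchy_filter_iff, THEN conjunct2, rule_format, of "(\<lambda>p y. p (k y)) ` F" e] by blast
    have "pmax F (k x \<ominus> k y) < e" if "x \<in> S" "y \<in> S" for x y
      using S(1,3) that k_closed by (auto simp: pmax_Q minus_copy_algebra subset_iff)
    then show "\<exists>S \<subseteq> carrier A. (\<forall>\<^sub>F x in filtermap k \<F>. x \<in> S) \<and> (\<forall>x \<in> S. \<forall>y \<in> S. pmax F (x \<ominus> y) < e)"
      using S(1,2) k_closed by (intro exI[of _ "k ` S"]) (auto simp: eventually_filtermap elim: eventually_mono)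
  qed
  then obtain l where "limitin (topo A) (\<lambda>x. x) l (filtermap k \<F>)"
    using complete unfolding complete_algebra_def by blast
  then have l: "l \<in> carrier A" and lim: "\<And>F e. \<lbrakk>finite F; F \<subseteq> P; 0 < e\<rbrakk> \<Longrightarrow> \<forall>\<^sub>F y in \<F>. k y \<in> carrier A \<and> pmax F (k y \<ominus> l) < e"
    unfolding limitin_topo eventually_filtermap by blast+
  \<comment> \<open>\<open>k\<close> says nothing outside the carrier of the copy; the Cauchy
    condition for the empty family shows that the filter lives on that carrier.\<close>
  obtain S where S: "S \<subseteq> carrier B" "\<forall>\<^sub>F y in \<F>. y \<in> S"
    using cauchy[unfolded B.Cauchy_filter_iff, THEN conjunct2, rule_format, of "{}" 1] by auto
  have "limitin (topo B) (\<lambda>y. y) (j l) \<F>"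
    unfolding B.limitin_topo
  proof (intro conjI allI impI)
    show "j l \<in> carrier B" using l by (simp add: copy_algebra_simps)
    fix G e assume G: "finite G" "G \<subseteq> Q" and e: "(e::real) > 0"
    obtain F where F: "finite F" "F \<subseteq> P" "G = (\<lambda>p y. p (k y)) ` F" by (rule Q_cases[OF G])
    show "\<forall>\<^sub>F y in \<F>. y \<in> carrier B \<and> pmax G (y \<ominus>\<^bsub>B\<^esub> j l) < e"
      using lim[OF F(1,2) e] S(2)
    proof eventually_elim
      case (elim y)
      then have "y \<in> carrier B" using S(1) by blast
      then show ?case using elim l \<open>j l \<in> carrier B\<close> by (simp add: F(3) pmax_Q minus_copy_algebra)
    qed
  qed
  then show "\<exists>l. limitin (topo B) (\<lambda>y. y) l \<F>" by blast
qed

lemma bornological_copy_algebra: "bornological B"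
  unfolding bornological_def
proof (intro allI impI)
  fix V assume V: "absolutely_convex B V \<and> (\<forall>C. bounded_subset B C \<longrightarrow> absorbs B V C)"
  then have VB: "V \<subseteq> carrier B" by (simp add: absolutely_convex_def)
  let ?W = "{x \<in> carrier A. j x \<in> V}"
  have "absolutely_convex A ?W"
    unfolding absolutely_convex_def
  proof (intro conjI ballI allI impI)
    fix x y a b assume xy: "x \<in> ?W" "y \<in> ?W" and ab: "cmod a + cmod b \<le> 1"
    have "a \<odot>\<^bsub>B\<^esub> j x \<oplus>\<^bsub>B\<^esub> b \<odot>\<^bsub>B\<^esub> j y \<in> V" using V xy ab unfolding absolutely_convex_def by blast
    then show "a \<odot> x \<oplus> b \<odot> y \<in> ?W" using xy by (simp add: copy_algebra_simps)
  qed auto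
  moreover have "absorbs A ?W C" if C: "bounded_subset A C" for C
  proof -
    have CA: "C \<subseteq> carrier A" using C by (simp add: bounded_subset_iff)
    have "bounded_subset B (j ` C)"
      unfolding B.bounded_subset_iff
    proof (intro conjI ballI)
      show "j ` C \<subseteq> carrier B" using CA by (auto simp: copy_algebra_simps)
      fix q assume "q \<in> Q"
      then obtain p where p: "p \<in> P" "q = (\<lambda>y. p (k y))" by blast
      then obtain M where "\<forall>x \<in> C. p x \<le> M" using C unfolding bounded_subset_iff by blast
      then show "\<exists>M. \<forall>y \<in> j ` C. q y \<le> M" using CA by (intro exI[of _ M]) (auto simp: p(2) subset_iff)
    qed
    then obtain r where r: "r > 0" "\<And>c. r \<le> cmod c \<Longrightarrow> j ` C \<subseteq> (\<lambda>v. c \<odot>\<^bsub>B\<^esub> v) ` V"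
      using V unfolding absorbs_def by blast
    have "C \<subseteq> (\<lambda>v. c \<odot> v) ` ?W" if c: "r \<le> cmod c" for c
    proof
      fix x assume x: "x \<in> C"
      then obtain v where v: "v \<in> V" "j x = c \<odot>\<^bsub>B\<^esub> v" using r(2)[OF c] by blast
      have kv: "k v \<in> carrier A" "j (k v) = v" using v(1) VB k_closed jk by blast+
      have "j x = j (c \<odot> k v)" using v(2) by (simp add: copy_algebra_simps)
      then have "x = c \<odot> k v" using j x CA kv(1) by (auto dest!: inj_onD)
      then show "x \<in> (\<lambda>v. c \<odot> v) ` ?W" using kv v(1) by auto
    qed
    then show ?thesis using r(1) unfolding absorbs_def by blast
  qed
  ultimately obtain U where U: "openin (topo A) U" "\<zero> \<in> U" "U \<subseteq> ?W"
    using bornological unfolding bornological_def by blast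
  obtain F e where F: "finite F" "F \<subseteq> P" "0 < e" "{x \<in> carrier A. pmax F x < e} \<subseteq> U"
    by (rule zero_nbhd[OF U(1,2)])
  let ?G = "(\<lambda>p y. p (k y)) ` F"
  have G: "finite ?G" "?G \<subseteq> Q" using F by auto
  have "{y \<in> carrier B. pmax ?G y < e} \<subseteq> V"
  proof
    fix y assume y: "y \<in> {y \<in> carrier B. pmax ?G y < e}"
    then have "k y \<in> U" using k_closed by (intro subsetD[OF F(4)]) (simp add: pmax_Q)
    then show "y \<in> V" using U(3) jk y by auto
  qed
  moreover have "\<zero>\<^bsub>B\<^esub> \<in> {y \<in> carrier B. pmax ?G y < e}"
    using B.zero_in_ball[OF G F(3) B.zero_closed] by simp
  ultimately show "\<exists>U. openin (topo B) U \<and> \<zero>\<^bsub>B\<^esub> \<in> U \<and> U \<subseteq> V"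
    using B.openin_zero_ball[OF G] by blast
qed

lemma Kstar_copy_algebra: "Kstar_algebra B"
  unfolding Kstar_algebra_def
  using involutive_copy_algebra Hausdorff_copy_algebra complete_copy_algebra B.Cstar_seminorms topo_copy_algebra by blast

end

end

section \<open>Cardinal estimates\<close>

lemma Pow_lepoll_mono: "X \<lesssim> Y \<Longrightarrow> Pow X \<lesssim> Pow Y"
  unfolding lepoll_def by (metis image_Pow_mono inj_on_image_Pow)

lemma lepoll_total: "X \<lesssim> Y \<or> Y \<lesssim> X"
  using ordLeq_total[OF card_of_Well_order card_of_Well_order, of X Y]
  unfolding lepoll_def card_of_ordLeq[symmetric] .

lemma infinite_times_lepoll: "infinite Z \<Longrightarrow> Z \<times> Z \<lesssim> Z"
  using card_of_Times_same_infinite[of Z] eqpoll_iff_card_of_ordIso eqpoll_imp_lepoll by blast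

text \<open>A complex number is coded by the Dedekind cuts of its real and imaginary parts, a subset
  of the countable type \<open>rat + rat\<close>.\<close>

lemma complex_lepoll_Pow: "infinite Z \<Longrightarrow> (UNIV :: complex set) \<lesssim> Pow Z"
proof -
  assume Z: "infinite Z"
  let ?f = "\<lambda>z. {Inl q |q. of_rat q < Re z} \<union> {Inr q |q. of_rat q < Im z} :: (rat + rat) set"
  have cut: "x = y" if "\<And>q. (of_rat q < x) = (of_rat q < y)" for x y :: real
  proof (rule ccontr)
    assume "x \<noteq> y"
    then have "\<exists>q. (of_rat q < x) \<noteq> (of_rat q < y)"
      using of_rat_dense[of x y] of_rat_dense[of y x] by (metis less_asym linorder_neqE)
    then show False using that by blast
  qed
  have "inj ?f"
  proof (rule injI)
    fix z w assume eq: "?f z = ?f w"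
    have "of_rat q < Re z \<longleftrightarrow> of_rat q < Re w" "of_rat q < Im z \<longleftrightarrow> of_rat q < Im w" for q
      using set_eq_iff[THEN iffD1, OF eq, rule_format, of "Inl q"] set_eq_iff[THEN iffD1, OF eq, rule_format, of "Inr q"] by auto
    then show "z = w" by (intro complex_eqI cut)
  qed
  then have "(UNIV :: complex set) \<lesssim> Pow (UNIV :: (rat + rat) set)"
    unfolding lepoll_def by blast
  also have "Pow (UNIV :: (rat + rat) set) \<lesssim> Pow (UNIV :: nat set)"
    by (rule Pow_lepoll_mono) (auto simp: lepoll_def intro!: exI[of _ to_nat])
  also have "Pow (UNIV :: nat set) \<lesssim> Pow Z"
    by (rule Pow_lepoll_mono[OF infinite_le_lepoll[THEN iffD1, OF Z]])
  finally show ?thesis .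
qed

text \<open>Serves for spectra and for function algebras alike: both consist of extensional complex
  functions on a small set. Graphs embed them into a power set which two applications of
  \<open>Pow\<close> to an infinite small set dominate.\<close>

lemma universe_functions:
  fixes X :: "'u set" and \<Phi> :: "('u \<Rightarrow> complex) set"
  assumes U: "universe \<U>" and X: "X \<in> \<U>" and \<Phi>: "\<Phi> \<subseteq> extensional X"
  shows "\<exists>j :: ('u \<Rightarrow> complex) \<Rightarrow> 'u. inj_on j \<Phi> \<and> j ` \<Phi> \<in> \<U>"
proof -
  \<comment> \<open>\<open>X\<close> may be finite; comparing it with an infinite member of the
    universe yields an infinite small set at least as large.\<close>
  obtain Z where Z: "Z \<in> \<U>" "infinite Z" "X \<lesssim> Z"
  proof -
    obtain W where W: "W \<in> \<U>" "infinite W" using U unfolding universe_def by blast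
    show thesis
    proof (cases "X \<lesssim> W")
      case False
      then have "W \<lesssim> X" using lepoll_total by blast
      then have "infinite X" using W(2) by (meson finite_lepoll_infinite infinite_le_lepoll lepoll_trans)
      then show thesis using that X by blast
    qed (use that W in blast)
  qed
  obtain Y Y' where Y: "Pow Z \<lesssim> Y" "Y \<in> \<U>" "Pow Y \<lesssim> Y'" "Y' \<in> \<U>"
    using U Z(1) unfolding universe_def by meson
  let ?graph = "\<lambda>f. (\<lambda>x. (x, f x)) ` X"
  have "inj_on ?graph \<Phi>"
  proof (rule inj_onI)
    fix f g assume fg: "f \<in> \<Phi>" "g \<in> \<Phi>" "?graph f = ?graph g"
    have "f x = g x" if "x \<in> X" for x
    proof -
      have "(x, f x) \<in> ?graph g" using fg(3) that by blast
      then show ?thesis by auto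
    qed
    then show "f = g" using fg \<Phi> by (intro extensionalityI[of f X g]) auto
  qed
  then have "\<Phi> \<lesssim> Pow (X \<times> (UNIV :: complex set))"
    unfolding lepoll_def by (intro exI[of _ ?graph]) auto
  \<comment> \<open>Both \<open>X\<close> and the complex numbers embed into
    \<open>Pow Z\<close>.\<close>
  also have "\<dots> \<lesssim> Pow (Pow Z \<times> Pow Z)"
    using lepoll_trans[OF Z(3) lepoll_Pow_self] complex_lepoll_Pow[OF Z(2)] by (intro Pow_lepoll_mono times_lepoll_mono)
  also have "\<dots> \<lesssim> Pow (Pow Z)"
    using Z(2) by (intro Pow_lepoll_mono infinite_times_lepoll) simp
  also have "\<dots> \<lesssim> Pow Y" by (rule Pow_lepoll_mono[OF Y(1)])
  also have "\<dots> \<lesssim> Y'" by (rule Y(3))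
  finally obtain j where j: "inj_on j \<Phi>" "j ` \<Phi> \<subseteq> Y'" unfolding lepoll_def by blast
  have "j ` \<Phi> \<in> \<U>"
    using U Y(4) subset_imp_lepoll[OF j(2)] unfolding universe_def by blast
  with j(1) show ?thesis by blast
qed

section \<open>The duality\<close>

lemma bornological_Kstar_cat_simps [simp]:
  "A \<in> Obj (bornological_Kstar_cat \<U>) \<longleftrightarrow> carrier A \<in> \<U> \<and> Kstar_algebra A \<and> bornological A"
  "Hom (bornological_Kstar_cat \<U>) A B = Kstar_hom A B"
  "Ident (bornological_Kstar_cat \<U>) A = (\<lambda>x \<in> carrier A. x)"
  "Comp (bornological_Kstar_cat \<U>) A B C v u = compose (carrier A) v u"
  by (simp_all add: bornological_Kstar_cat_def)

lemma realcompact_kC_cat_simps [simp]: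
  "T \<in> Obj (realcompact_kC_cat \<U>) \<longleftrightarrow> topspace T \<in> \<U> \<and> realcompact_space T \<and> kC_space T"
  "g \<in> Hom (realcompact_kC_cat \<U>) T S \<longleftrightarrow> g \<in> extensional (topspace T) \<and> continuous_map T S g"
  "Ident (realcompact_kC_cat \<U>) T = (\<lambda>t \<in> topspace T. t)"
  "Comp (realcompact_kC_cat \<U>) T S R h g = compose (topspace T) h g"
  by (simp_all add: realcompact_kC_cat_def)

lemma topspace_Kstar_algebra: "Kstar_algebra A \<Longrightarrow> topspace (topo A) = carrier A"
proof -
  assume "Kstar_algebra A"
  then obtain P where "Cstar_topological_algebra A P"
    unfolding Kstar_algebra_def Cstar_topological_algebra_def Cstar_topological_algebra_axioms_def by blast
  then interpret Cstar_topological_algebra A P .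
  show ?thesis by simp
qed

text \<open>With \<open>complex_Kstar\<close> as \<open>C\<close> this pulls characters back along
  \<open>u\<close>.\<close>

lemma Kstar_hom_compose:
  assumes A: "Kstar_algebra A" and u: "u \<in> Kstar_hom A B" and v: "v \<in> Kstar_hom B C"
  shows "compose (carrier A) v u \<in> Kstar_hom A C"
proof -
  interpret involutive_algebra A using A by (simp add: Kstar_algebra_def)
  have "continuous_map (topo A) (topo C) (v \<circ> u)"
    by (rule continuous_map_compose[OF Kstar_homD(8)[OF u] Kstar_homD(8)[OF v]])
  then have "continuous_map (topo A) (topo C) (compose (carrier A) v u)"
    by (rule continuous_map_eq) (simp add: topspace_Kstar_algebra[OF A] compose_def)
  then show ?thesis
    by (intro Kstar_homI) (use Kstar_homD[OF u] Kstar_homD[OF v] in \<open>auto simp: compose_def\<close>)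
qed

lemma category_bornological_Kstar_cat: "category (bornological_Kstar_cat (\<U> :: 'a set set))" (is "category ?X")
proof unfold_locales
  fix A :: "'a top_star_algebra" assume A: "A \<in> Obj ?X"
  then interpret involutive_algebra A by (simp add: Kstar_algebra_def)
  have "continuous_map (topo A) (topo A) (\<lambda>x. x)" by simp
  then have "continuous_map (topo A) (topo A) (\<lambda>x \<in> carrier A. x)"
    by (rule continuous_map_eq) (use A in \<open>simp add: topspace_Kstar_algebra\<close>)
  then show "Ident ?X A \<in> Hom ?X A A"
    by (simp, intro Kstar_homI) simp_all
next
  fix A B C :: "'a top_star_algebra" and f g :: "'a \<Rightarrow> 'a"
  assume "A \<in> Obj ?X" "B \<in> Obj ?X" "C \<in> Obj ?X"
    "f \<in> Hom ?X A B" "g \<in> Hom ?X B C"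
  then show "Comp ?X A B C g f \<in> Hom ?X A C"
    using Kstar_hom_compose[of A f B g C] by simp
next
  fix A B :: "'a top_star_algebra" and f :: "'a \<Rightarrow> 'a"
  assume f: "f \<in> Hom ?X A B"
  have "f \<in> extensional (carrier A)" "\<And>x. x \<in> carrier A \<Longrightarrow> f x \<in> carrier B"
    using Kstar_homD(1,2)[of f A B] f by auto
  then show "Comp ?X A A B f (Ident ?X A) = f"
    "Comp ?X A B B (Ident ?X B) f = f"
    by (auto simp: compose_def extensional_def fun_eq_iff)
next
  fix A B C D :: "'a top_star_algebra" and f g h :: "'a \<Rightarrow> 'a"
  assume "f \<in> Hom ?X A B"
  then have "\<And>x. x \<in> carrier A \<Longrightarrow> f x \<in> carrier B" using Kstar_homD(2)[of f A B] by auto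
  then show "Comp ?X A C D h (Comp ?X A B C g f)
      = Comp ?X A B D (Comp ?X B C D h g) f"
    by (auto simp: compose_def fun_eq_iff)
qed

lemma category_realcompact_kC_cat: "category (realcompact_kC_cat (\<U> :: 'b set set))" (is "category ?Y")
proof unfold_locales
  fix T :: "'b topology"
  have "continuous_map T T (\<lambda>t. t)" by simp
  then show "Ident ?Y T \<in> Hom ?Y T T"
    by (auto intro: continuous_map_eq)
next
  fix T S R :: "'b topology" and g h :: "'b \<Rightarrow> 'b"
  assume "g \<in> Hom ?Y T S" "h \<in> Hom ?Y S R"
  then have "continuous_map T R (h \<circ> g)" using continuous_map_compose by auto
  then show "Comp ?Y T S R h g \<in> Hom ?Y T R"
    by (auto simp: compose_def intro: continuous_map_eq)
next
  fix T S :: "'b topology" and g :: "'b \<Rightarrow> 'b"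
  assume "g \<in> Hom ?Y T S"
  then have "g \<in> extensional (topspace T)" "\<And>t. t \<in> topspace T \<Longrightarrow> g t \<in> topspace S"
    by (auto simp: continuous_map_def)
  then show "Comp ?Y T T S g (Ident ?Y T) = g"
    "Comp ?Y T S S (Ident ?Y S) g = g"
    by (auto simp: compose_def extensional_def fun_eq_iff)
next
  fix T S R Q :: "'b topology" and g h k :: "'b \<Rightarrow> 'b"
  assume "g \<in> Hom ?Y T S"
  then have "\<And>t. t \<in> topspace T \<Longrightarrow> g t \<in> topspace S" by (auto simp: continuous_map_def)
  then show "Comp ?Y T R Q k (Comp ?Y T S R h g)
      = Comp ?Y T S Q (Comp ?Y S R Q k h) g"
    by (auto simp: compose_def fun_eq_iff)
qed

text \<open>The action of \<open>spectrum_functor\<close> on morphisms, but with the two algebras on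
  different types, as comparing an algebra with its copy requires.\<close>

definition spectrum_map ::
    "('a, 'm) top_star_algebra_scheme \<Rightarrow> ('b, 'n) top_star_algebra_scheme \<Rightarrow> ('b \<Rightarrow> 'a) \<Rightarrow> ('a \<Rightarrow> complex) \<Rightarrow> 'b \<Rightarrow> complex" where
  "spectrum_map A B u = (\<lambda>\<phi> \<in> topspace (spectrum A). \<lambda>x \<in> carrier B. \<phi> (u x))"

lemma spectrum_map_apply:
  "\<lbrakk>\<phi> \<in> topspace (spectrum A); x \<in> carrier B\<rbrakk> \<Longrightarrow> spectrum_map A B u \<phi> x = \<phi> (u x)"
  by (simp add: spectrum_map_def)

lemma continuous_spectrum_map:
  assumes B: "Kstar_algebra B" and u: "u \<in> Kstar_hom B A"
  shows "continuous_map (spectrum A) (spectrum B) (spectrum_map A B u)"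
proof (rule continuous_map_into_spectrum)
  show "spectrum_map A B u \<phi> \<in> Kstar_hom B complex_Kstar" if "\<phi> \<in> topspace (spectrum A)" for \<phi>
    using Kstar_hom_compose[OF B u, of \<phi> complex_Kstar] that
    by (simp add: spectrum_map_def compose_def topspace_spectrum)
  show "continuous_map (spectrum A) euclidean (\<lambda>\<phi>. spectrum_map A B u \<phi> x)" if "x \<in> carrier B" for x
    by (rule continuous_map_eq[OF continuous_map_spectrum_eval[OF Kstar_homD(2)[OF u that]]])
      (simp add: spectrum_map_apply that)
qed

lemma spectrum_map_closed:
  "\<lbrakk>Kstar_algebra B; u \<in> Kstar_hom B A; \<phi> \<in> topspace (spectrum A)\<rbrakk>
    \<Longrightarrow> spectrum_map A B u \<phi> \<in> topspace (spectrum B)"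
  using continuous_spectrum_map unfolding continuous_map_def by blast

lemma spectrum_extensional: "\<phi> \<in> topspace (spectrum A) \<Longrightarrow> \<phi> \<in> extensional (carrier A)"
  by (simp add: topspace_spectrum Kstar_hom_def)

lemma spectrum_eqI:
  "\<lbrakk>\<phi> \<in> topspace (spectrum A); \<psi> \<in> topspace (spectrum A); \<And>x. x \<in> carrier A \<Longrightarrow> \<phi> x = \<psi> x\<rbrakk> \<Longrightarrow> \<phi> = \<psi>"
  by (meson extensionalityI spectrum_extensional)

lemma spectrum_map_ident:
  "\<phi> \<in> topspace (spectrum A) \<Longrightarrow> spectrum_map A A (\<lambda>x \<in> carrier A. x) \<phi> = \<phi>"
  by (rule extensionalityI[of _ "carrier A"]) (simp_all add: spectrum_map_def spectrum_extensional)

lemma spectrum_map_compose: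
  assumes "Kstar_algebra B" "u \<in> Kstar_hom B A" "v \<in> Kstar_hom C B" "\<phi> \<in> topspace (spectrum A)"
  shows "spectrum_map A C (compose (carrier C) u v) \<phi> = spectrum_map B C v (spectrum_map A B u \<phi>)"
  using spectrum_map_closed[OF assms(1,2,4)] assms(4) Kstar_homD(2)[OF assms(3)]
  by (auto simp: spectrum_map_def compose_def fun_eq_iff)

lemma on_Hom_spectrum_functor: "on_Hom spectrum_functor A B u = spectrum_map A B u"
  by (simp add: spectrum_functor_def spectrum_map_def)

theorem is_functor_spectrum:
  "is_functor (opposite (bornological_Kstar_cat UNIV)) (realcompact_kC_cat UNIV) spectrum_functor" (is "is_functor ?X ?Y _")
proof (intro is_functor.intro category_opposite category_bornological_Kstar_cat category_realcompact_kC_cat is_functor_axioms.intro)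
  fix A assume "A \<in> Obj ?X"
  then have A: "Kstar_algebra A" "bornological A" by simp_all
  then obtain P where "bornological_Kstar_algebra A P" using bornological_Kstar_algebraI by blast
  then interpret bornological_Kstar_algebra A P .
  show "on_Obj spectrum_functor A \<in> Obj ?Y"
    using realcompact_spectrum kC_spectrum by (simp add: spectrum_functor_def)
  show "on_Hom spectrum_functor A A (Ident ?X A)
      = Ident ?Y (on_Obj spectrum_functor A)"
    unfolding on_Hom_spectrum_functor
    by (rule extensionalityI[of _ "topspace (spectrum A)"])
      (simp_all add: spectrum_functor_def spectrum_map_ident, simp add: spectrum_map_def)
next
  fix A B u
  assume "A \<in> Obj ?X" "B \<in> Obj ?X"
    "u \<in> Hom ?X A B"
  then show "on_Hom spectrum_functor A B u \<in> Hom ?Y (on_Obj spectrum_functor A) (on_Obj spectrum_functor B)"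
    unfolding on_Hom_spectrum_functor
    using continuous_spectrum_map[of B u A]
    by (simp add: spectrum_functor_def) (simp add: spectrum_map_def)
next
  fix A B C u v
  assume *: "A \<in> Obj ?X" "B \<in> Obj ?X"
    "C \<in> Obj ?X" "u \<in> Hom ?X A B"
    "v \<in> Hom ?X B C"
  show "on_Hom spectrum_functor A C (Comp ?X A B C v u)
      = Comp ?Y (on_Obj spectrum_functor A) (on_Obj spectrum_functor B) (on_Obj spectrum_functor C)
          (on_Hom spectrum_functor B C v) (on_Hom spectrum_functor A B u)"
    unfolding on_Hom_spectrum_functor
    using * spectrum_map_compose[of B u A v C]
    by (intro extensionalityI[of _ "topspace (spectrum A)"])
      (simp_all add: spectrum_functor_def compose_def, simp add: spectrum_map_def)
qed

definition cont_map :: "'b topology \<Rightarrow> 'c topology \<Rightarrow> ('b \<Rightarrow> 'c) \<Rightarrow> ('c \<Rightarrow> complex) \<Rightarrow> 'b \<Rightarrow> complex" where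
  "cont_map T S g = (\<lambda>f \<in> carrier (cont_algebra S). \<lambda>t \<in> topspace T. f (g t))"

text \<open>Images of compact sets are compact, so the supremum over \<open>K\<close> of a composite
  with \<open>g\<close> is bounded by the seminorm of the image of \<open>K\<close>.\<close>

lemma cont_map_Kstar_hom:
  assumes g: "continuous_map T S g"
  shows "cont_map T S g \<in> Kstar_hom (cont_algebra S) (cont_algebra T)"
proof -
  interpret S: Cstar_topological_algebra "cont_algebra S" "compact_seminorms S" by (rule Cstar_topological_algebra_cont_algebra)
  interpret T: Cstar_topological_algebra "cont_algebra T" "compact_seminorms T" by (rule Cstar_topological_algebra_cont_algebra)
  have gT: "g t \<in> topspace S" if "t \<in> topspace T" for t using g that by (auto simp: continuous_map_def)
  have car: "cont_map T S g f \<in> carrier (cont_algebra T)" if "f \<in> carrier (cont_algebra S)" for f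
    using continuous_map_compose[OF g cont_algebraD[OF that]] that by (simp add: cont_map_def o_def)
  have "continuous_map (topo (cont_algebra S)) (topo (cont_algebra T)) (cont_map T S g)"
  proof (rule S.continuous_map_le_pmax[OF T.Cstar_topological_algebra_axioms car])
    show "cont_map T S g (x \<ominus>\<^bsub>cont_algebra S\<^esub> y) = cont_map T S g x \<ominus>\<^bsub>cont_algebra T\<^esub> cont_map T S g y"
      if "x \<in> carrier (cont_algebra S)" "y \<in> carrier (cont_algebra S)" for x y
      using that car[OF that(1)] car[OF that(2)] S.minus_closed[OF that] gT
      by (simp add: minus_cont_algebra cong: restrict_cong) (auto simp: cont_map_def minus_cont_algebra fun_eq_iff)
    fix q assume "q \<in> compact_seminorms T"
    then obtain K where K: "compactin T K" "q = sup_seminorm K" by blast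
    have gK: "compactin S (g ` K)" by (rule image_compactin[OF K(1) g])
    have "q (cont_map T S g f) \<le> pmax {sup_seminorm (g ` K)} f" if f: "f \<in> carrier (cont_algebra S)" for f
    proof -
      have "sup_seminorm K (cont_map T S g f) \<le> sup_seminorm (g ` K) f"
        using le_sup_seminorm[OF gK f] sup_seminorm_nonneg[OF gK f] compactin_subset_topspace[OF K(1)] f
        by (subst sup_seminorm_le_iff[OF K(1) car[OF f]]) (auto simp: cont_map_def)
      then show ?thesis using le_pmax[of "{sup_seminorm (g ` K)}" "sup_seminorm (g ` K)" f] K(2) by simp
    qed
    then show "\<exists>F. finite F \<and> F \<subseteq> compact_seminorms S \<and> (\<forall>f \<in> carrier (cont_algebra S). q (cont_map T S g f) \<le> pmax F f)"
      using gK by (intro exI[of _ "{sup_seminorm (g ` K)}"]) auto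
  qed
  then show ?thesis
  proof (rule Kstar_homI[rotated -1])
    show "cont_map T S g \<in> extensional (carrier (cont_algebra S))" by (simp add: cont_map_def)
    show "cont_map T S g f \<in> carrier (cont_algebra T)" if "f \<in> carrier (cont_algebra S)" for f by (rule car[OF that])
  qed (use S.add.m_closed S.m_closed S.one_closed S.sm_closed S.star_closed gT in
      \<open>auto simp: cont_map_def\<close>, (auto simp: cont_algebra_simps gT)+)
qed

lemma on_Hom_cont_functor: "on_Hom cont_functor T S g = cont_map T S g"
  by (simp add: cont_functor_def cont_map_def)

theorem is_functor_cont:
  "is_functor (realcompact_kC_cat UNIV) (opposite (bornological_Kstar_cat UNIV)) cont_functor" (is "is_functor ?Y ?X _")
proof (intro is_functor.intro category_opposite category_bornological_Kstar_cat category_realcompact_kC_cat is_functor_axioms.intro)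
  fix T assume "T \<in> Obj ?Y"
  then show "on_Obj cont_functor T \<in> Obj ?X"
    using Kstar_algebra_cont_algebra[of T] bornological_cont_algebra[of T] by (simp add: cont_functor_def)
  show "on_Hom cont_functor T T (Ident ?Y T) = Ident ?X (on_Obj cont_functor T)"
    unfolding on_Hom_cont_functor
    by (auto simp: cont_functor_def cont_map_def fun_eq_iff carrier_cont_algebra extensional_def)
next
  fix T S g
  assume "g \<in> Hom ?Y T S"
  then show "on_Hom cont_functor T S g \<in> Hom ?X (on_Obj cont_functor T) (on_Obj cont_functor S)"
    unfolding on_Hom_cont_functor using cont_map_Kstar_hom[of T S g] by (simp add: cont_functor_def)
next
  fix T S R g h
  assume g: "g \<in> Hom ?Y T S" and h: "h \<in> Hom ?Y S R"
  have gT: "g t \<in> topspace S" if "t \<in> topspace T" for t using g that by (auto simp: continuous_map_def)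
  have car: "cont_map S R h f \<in> carrier (cont_algebra S)" if "f \<in> carrier (cont_algebra R)" for f
    using Kstar_homD(2)[OF cont_map_Kstar_hom[of S R h] that] h by simp
  show "on_Hom cont_functor T R (Comp ?Y T S R h g)
      = Comp ?X (on_Obj cont_functor T) (on_Obj cont_functor S) (on_Obj cont_functor R)
          (on_Hom cont_functor S R h) (on_Hom cont_functor T S g)"
    unfolding on_Hom_cont_functor
  proof (rule extensionalityI[of _ "carrier (cont_algebra R)"])
    fix f assume f: "f \<in> carrier (cont_algebra R)"
    have "cont_map T S g (cont_map S R h f) = (\<lambda>t \<in> topspace T. cont_map S R h f (g t))"
      using car[OF f] by (simp add: cont_map_def)
    also have "\<dots> = (\<lambda>t \<in> topspace T. f (h (g t)))"
      using f gT by (auto simp: cont_map_def)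
    finally show "cont_map T R (Comp ?Y T S R h g) f
        = Comp ?X (on_Obj cont_functor T) (on_Obj cont_functor S) (on_Obj cont_functor R)
            (cont_map S R h) (cont_map T S g) f"
      using f by (auto simp: cont_functor_def compose_def) (auto simp: cont_map_def)
  qed (simp_all add: cont_map_def cont_functor_def compose_def)
qed

text \<open>Both sides of the naturality square send a character \<open>\<phi>\<close> to
  \<open>\<phi> (u x)\<close>.\<close>

theorem natural_gelfand: "natural_Kstar_iso_double_dual (gelfand :: 'a top_star_algebra \<Rightarrow> _)"
  unfolding natural_Kstar_iso_double_dual_def Let_def
proof (intro conjI ballI)
  fix A :: "'a top_star_algebra" assume "A \<in> Obj (opposite (bornological_Kstar_cat UNIV))"
  then obtain P where "bornological_Kstar_algebra A P" using bornological_Kstar_algebraI[of A] by auto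
  then interpret bornological_Kstar_algebra A P .
  show "Kstar_iso A (on_Obj (comp_functor cont_functor spectrum_functor) A) (gelfand A)"
    using Kstar_iso_gelfand by (simp add: comp_functor_def cont_functor_def spectrum_functor_def)
next
  fix A B :: "'a top_star_algebra" and u :: "'a \<Rightarrow> 'a" and x
  assume B: "B \<in> Obj (opposite (bornological_Kstar_cat UNIV))"
    and u: "u \<in> Hom (opposite (bornological_Kstar_cat UNIV)) A B" and x: "x \<in> carrier B"
  have B': "Kstar_algebra B" and u': "u \<in> Kstar_hom B A"
    using B u by simp_all
  have "gelfand B x \<in> carrier (cont_algebra (spectrum B))"
    using continuous_map_spectrum_eval[OF x] x by (simp add: gelfand_def)
  then have "cont_map (spectrum A) (spectrum B) (spectrum_map A B u) (gelfand B x)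
      = (\<lambda>\<phi> \<in> topspace (spectrum A). gelfand B x (spectrum_map A B u \<phi>))"
    by (simp add: cont_map_def)
  also have "\<dots> = (\<lambda>\<phi> \<in> topspace (spectrum A). \<phi> (u x))"
    using spectrum_map_closed[OF B' u'] x by (auto simp: gelfand_def spectrum_map_apply)
  finally show "gelfand A (u x) = on_Hom (comp_functor cont_functor spectrum_functor) A B u (gelfand B x)"
    using Kstar_homD(2)[OF u' x] x
    by (simp add: comp_functor_def on_Hom_cont_functor on_Hom_spectrum_functor gelfand_def) (simp add: spectrum_functor_def)
qed

text \<open>Both sides of the naturality square evaluate a function at \<open>g t\<close>.\<close>

theorem natural_point_eval: "natural_homeomorphism_double_dual (point_eval :: 'b topology \<Rightarrow> _)"
  unfolding natural_homeomorphism_double_dual_def Let_def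
proof (intro conjI ballI)
  fix T :: "'b topology" assume "T \<in> Obj (realcompact_kC_cat UNIV)"
  then show "homeomorphic_map T (on_Obj (comp_functor spectrum_functor cont_functor) T) (point_eval T)"
    using homeomorphic_map_point_eval[of T] by (simp add: comp_functor_def cont_functor_def spectrum_functor_def)
next
  fix T S :: "'b topology" and g :: "'b \<Rightarrow> 'b" and t
  assume g: "g \<in> Hom (realcompact_kC_cat UNIV) T S" and t: "t \<in> topspace T"
  have "point_eval T t \<in> topspace (spectrum (cont_algebra T))"
    using point_eval_Kstar_hom[OF t] by (simp add: topspace_spectrum)
  then have "spectrum_map (cont_algebra T) (cont_algebra S) (cont_map T S g) (point_eval T t)
      = (\<lambda>f \<in> carrier (cont_algebra S). point_eval T t (cont_map T S g f))"
    by (simp add: spectrum_map_def)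
  also have "\<dots> = point_eval S (g t)"
    using Kstar_homD(2)[OF cont_map_Kstar_hom[of T S g]] g t by (auto simp: point_eval_def) (auto simp: cont_map_def)
  finally show "point_eval S (g t) = on_Hom (comp_functor spectrum_functor cont_functor) T S g (point_eval T t)"
    by (simp add: comp_functor_def on_Hom_cont_functor on_Hom_spectrum_functor) (simp add: cont_functor_def)
qed

section \<open>Equivalence of the small categories\<close>

lemma Kstar_iso_homeomorphic_spectra:
  assumes A: "Kstar_algebra A" and B: "Kstar_algebra B" and u: "Kstar_iso A B u"
  shows "spectrum B homeomorphic_space spectrum A"
proof -
  obtain v where u: "u \<in> Kstar_hom A B" and v: "v \<in> Kstar_hom B A"
    and vu: "\<And>x. x \<in> carrier A \<Longrightarrow> v (u x) = x" and uv: "\<And>y. y \<in> carrier B \<Longrightarrow> u (v y) = y"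
    using assms(3) unfolding Kstar_iso_def by blast
  have "homeomorphic_maps (spectrum B) (spectrum A) (spectrum_map B A u) (spectrum_map A B v)"
    unfolding homeomorphic_maps_def
  proof (intro conjI continuous_spectrum_map A B u v ballI)
    show "spectrum_map A B v (spectrum_map B A u \<phi>) = \<phi>" if \<phi>: "\<phi> \<in> topspace (spectrum B)" for \<phi>
      using spectrum_map_closed[OF A u \<phi>] \<phi>
      by (intro spectrum_eqI[of _ B] spectrum_map_closed[OF B v]) (simp_all add: spectrum_map_apply Kstar_homD(2)[OF v] uv)
    show "spectrum_map B A u (spectrum_map A B v \<phi>) = \<phi>" if \<phi>: "\<phi> \<in> topspace (spectrum A)" for \<phi>
      using spectrum_map_closed[OF B v \<phi>] \<phi>
      by (intro spectrum_eqI[of _ A] spectrum_map_closed[OF A u]) (simp_all add: spectrum_map_apply Kstar_homD(2)[OF u] vu)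
  qed
  then show ?thesis by (auto simp: homeomorphic_space_def)
qed

lemma iso_in_realcompact_kC_cat:
  assumes "T homeomorphic_space S"
  shows "\<exists>e. iso_in (realcompact_kC_cat \<U>) T S e"
proof -
  obtain f g where fg: "homeomorphic_maps T S f g" using assms by (auto simp: homeomorphic_space_def)
  then have f: "continuous_map T S f" and g: "continuous_map S T g" by (auto simp: homeomorphic_maps_def)
  have gf: "g (f t) = t" "f t \<in> topspace S" if "t \<in> topspace T" for t using fg that by (auto simp: homeomorphic_maps_def continuous_map_def)
  have f_g: "f (g s) = s" "g s \<in> topspace T" if "s \<in> topspace S" for s using fg that by (auto simp: homeomorphic_maps_def continuous_map_def)
  have "continuous_map T S (restrict f (topspace T))" "continuous_map S T (restrict g (topspace S))"
    by (rule continuous_map_eq[OF f], simp, rule continuous_map_eq[OF g], simp)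
  moreover have "compose (topspace T) (restrict g (topspace S)) (restrict f (topspace T)) = (\<lambda>t \<in> topspace T. t)"
    "compose (topspace S) (restrict f (topspace T)) (restrict g (topspace S)) = (\<lambda>s \<in> topspace S. s)"
    using gf f_g by (auto simp: compose_def)
  ultimately show ?thesis
    unfolding iso_in_def by (intro exI[of _ "restrict f (topspace T)"] conjI bexI[of _ "restrict g (topspace S)"]) simp_all
qed

lemma (in bornological_Kstar_algebra) Kstar_algebra: "Kstar_algebra A"
  unfolding Kstar_algebra_def
  using involutive_algebra_axioms Cstar_seminorms topo_eq Hausdorff complete by blast

text \<open>For \<open>x\<close> in \<open>B\<close> the function sending \<open>\<phi>\<close> to
  \<open>g \<phi> x\<close> is continuous, hence the transform of an element \<open>u x\<close> of
  \<open>A\<close>. Characters of \<open>A\<close> separate its elements, which gives the algebraic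
  laws; each composite of \<open>p\<close> with \<open>u\<close> is a C*-seminorm on
  \<open>B\<close>, hence continuous.\<close>

lemma (in bornological_Kstar_algebra) spectrum_map_full:
  assumes B: "bornological_Kstar_algebra B Q" and g: "continuous_map (spectrum A) (spectrum B) g"
  shows "\<exists>u \<in> Kstar_hom B A. \<forall>\<phi> \<in> topspace (spectrum A). spectrum_map A B u \<phi> = g \<phi>"
proof -
  interpret B: bornological_Kstar_algebra B Q by fact
  have gs: "g \<phi> \<in> topspace (spectrum B)" if "\<phi> \<in> topspace (spectrum A)" for \<phi>
    using g that by (auto simp: continuous_map_def)
  have "\<exists>y \<in> carrier A. \<forall>\<phi> \<in> topspace (spectrum A). \<phi> y = g \<phi> x" if x: "x \<in> carrier B" for x
    using transform_surjective_continuous[OF continuous_map_compose[OF g continuous_map_spectrum_eval[OF x]]] by (simp add: o_def)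
  then obtain w where w: "\<And>x. x \<in> carrier B \<Longrightarrow> w x \<in> carrier A"
    "\<And>x \<phi>. \<lbrakk>x \<in> carrier B; \<phi> \<in> topspace (spectrum A)\<rbrakk> \<Longrightarrow> \<phi> (w x) = g \<phi> x"
    by metis
  define u where "u = restrict w (carrier B)"
  have u: "u x \<in> carrier A" "\<And>\<phi>. \<phi> \<in> topspace (spectrum A) \<Longrightarrow> \<phi> (u x) = g \<phi> x" if "x \<in> carrier B" for x
    using w that by (simp_all add: u_def)
  note charA = star_charactersD[OF spectrum_star_characters]
  note charB = star_charactersD[OF B.spectrum_star_characters[OF gs]]
  have add: "u (x \<oplus>\<^bsub>B\<^esub> y) = u x \<oplus> u y" if "x \<in> carrier B" "y \<in> carrier B" for x y
    by (rule spectrum_separates) (simp_all add: u that charA charB)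
  have mult: "u (x \<otimes>\<^bsub>B\<^esub> y) = u x \<otimes> u y" if "x \<in> carrier B" "y \<in> carrier B" for x y
    by (rule spectrum_separates) (simp_all add: u that charA charB)
  have one: "u \<one>\<^bsub>B\<^esub> = \<one>"
    by (rule spectrum_separates) (simp_all add: u charA charB)
  have sm: "u (c \<odot>\<^bsub>B\<^esub> x) = c \<odot> u x" if "x \<in> carrier B" for c x
    by (rule spectrum_separates) (simp_all add: u that charA charB)
  have star: "u (star B x) = star A (u x)" if "x \<in> carrier B" for x
    by (rule spectrum_separates) (simp_all add: u that charA charB)
  have "continuous_map (topo B) (topo A) u"
  proof (rule B.continuous_map_le_pmax[OF Cstar_topological_algebra_axioms u(1)])
    show "u (x \<ominus>\<^bsub>B\<^esub> y) = u x \<ominus> u y" if "x \<in> carrier B" "y \<in> carrier B" for x y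
      using that by (simp add: B.minus_eq_sm minus_eq_sm add sm u)
    fix p assume "p \<in> P"
    then interpret p: Cstar_seminormed_algebra A p by (rule P_seminorm)
    have "Cstar_seminorm B (\<lambda>x. p (u x))"
      unfolding Cstar_seminorm_def by (simp add: add mult sm star u p.p_add p.p_sm p.p_mult_star)
    then show "\<exists>F. finite F \<and> F \<subseteq> Q \<and> (\<forall>x \<in> carrier B. p (u x) \<le> pmax F x)"
      by (rule B.Cstar_seminorm_continuous)
  qed
  then have hom: "u \<in> Kstar_hom B A"
    by (intro Kstar_homI add mult one sm star u) (simp_all add: u_def)
  have "spectrum_map A B u \<phi> = g \<phi>" if \<phi>: "\<phi> \<in> topspace (spectrum A)" for \<phi>
    using \<phi> u by (intro spectrum_eqI[of _ B] spectrum_map_closed[OF B.Kstar_algebra hom] gs) (simp_all add: spectrum_map_apply)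
  with hom show ?thesis by blast
qed

text \<open>The functor sends \<open>A\<close> to a small copy \<open>S A\<close> of its spectrum.
  Faithfulness is separation by characters and fullness is \<open>spectrum_map_full\<close>; a space
  \<open>T\<close> is reached up to isomorphism from a small copy of its function algebra, whose
  spectrum is \<open>T\<close> again by realcompactness.\<close>

theorem equivalent_small_categories:
  assumes U: "universe (\<U> :: 'u set set)"
  shows "equivalent_categories (opposite (bornological_Kstar_cat \<U>)) (realcompact_kC_cat \<U>)"
proof -
  let ?X = "opposite (bornological_Kstar_cat \<U>)" and ?Y = "realcompact_kC_cat \<U>"
  have "\<exists>S j k. topspace S \<in> \<U> \<and> homeomorphic_maps (spectrum A) S j k" if A: "A \<in> Obj ?X" for A
  proof -
    have "topspace (spectrum A) \<subseteq> extensional (carrier A)" using spectrum_extensional by blast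
    then obtain j where j: "inj_on j (topspace (spectrum A))" "j ` topspace (spectrum A) \<in> \<U>"
      using universe_functions[OF U, of "carrier A" "topspace (spectrum A)"] A by auto
    show ?thesis using homeomorphic_copy[OF j(1)] j(2) homeomorphic_map_maps by metis
  qed
  then obtain S j k where S: "\<And>A. A \<in> Obj ?X \<Longrightarrow> topspace (S A) \<in> \<U>"
    and maps_jk: "\<And>A. A \<in> Obj ?X \<Longrightarrow> homeomorphic_maps (spectrum A) (S A) (j A) (k A)"
    by metis
  have j: "continuous_map (spectrum A) (S A) (j A)" and k: "continuous_map (S A) (spectrum A) (k A)"
    and k_j: "\<And>\<phi>. \<phi> \<in> topspace (spectrum A) \<Longrightarrow> k A (j A \<phi>) = \<phi>" and j_k: "\<And>s. s \<in> topspace (S A) \<Longrightarrow> j A (k A s) = s"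
    and jc: "\<And>\<phi>. \<phi> \<in> topspace (spectrum A) \<Longrightarrow> j A \<phi> \<in> topspace (S A)" and kc: "\<And>s. s \<in> topspace (S A) \<Longrightarrow> k A s \<in> topspace (spectrum A)"
    if "A \<in> Obj ?X" for A
    using maps_jk[OF that] by (auto simp: homeomorphic_maps_def continuous_map_def)
  have Kstar: "Kstar_algebra A" if "A \<in> Obj ?X" for A
    using that by simp
  define F where "F = \<lparr>on_Obj = S, on_Hom = (\<lambda>A B u. \<lambda>s \<in> topspace (S A). j B (spectrum_map A B u (k A s)))\<rparr>"
  have FO: "on_Obj F = S" and FH: "on_Hom F A B u = (\<lambda>s \<in> topspace (S A). j B (spectrum_map A B u (k A s)))" for A B u
    by (simp_all add: F_def)
  have map_closed: "spectrum_map A B u \<phi> \<in> topspace (spectrum B)"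
    if "A \<in> Obj ?X" "B \<in> Obj ?X" "u \<in> Hom ?X A B" "\<phi> \<in> topspace (spectrum A)" for A B u \<phi>
    using spectrum_map_closed[OF Kstar[OF that(2)], of u A \<phi>] that by simp
  have born: "\<exists>P. bornological_Kstar_algebra A P" if "A \<in> Obj ?X" for A
    using bornological_Kstar_algebraI[of A] that by simp
  have F_functor: "is_functor ?X ?Y F"
  proof (intro is_functor.intro category_opposite category_bornological_Kstar_cat category_realcompact_kC_cat is_functor_axioms.intro)
    fix A assume A: "A \<in> Obj ?X"
    obtain P where "bornological_Kstar_algebra A P" using born[OF A] by blast
    then interpret bornological_Kstar_algebra A P .
    have "spectrum A homeomorphic_space S A" using maps_jk[OF A] by (auto simp: homeomorphic_space_def)
    from homeomorphic_realcompact_space[OF realcompact_spectrum this] homeomorphic_kC_space[OF kC_spectrum this]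
    show "on_Obj F A \<in> Obj ?Y"
      using S[OF A] by (simp add: FO)
    show "on_Hom F A A (Ident ?X A) = Ident ?Y (on_Obj F A)"
      using kc[OF A] j_k[OF A] by (auto simp: FH FO spectrum_map_ident)
  next
    fix A B u assume A: "A \<in> Obj ?X" and B: "B \<in> Obj ?X" and u: "u \<in> Hom ?X A B"
    have "continuous_map (S A) (S B) (j B \<circ> (spectrum_map A B u \<circ> k A))"
      using u by (intro continuous_map_compose[OF continuous_map_compose[OF k[OF A] continuous_spectrum_map[OF Kstar[OF B]]] j[OF B]]) simp
    then have "continuous_map (S A) (S B) (on_Hom F A B u)"
      by (rule continuous_map_eq) (simp add: FH)
    then show "on_Hom F A B u \<in> Hom ?Y (on_Obj F A) (on_Obj F B)" by (simp add: FO, simp add: FH)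
  next
    fix A B C u v assume A: "A \<in> Obj ?X" and B: "B \<in> Obj ?X" and C: "C \<in> Obj ?X" and u: "u \<in> Hom ?X A B" and v: "v \<in> Hom ?X B C"
    have "on_Hom F A C (Comp ?X A B C v u) s = on_Hom F B C v (on_Hom F A B u s)" if s: "s \<in> topspace (S A)" for s
      using spectrum_map_compose[OF Kstar[OF B] _ _ kc[OF A s], of u v C] u v s
        map_closed[OF A B u kc[OF A s]] jc[OF B] k_j[OF B]
      by (simp add: FH)
    then show "on_Hom F A C (Comp ?X A B C v u) = Comp ?Y (on_Obj F A) (on_Obj F B) (on_Obj F C) (on_Hom F B C v) (on_Hom F A B u)"
      by (intro extensionalityI[of _ "topspace (S A)"]) (simp_all add: FO compose_def, simp add: FH)
  qed
  show ?thesis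
  proof (rule equivalent_categoriesI[OF F_functor])
    fix A B u v assume A: "A \<in> Obj ?X" and B: "B \<in> Obj ?X" and u: "u \<in> Hom ?X A B" and v: "v \<in> Hom ?X A B"
      and eq: "on_Hom F A B u = on_Hom F A B v"
    obtain P where "bornological_Kstar_algebra A P" using born[OF A] by blast
    then interpret bornological_Kstar_algebra A P .
    have u': "u \<in> Kstar_hom B A" and v': "v \<in> Kstar_hom B A" using u v by simp_all
    have "u x = v x" if x: "x \<in> carrier B" for x
    proof (rule spectrum_separates[OF Kstar_homD(2)[OF u' x] Kstar_homD(2)[OF v' x]])
      fix \<phi> assume \<phi>: "\<phi> \<in> topspace (spectrum A)"
      have "j B (spectrum_map A B u \<phi>) = j B (spectrum_map A B v \<phi>)"
        using fun_cong[OF eq, of "j A \<phi>"] jc[OF A \<phi>] k_j[OF A \<phi>] by (simp add: FH)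
      then have "spectrum_map A B u \<phi> = spectrum_map A B v \<phi>"
        using k_j[OF B] map_closed[OF A B u \<phi>] map_closed[OF A B v \<phi>] by metis
      then show "\<phi> (u x) = \<phi> (v x)" using \<phi> x by (metis spectrum_map_apply)
    qed
    then show "u = v"
      using Kstar_homD(1)[OF u'] Kstar_homD(1)[OF v'] by (intro extensionalityI[of _ "carrier B"])
  next
    fix A B h assume A: "A \<in> Obj ?X" and B: "B \<in> Obj ?X" and h: "h \<in> Hom ?Y (on_Obj F A) (on_Obj F B)"
    obtain P Q where P: "bornological_Kstar_algebra A P" and Q: "bornological_Kstar_algebra B Q" using born[OF A] born[OF B] by blast
    interpret bornological_Kstar_algebra A P by fact
    have hc: "continuous_map (S A) (S B) h" and he: "h \<in> extensional (topspace (S A))" using h by (simp_all add: FO)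
    have "continuous_map (spectrum A) (spectrum B) (k B \<circ> (h \<circ> j A))"
      by (intro continuous_map_compose[OF continuous_map_compose[OF j[OF A] hc] k[OF B]])
    from spectrum_map_full[OF Q this] obtain u where u: "u \<in> Kstar_hom B A"
      "\<And>\<phi>. \<phi> \<in> topspace (spectrum A) \<Longrightarrow> spectrum_map A B u \<phi> = k B (h (j A \<phi>))" by (auto simp: o_def)
    have "on_Hom F A B u = h"
    proof (rule extensionalityI[OF _ he])
      fix s assume s: "s \<in> topspace (S A)"
      have "h s \<in> topspace (S B)" using hc s by (auto simp: continuous_map_def)
      then show "on_Hom F A B u s = h s"
        using s u(2)[OF kc[OF A s]] j_k[OF A s] j_k[OF B] by (simp add: FH)
    qed (simp add: FH)
    then show "\<exists>u \<in> Hom ?X A B. on_Hom F A B u = h" using u(1) by auto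
  next
    fix T :: "'u topology" assume T: "T \<in> Obj ?Y"
    then obtain P where P: "bornological_Kstar_algebra (cont_algebra T) P"
      using bornological_Kstar_algebraI[OF Kstar_algebra_cont_algebra bornological_cont_algebra, of T] by auto
    interpret C: bornological_Kstar_algebra "cont_algebra T" P by fact
    have "carrier (cont_algebra T) \<subseteq> extensional (topspace T)" by (auto simp: carrier_cont_algebra)
    then obtain i :: "('u \<Rightarrow> complex) \<Rightarrow> 'u" where i: "inj_on i (carrier (cont_algebra T))" "i ` carrier (cont_algebra T) \<in> \<U>"
      using universe_functions[OF U, of "topspace T" "carrier (cont_algebra T)"] T by auto
    let ?B = "copy_algebra (cont_algebra T) P i"
    have B: "?B \<in> Obj ?X"
      using i(2) C.Kstar_copy_algebra[OF i(1)] C.bornological_copy_algebra[OF i(1)]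
      by (simp add: C.copy_algebra_simps(1)[OF i(1)])
    have "S ?B homeomorphic_space spectrum ?B"
      using maps_jk[OF B] by (auto simp: homeomorphic_space_def intro: homeomorphic_maps_sym[THEN iffD1])
    also have "spectrum ?B homeomorphic_space spectrum (cont_algebra T)"
      by (rule Kstar_iso_homeomorphic_spectra[OF C.Kstar_algebra Kstar[OF B] C.Kstar_iso_copy_algebra[OF i(1)]])
    also have "spectrum (cont_algebra T) homeomorphic_space T"
      using T by (subst homeomorphic_space_sym)
        (simp add: homeomorphic_map_imp_homeomorphic_space[OF homeomorphic_map_point_eval])
    finally have "\<exists>e. iso_in ?Y (on_Obj F ?B) T e"
      unfolding FO by (rule iso_in_realcompact_kC_cat)
    then show "\<exists>A \<in> Obj ?X. \<exists>e. iso_in ?Y (on_Obj F A) T e" using B by blast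
  qed
qed

theorem theorem3p5:
  shows
    "is_functor (opposite (bornological_Kstar_cat UNIV)) (realcompact_kC_cat UNIV)
       (spectrum_functor ::
          ('a top_star_algebra, 'a \<Rightarrow> 'a, ('a \<Rightarrow> complex) topology, ('a \<Rightarrow> complex) \<Rightarrow> ('a \<Rightarrow> complex)) cat_functor) \<and>
     is_functor (realcompact_kC_cat UNIV) (opposite (bornological_Kstar_cat UNIV))
       (cont_functor ::
          ('b topology, 'b \<Rightarrow> 'b, ('b \<Rightarrow> complex) top_star_algebra, ('b \<Rightarrow> complex) \<Rightarrow> ('b \<Rightarrow> complex)) cat_functor) \<and>
     (\<exists>\<eta> :: 'a top_star_algebra \<Rightarrow> 'a \<Rightarrow> (('a \<Rightarrow> complex) \<Rightarrow> complex). natural_Kstar_iso_double_dual \<eta>) \<and>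
     (\<exists>\<epsilon> :: 'b topology \<Rightarrow> 'b \<Rightarrow> (('b \<Rightarrow> complex) \<Rightarrow> complex). natural_homeomorphism_double_dual \<epsilon>) \<and>
     (\<forall>\<U> :: 'u set set. universe \<U> \<longrightarrow>
        equivalent_categories (opposite (bornological_Kstar_cat \<U>)) (realcompact_kC_cat \<U>))"
  using is_functor_spectrum is_functor_cont natural_gelfand natural_point_eval equivalent_small_categories by blast

end
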